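(* Let $F$ be a unimodular fan in $V=\Lambda\otimes_{\mathbb Z}\mathbb R$ and let $f\in\mathrm{PP}^k(F)$ be a piecewise polynomial of degree $k$ on $F$. Then there exists a representation $$f=\sum_{\sigma\in F^{(\le k)}}a_\sigma\Psi_\sigma,$$ where the sum runs over all cones $\sigma$ of $F$ of dimension at most $k$ and each $a_\sigma$ is a homogeneous integer polynomial of degree $k-\dim(\sigma)$. In particular, every piecewise polynomial of degree $k$ on a tropical fan cycle $X$ is a sum of products of rational functions on $X$.
   Context: Let $\Lambda$ be a lattice and $V=\Lambda\otimes_{\mathbb Z}\mathbb R$. For a rational cone $\sigma\subset V$ let $V_\sigma$ be its linear span and $\Lambda_\sigma=\Lambda\cap V_\sigma$. A fan $F$ is unimodular if every cone is generated by part of a lattice basis of $\Lambda$. A piecewise polynomial of degree $k$ on a rational fan $F$ (not necessarily complete or pure-dimensional) is a continuous function $f:|F|\to\mathbb R$ whose restriction to each cone $\sigma\in F$ is given by an element of $\mathrm{Sym}^k(\Lambda_\sigma^\vee)$ (a homogeneous polynomial of degree $k$ on $V_\sigma$ with integer coefficients). The group of these is $\mathrm{PP}^k(F)$. A homogeneous integer polynomial of degree $m$ on $F$ is the restriction to $|F|$ of an element of $\mathrm{Sym}^m(\Lambda^\vee)$. For a unimodular fan $F$ with rays $r_1,\dots,r_m$ with primitive integral vectors $v_1,\dots,v_m$, $\Psi_i\in\mathrm{PP}^1(F)$ is the unique function which is linear on the cones of $F$ with $\Psi_i(v_j)=\delta_{ij}$; for a cone $\tau\in F$, $\Psi_\tau:=\prod_{i:v_i\in\tau}\Psi_i\in\mathrm{PP}^{\dim\tau}(F)$.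 A tropical fan is a rational fan of pure dimension $d$ with integer weights on its maximal cones satisfying the balancing condition $\sum_{\sigma>\tau}\omega(\sigma)u_{\sigma/\tau}=0\in V/V_\tau$ for every cone $\tau$ of dimension $d-1$, where $u_{\sigma/\tau}$ is the primitive normal vector of $\sigma$ relative to $\tau$. A fan cycle $X$ is the class of a tropical fan modulo refinement (cones of weight $0$ disregarded); a representative is called a fan structure of $X$, and $|X|$ is its support. A piecewise polynomial of degree $k$ on $X$ is an element of $\mathrm{PP}^k(X):=\{f: f\in\mathrm{PP}^k(\mathcal X)\text{ for some fan structure }\mathcal X\text{ of }X\}$. The rational functions here are rational fan functions, i.e. elements of $\mathrm{PP}^1(X)$: functions $|X|\to\mathbb R$ that are integer linear on the cones of some fan structure of $X$. *)

theory Defs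
  imports "HOL-Analysis.Analysis"
begin

section \<open>Lattices and integer polynomials\<close>

definition int_span :: "'a::real_vector set \<Rightarrow> 'a set" where
  "int_span B = {\<Sum>b\<in>B. of_int (c b) *\<^sub>R b | c :: 'a \<Rightarrow> int. True}"

definition lattice_basis :: "'a::euclidean_space set \<Rightarrow> 'a set \<Rightarrow> bool" where
  "lattice_basis L B \<longleftrightarrow> independent B \<and> L = int_span B"

text \<open>
  A lattice is realised inside a Euclidean space. It need not have full rank there: the vector
  space spanned over the reals is \<open>span L\<close>, and every cone below lies in \<open>span L\<close>.
  In this way rank \<open>0\<close> is included although Euclidean types have positive dimension.
\<close>
definition is_lattice :: "'a::euclidean_space set \<Rightarrow> bool" where
  "is_lattice L \<longleftrightarrow> (\<exists>B. lattice_basis L B)"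

text \<open>
  The elements of the dual of \<open>M\<close> are represented by linear forms on the ambient
  space, of which only the restriction to \<open>span M\<close> is relevant. Likewise for the symmetric
  powers, regarded as groups of polynomial functions on \<open>span M\<close>: the additive group
  generated by the products of \<open>k\<close> elements of the dual (all integers if \<open>k = 0\<close>).
\<close>
definition dual_lattice :: "'a::euclidean_space set \<Rightarrow> ('a \<Rightarrow> real) set" where
  "dual_lattice M = {l. linear l \<and> (\<forall>x\<in>M. l x \<in> \<int>)}"

inductive_set sym_power :: "nat \<Rightarrow> 'a::euclidean_space set \<Rightarrow> ('a \<Rightarrow> real) set"
  for k :: nat and M :: "'a set" where
  prod: "(\<And>j. j < k \<Longrightarrow> l j \<in> dual_lattice M) \<Longrightarrow> (\<lambda>x. \<Prod>j<k. l j x) \<in> sym_power k M"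
| diff: "p \<in> sym_power k M \<Longrightarrow> q \<in> sym_power k M \<Longrightarrow> (\<lambda>x. p x - q x) \<in> sym_power k M"


section \<open>Rational fans\<close>

text \<open>Rational cones need not be pointed. Note that \<open>convex_cone hull {} = {0}\<close>.\<close>
definition rational_cone :: "'a::euclidean_space set \<Rightarrow> 'a set \<Rightarrow> bool" where
  "rational_cone L \<sigma> \<longleftrightarrow> (\<exists>S. finite S \<and> S \<subseteq> L \<and> \<sigma> = convex_cone hull S)"

definition rational_fan :: "'a::euclidean_space set \<Rightarrow> 'a set set \<Rightarrow> bool" where
  "rational_fan L F \<longleftrightarrow>
     finite F \<and>
     (\<forall>\<sigma>\<in>F. rational_cone L \<sigma>) \<and>
     (\<forall>\<sigma>\<in>F. \<forall>\<tau>. \<tau> face_of \<sigma> \<and> \<tau> \<noteq> {} \<longrightarrow> \<tau> \<in> F) \<and>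
     (\<forall>\<sigma>\<in>F. \<forall>\<tau>\<in>F. \<sigma> \<inter> \<tau> face_of \<sigma> \<and> \<sigma> \<inter> \<tau> face_of \<tau>)"

definition unimodular_fan :: "'a::euclidean_space set \<Rightarrow> 'a set set \<Rightarrow> bool" where
  "unimodular_fan L F \<longleftrightarrow>
     rational_fan L F \<and>
     (\<forall>\<sigma>\<in>F. \<exists>B S. lattice_basis L B \<and> S \<subseteq> B \<and> \<sigma> = convex_cone hull S)"


section \<open>Piecewise polynomials\<close>

text \<open>
  Functions on the support \<open>\<Union>F\<close> are represented by total functions whose values outside
  \<open>\<Union>F\<close> are irrelevant.
\<close>
definition PP :: "'a::euclidean_space set \<Rightarrow> nat \<Rightarrow> 'a set set \<Rightarrow> ('a \<Rightarrow> real) set" where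
  "PP L k F = {f. continuous_on (\<Union>F) f \<and>
                  (\<forall>\<sigma>\<in>F. \<exists>p \<in> sym_power k (L \<inter> span \<sigma>). \<forall>x\<in>\<sigma>. f x = p x)}"

definition rays :: "'a::euclidean_space set set \<Rightarrow> 'a set set" where
  "rays F = {r \<in> F. dim r = 1}"

definition primitive_vector :: "'a::euclidean_space set \<Rightarrow> 'a set \<Rightarrow> 'a" where
  "primitive_vector L r =
     (THE v. v \<in> L \<inter> r \<and> v \<noteq> 0 \<and> (\<forall>w \<in> L \<inter> r. \<exists>n::nat. w = of_nat n *\<^sub>R v))"

text \<open>The value \<open>0\<close> outside the support is fixed only to make the function unique.\<close>
definition Psi :: "'a::euclidean_space set \<Rightarrow> 'a set set \<Rightarrow> 'a set \<Rightarrow> 'a \<Rightarrow> real" where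
  "Psi L F r = (THE g. g \<in> PP L 1 F \<and>
     (\<forall>r' \<in> rays F. g (primitive_vector L r') = (if r' = r then 1 else 0)) \<and>
     (\<forall>x. x \<notin> \<Union>F \<longrightarrow> g x = 0))"

definition Psi_cone :: "'a::euclidean_space set \<Rightarrow> 'a set set \<Rightarrow> 'a set \<Rightarrow> 'a \<Rightarrow> real" where
  "Psi_cone L F \<tau> x = (\<Prod>r \<in> {r \<in> rays F. primitive_vector L r \<in> \<tau>}. Psi L F r x)"


section \<open>Tropical fans and fan cycles\<close>

definition maximal_cones :: "'a set set \<Rightarrow> 'a set set" where
  "maximal_cones F = {\<sigma> \<in> F. \<forall>\<sigma>'\<in>F. \<sigma> \<subseteq> \<sigma>' \<longrightarrow> \<sigma>' = \<sigma>}"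

definition pure_dimensional :: "nat \<Rightarrow> 'a::euclidean_space set set \<Rightarrow> bool" where
  "pure_dimensional d F \<longleftrightarrow> (\<forall>\<sigma> \<in> maximal_cones F. dim \<sigma> = d)"

text \<open>
  A representative in \<open>L \<inter> span \<sigma>\<close> of the primitive normal vector of \<open>\<sigma>\<close> relative to its facet
  \<open>\<tau>\<close>: the class modulo \<open>L \<inter> span \<tau>\<close> that generates the quotient lattice and
  points to the side of \<open>\<sigma>\<close>.
\<close>
definition normal_vector :: "'a::euclidean_space set \<Rightarrow> 'a set \<Rightarrow> 'a set \<Rightarrow> 'a" where
  "normal_vector L \<sigma> \<tau> =
     (SOME u. u \<in> L \<inter> span \<sigma> \<and>
        (\<forall>w \<in> L \<inter> span \<sigma>. \<exists>n::int. w - of_int n *\<^sub>R u \<in> span \<tau>) \<and>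
        (\<exists>x\<in>\<sigma>. u - x \<in> span \<tau>))"

type_synonym 'a weighted_fan = "'a set set \<times> ('a set \<Rightarrow> int)"

text \<open>
  The weight function matters on maximal cones only. An equation in the quotient of the vector
  space by \<open>span \<tau>\<close> is expressed by membership in \<open>span \<tau>\<close>.
\<close>
definition balanced :: "'a::euclidean_space set \<Rightarrow> nat \<Rightarrow> 'a weighted_fan \<Rightarrow> bool" where
  "balanced L d = (\<lambda>(F, \<omega>). \<forall>\<tau>\<in>F. Suc (dim \<tau>) = d \<longrightarrow>
     (\<Sum>\<sigma> \<in> {\<sigma> \<in> maximal_cones F. \<tau> \<subseteq> \<sigma>}. of_int (\<omega> \<sigma>) *\<^sub>R normal_vector L \<sigma> \<tau>) \<in> span \<tau>)"

definition tropical_fans :: "'a::euclidean_space set \<Rightarrow> nat \<Rightarrow> 'a weighted_fan set" where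
  "tropical_fans L d =
     {(F, \<omega>). rational_fan L F \<and> pure_dimensional d F \<and> balanced L d (F, \<omega>)}"

text \<open>The fan that remains when maximal cones of weight \<open>0\<close> are disregarded.\<close>
definition essential_fan :: "'a weighted_fan \<Rightarrow> 'a set set" where
  "essential_fan = (\<lambda>(F, \<omega>). {\<tau> \<in> F. \<exists>\<sigma> \<in> maximal_cones F. \<omega> \<sigma> \<noteq> 0 \<and> \<tau> \<subseteq> \<sigma>})"

definition refinement :: "'a weighted_fan \<Rightarrow> 'a weighted_fan \<Rightarrow> bool" where
  "refinement Y X \<longleftrightarrow>
     \<Union>(essential_fan Y) = \<Union>(essential_fan X) \<and>
     (\<forall>\<sigma> \<in> essential_fan Y. \<exists>\<sigma>' \<in> essential_fan X. \<sigma> \<subseteq> \<sigma>') \<and>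
     (\<forall>\<sigma> \<in> maximal_cones (essential_fan Y). \<forall>\<sigma>' \<in> maximal_cones (essential_fan X).
        \<sigma> \<subseteq> \<sigma>' \<longrightarrow> snd Y \<sigma> = snd X \<sigma>')"

definition fan_equiv ::
  "'a::euclidean_space set \<Rightarrow> nat \<Rightarrow> ('a weighted_fan \<times> 'a weighted_fan) set" where
  "fan_equiv L d = {(X, Y). X \<in> tropical_fans L d \<and> Y \<in> tropical_fans L d \<and>
     (\<exists>Z \<in> tropical_fans L d. refinement Z X \<and> refinement Z Y)}"

text \<open>A fan cycle is thus the set of its fan structures.\<close>
definition fan_cycles :: "'a::euclidean_space set \<Rightarrow> nat \<Rightarrow> 'a weighted_fan set set" where
  "fan_cycles L d = tropical_fans L d // fan_equiv L d"

text \<open>All fan structures of a cycle have the same support, so the union is that support.\<close>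
definition cycle_support :: "'a weighted_fan set \<Rightarrow> 'a set" where
  "cycle_support C = (\<Union>X\<in>C. \<Union>(essential_fan X))"

definition PP_cycle ::
  "'a::euclidean_space set \<Rightarrow> nat \<Rightarrow> 'a weighted_fan set \<Rightarrow> ('a \<Rightarrow> real) set" where
  "PP_cycle L k C = (\<Union>X\<in>C. PP L k (essential_fan X))"

end

(*
The common tool is to correct a representation cone by cone.

On a unimodular fan, order the cones so that faces come first. The error left on a cone by the smaller
cones is a polynomial that vanishes on all facets, hence it is divisible by the product of the dual
coordinates, that is, by Psi of the cone; and Psi of the cone vanishes on all cones not containing it.

For a cycle no resolution of singularities is needed. Call a function integral piecewise linear if it
is obtained from integral linear forms by differences and maxima. Every cone Q of a rational fan is the
image of a retraction phi of the support with integral piecewise linear components that maps every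
cone t of the fan into the intersection of Q and t: convexity of these intersections allows one to
extend phi cone by cone. If f - g vanishes on some cones and is equal to e on Q, then
g + e o phi equals f on Q and still on these cones. Hence f is a sum of products of integral piecewise
linear functions, and each of these becomes linear on the cones after the fan structure has been cut
along finitely many rational hyperplanes, which preserves balancing.
*)
theory Submission
  imports Defs "HOL-Computational_Algebra.Polynomial"
begin

section \<open>Lattices\<close>

text \<open>Integrality is the obstacle throughout: no step may introduce denominators. On a
  unimodular cone the coordinates are integral forms \<open>l\<close> that come with a lattice
  vector \<open>v\<close> such that \<open>l v = 1\<close>, so a polynomial can be divided by
  \<open>l\<close> without denominators. Vanishing on a facet suffices for that: the facet is a cone
  of full dimension in the hyperplane \<open>l = 0\<close>, and a polynomial that vanishes there
  vanishes on the hyperplane. If a cone has more generators than the degree, the successive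
  quotients end in a constant that must be 0, so the error vanishes.

  A general rational cone has no such coordinates, and interpolation between its generators would
  produce fractions. The substitutes are a splitting of L along the span of a cone, and an estimate
  of a piecewise linear e by \<open>N * D\<close> with a natural number N, valid on a cone where D
  is nonnegative and each zero of D is a zero of e. Truncation at \<open>N * D\<close> then changes
  a function away from the zeros of D by integral operations only. The retraction has to map t into
  the intersection of Q and t because that is where the error e is known to vanish.\<close>

lemma linear_eqE:
  fixes l :: "'a::real_vector \<Rightarrow> real"
  assumes "linear l"
  shows "l (x + y) = l x + l y" "l (x - y) = l x - l y" "l (c *\<^sub>R x) = c * l x" "l 0 = 0" "l (- x) = - l x"
  using assms by (simp_all add: linear_add linear_diff linear_scale linear_0 linear_neg)

lemma linear_scaleR_const:
  fixes l :: "'a::real_vector \<Rightarrow> real"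
  shows "linear l \<Longrightarrow> linear (\<lambda>x. l x *\<^sub>R v)"
  by (intro linearI) (simp_all add: linear_eqE scaleR_add_left)

lemma biorthogonal_forms:
  fixes S :: "'a::real_vector set"
  assumes "independent S"
  obtains l :: "'a \<Rightarrow> 'a \<Rightarrow> real"
  where "\<And>s. linear (l s)" "\<And>s t. t \<in> S \<Longrightarrow> l s t = (if t = s then 1 else 0)"
proof -
  have "\<forall>s. \<exists>l. linear l \<and> (\<forall>t\<in>S. l t = (if t = s then 1 else (0::real)))"
    by (intro allI linear_independent_extend[OF assms])
  then show ?thesis using that by metis
qed

lemma biorthogonal_expansion:
  fixes S :: "'a::real_vector set" and l :: "'a \<Rightarrow> 'a \<Rightarrow> real"
  assumes "finite S" and l: "\<forall>s\<in>S. linear (l s)"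
    and dual: "\<forall>s\<in>S. \<forall>t\<in>S. l s t = (if t = s then 1 else 0)" and "x \<in> span S"
  shows "x = (\<Sum>s\<in>S. l s x *\<^sub>R s)"
proof -
  have "linear (\<lambda>x. \<Sum>s\<in>S. l s x *\<^sub>R s)"
    using l by (intro linear_compose_sum ballI linear_scaleR_const) blast
  moreover have "(\<Sum>s\<in>S. l s t *\<^sub>R s) = t" if "t \<in> S" for t
  proof -
    have "(\<Sum>s\<in>S. l s t *\<^sub>R s) = (\<Sum>s\<in>S. if s = t then s else 0)"
      using that dual by (intro sum.cong) auto
    then show ?thesis using that assms(1) by simp
  qed
  ultimately show ?thesis
    using linear_eq_on_span[of id "\<lambda>x. \<Sum>s\<in>S. l s x *\<^sub>R s" S x] assms(4) by (auto simp: linear_id)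
qed

lemma dual_latticeD:
  assumes "l \<in> dual_lattice M"
  shows "linear l" "x \<in> M \<Longrightarrow> l x \<in> \<int>"
  using assms by (auto simp: dual_lattice_def)

lemma dual_lattice_zero: "(\<lambda>x. 0) \<in> dual_lattice M"
  by (simp add: dual_lattice_def linear_zero)

lemma dual_lattice_diff:
  "l \<in> dual_lattice M \<Longrightarrow> l' \<in> dual_lattice M \<Longrightarrow> (\<lambda>x. l x - l' x) \<in> dual_lattice M"
  by (auto simp: dual_lattice_def intro: linear_compose_sub)

lemma dual_lattice_scale:
  "l \<in> dual_lattice M \<Longrightarrow> c \<in> \<int> \<Longrightarrow> (\<lambda>x. c * l x) \<in> dual_lattice M"
  using linear_compose_scale_right[of l c] by (auto simp: dual_lattice_def)

lemma dual_lattice_neg: "l \<in> dual_lattice M \<Longrightarrow> (\<lambda>x. - l x) \<in> dual_lattice M"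
  by (auto simp: dual_lattice_def intro: linear_compose_neg)

lemma dual_lattice_mono: "M \<subseteq> M' \<Longrightarrow> dual_lattice M' \<subseteq> dual_lattice M"
  by (auto simp: dual_lattice_def)

lemma dual_lattice_compose:
  "l \<in> dual_lattice M \<Longrightarrow> linear h \<Longrightarrow> (\<And>x. x \<in> M' \<Longrightarrow> h x \<in> M) \<Longrightarrow> (\<lambda>x. l (h x)) \<in> dual_lattice M'"
  using linear_compose[of h l] by (auto simp: dual_lattice_def o_def)

lemma dual_basis:
  assumes "lattice_basis L B" "b \<in> B"
  obtains l where "l \<in> dual_lattice L" "\<And>c. c \<in> B \<Longrightarrow> l c = (if c = b then 1 else 0)"
proof -
  have B: "independent B" "L = int_span B"
    using assms by (auto simp: lattice_basis_def)
  obtain l where l: "linear l" "\<forall>c\<in>B. l c = (if c = b then 1 else (0::real))"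
    using linear_independent_extend[OF B(1), of "\<lambda>c. if c = b then 1 else 0"] by blast
  have "l (\<Sum>c\<in>B. of_int (k c) *\<^sub>R c) \<in> \<int>" for k :: "'a \<Rightarrow> int"
    using l by (auto simp: linear_sum linear_scale intro!: Ints_sum)
  then have "l \<in> dual_lattice L"
    using l(1) by (auto simp: dual_lattice_def B int_span_def)
  then show ?thesis using l that by blast
qed

lemma int_span_superset:
  assumes "finite B"
  shows "B \<subseteq> int_span B"
proof
  fix b assume "b \<in> B"
  then have "b = (\<Sum>c\<in>B. if c = b then c else 0)"
    using assms by simp
  also have "\<dots> = (\<Sum>c\<in>B. of_int (if c = b then 1 else 0) *\<^sub>R c)"
    by (intro sum.cong) auto
  finally have "b = (\<Sum>c\<in>B. of_int (if c = b then 1 else 0) *\<^sub>R c)" .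
  then show "b \<in> int_span B" unfolding int_span_def
    by (auto intro!: exI[of _ "\<lambda>c. if c = b then 1 else 0"])
qed

lemma lattice_basis_subset:
  assumes "lattice_basis L B"
  shows "finite B" "B \<subseteq> L" "independent B"
  using assms int_span_superset[of B] independent_imp_finite[of B] by (auto simp: lattice_basis_def)

lemma int_span_subset_span: "int_span B \<subseteq> span B"
  unfolding int_span_def by (auto intro!: span_sum span_scale intro: span_base)

section \<open>Lattice points, primitive forms and integral projections\<close>

locale euclidean_lattice =
  fixes L :: "'a::euclidean_space set"
  assumes is_lattice: "is_lattice L"
begin

lemma lattice_zero [simp]: "0 \<in> L"
proof -
  obtain B where B: "L = int_span B"
    using is_lattice by (auto simp: is_lattice_def lattice_basis_def)
  show ?thesis unfolding B int_span_def by (auto intro!: exI[of _ "\<lambda>_. 0"])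
qed

lemma lattice_diff:
  assumes "x \<in> L" "y \<in> L"
  shows "x - y \<in> L"
proof -
  obtain B where B: "L = int_span B"
    using is_lattice by (auto simp: is_lattice_def lattice_basis_def)
  obtain c d where "x = (\<Sum>b\<in>B. of_int (c b) *\<^sub>R b)" "y = (\<Sum>b\<in>B. of_int (d b) *\<^sub>R b)"
    using assms by (auto simp: B int_span_def)
  then have "x - y = (\<Sum>b\<in>B. of_int (c b - d b) *\<^sub>R b)"
    by (simp add: sum_subtractf scaleR_diff_left)
  then show ?thesis unfolding B int_span_def by (auto intro!: exI[of _ "\<lambda>b. c b - d b"])
qed

lemma lattice_scale:
  assumes "x \<in> L" "n \<in> \<int>"
  shows "n *\<^sub>R x \<in> L"
proof -
  obtain B where B: "L = int_span B"
    using is_lattice by (auto simp: is_lattice_def lattice_basis_def)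
  obtain c where "x = (\<Sum>b\<in>B. of_int (c b) *\<^sub>R b)"
    using assms by (auto simp: B int_span_def)
  moreover obtain m where "n = of_int m" using assms(2) Ints_cases by blast
  ultimately have "n *\<^sub>R x = (\<Sum>b\<in>B. of_int (m * c b) *\<^sub>R b)"
    by (simp add: scaleR_sum_right)
  then show ?thesis unfolding B int_span_def by (auto intro!: exI[of _ "\<lambda>b. m * c b"])
qed

lemma lattice_add: "x \<in> L \<Longrightarrow> y \<in> L \<Longrightarrow> x + y \<in> L"
  using lattice_diff[of x "0 - y"] lattice_diff[of 0 y] by simp

lemma lattice_sum: "(\<And>i. i \<in> I \<Longrightarrow> f i \<in> L) \<Longrightarrow> sum f I \<in> L"
  by (induction I rule: infinite_finite_induct) (auto intro: lattice_add)

text \<open>L need not have full rank, so these coordinates replace those of the ambient space. They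
  are integral on L and determine a point within \<open>span L\<close>.\<close>

lemma lattice_coords:
  obtains B l where "finite B" "B \<subseteq> L" "\<And>b. b \<in> B \<Longrightarrow> l b \<in> dual_lattice L"
    "\<And>x. x \<in> span L \<Longrightarrow> x = (\<Sum>b\<in>B. l b x *\<^sub>R b)"
proof -
  obtain B where B: "lattice_basis L B"
    using is_lattice by (auto simp: is_lattice_def)
  note B' = lattice_basis_subset[OF B]
  have "\<forall>b\<in>B. \<exists>l. l \<in> dual_lattice L \<and> (\<forall>c\<in>B. l c = (if c = b then 1 else 0))"
    using dual_basis[OF B] by metis
  then obtain l where l: "\<And>b. b \<in> B \<Longrightarrow> l b \<in> dual_lattice L"
    "\<And>b c. b \<in> B \<Longrightarrow> c \<in> B \<Longrightarrow> l b c = (if c = b then 1 else 0)"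
    by metis
  have "x = (\<Sum>b\<in>B. l b x *\<^sub>R b)" if "x \<in> span L" for x
  proof -
    have "span L \<subseteq> span B"
      using B int_span_subset_span[of B] by (auto simp: lattice_basis_def intro: span_minimal[THEN subsetD])
    with that have "x \<in> span B" by blast
    moreover have "\<forall>b\<in>B. linear (l b)" using l(1) dual_latticeD(1) by blast
    ultimately show ?thesis using biorthogonal_expansion[OF B'(1), of l x] l(2) by blast
  qed
  then show ?thesis using that B' l(1) by blast
qed

text \<open>Boundedness leaves finitely many integral values for each lattice coordinate.\<close>

lemma finite_lattice_bounded:
  assumes "bounded A"
  shows "finite (L \<inter> A)"
proof -
  obtain B l where Bl: "finite B" "B \<subseteq> L" "\<And>b. b \<in> B \<Longrightarrow> l b \<in> dual_lattice L"
    "\<And>x. x \<in> span L \<Longrightarrow> x = (\<Sum>b\<in>B. l b x *\<^sub>R b)"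
    using lattice_coords by metis
  have "\<exists>N. \<forall>x\<in>A. \<bar>l b x\<bar> \<le> N" if "b \<in> B" for b
  proof -
    have "bounded_linear (l b)"
      using dual_latticeD(1)[OF Bl(3)[OF that]] by (simp add: linear_conv_bounded_linear)
    then have "bounded (l b ` A)" using assms by (rule bounded_linear_image[rotated])
    then show ?thesis by (auto simp: bounded_iff)
  qed
  then obtain N where N: "\<And>b x. b \<in> B \<Longrightarrow> x \<in> A \<Longrightarrow> \<bar>l b x\<bar> \<le> N b"
    by metis
  let ?\<Phi> = "\<lambda>x. restrict (\<lambda>b. l b x) B"
  have "inj_on ?\<Phi> (L \<inter> A)"
  proof (rule inj_onI)
    fix x y assume xy: "x \<in> L \<inter> A" "y \<in> L \<inter> A" and eq: "?\<Phi> x = ?\<Phi> y"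
    have "l b x = l b y" if "b \<in> B" for b
      using fun_cong[OF eq, of b] that by simp
    then show "x = y"
      using Bl(4)[of x] Bl(4)[of y] xy by (simp add: span_base)
  qed
  moreover have "?\<Phi> ` (L \<inter> A) \<subseteq> Pi\<^sub>E B (\<lambda>b. {k\<in>\<int>. \<bar>k\<bar> \<le> N b})"
    using N dual_latticeD(2)[OF Bl(3)] by auto
  moreover have "finite (Pi\<^sub>E B (\<lambda>b. {k::real \<in>\<int>. \<bar>k\<bar> \<le> N b}))"
    using Bl(1) finite_abs_int_segment by (intro finite_PiE)
  ultimately show ?thesis
    by (rule inj_on_finite)
qed

text \<open>The values of a linear form with kernel \<open>W\<close> on the lattice points form a discrete group:
  modulo the lattice points of \<open>W\<close>, values in \<open>[0, 1]\<close> are attained on a bounded set.\<close>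
lemma primitive_form:
  assumes W: "W = span (L \<inter> W)" and u: "u \<in> L" "u \<notin> W"
  obtains l v where "l \<in> dual_lattice (L \<inter> span (insert u W))" "\<And>x. x \<in> W \<Longrightarrow> l x = 0"
    "v \<in> L \<inter> span (insert u W)" "l v = 1" "l u > 0"
    "\<And>x. x \<in> span (insert u W) \<Longrightarrow> x - l x *\<^sub>R v \<in> W"
proof -
  let ?M = "L \<inter> span (insert u W)"
  obtain T where T: "T \<subseteq> L \<inter> W" "independent T" "L \<inter> W \<subseteq> span T"
    using maximal_independent_subset[of "L \<inter> W"] by blast
  have spT: "span T = W"
    using T W by (metis span_minimal span_mono subspace_span subset_antisym)
  have finT: "finite T" using T(2) independent_imp_finite by blast
  have uT: "u \<notin> span T" using u spT by simp
  then have indU: "independent (insert u T)" using T(2) independent_insertI by blast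
  have uT': "u \<notin> T" using uT span_base by blast
  have spU: "span (insert u T) = span (insert u W)"
  proof (rule subset_antisym)
    show "span (insert u T) \<subseteq> span (insert u W)"
      using T(1) by (intro span_mono) auto
    have "span T \<subseteq> span (insert u T)" by (intro span_mono) auto
    then have "insert u W \<subseteq> span (insert u T)" using spT by (simp add: span_base)
    then show "span (insert u W) \<subseteq> span (insert u T)" by (rule span_minimal) simp
  qed
  obtain c where c: "\<And>t. linear (c t)"
    "\<And>t x. x \<in> insert u T \<Longrightarrow> c t x = (if x = t then 1 else (0::real))"
    using biorthogonal_forms[OF indU] by metis
  \<comment> \<open>The coordinate of u in the basis formed by u and T. It vanishes on W, but its
    values at lattice points may be fractions; rescaling by \<open>1 / g\<close> repairs
    this.\<close>
  define l0 where "l0 = c u"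
  have l0: "linear l0" "\<forall>x\<in>insert u T. l0 x = (if x = u then 1 else 0)"
    unfolding l0_def using c by auto
  have l0W: "l0 x = 0" if "x \<in> W" for x
    using linear_eq_0_on_span[OF l0(1), of T x] l0(2) uT' that spT by (metis insertCI)
  have expand: "x = l0 x *\<^sub>R u + (\<Sum>t\<in>T. c t x *\<^sub>R t)" if "x \<in> span (insert u W)" for x
    using biorthogonal_expansion[of "insert u T" c x] finT uT' c that spU by (simp add: l0_def)
  have Mdiff: "x - n *\<^sub>R y \<in> ?M" if "x \<in> ?M" "y \<in> ?M" "n \<in> \<int>" for x y n
    using that by (auto intro: lattice_diff lattice_scale span_diff span_scale)
  define R where "R = norm u + (\<Sum>t\<in>T. norm t)"
  define G where "G = l0 ` (?M) \<inter> {0<..1}"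
  have "G \<subseteq> l0 ` (L \<inter> cball 0 R)"
  proof
    fix g assume "g \<in> G"
    then obtain x where x: "x \<in> ?M" "g = l0 x" "0 < l0 x" "l0 x \<le> 1" by (auto simp: G_def)
    \<comment> \<open>Removing the integer parts of the T-coordinates keeps the value of
      \<open>l0\<close> and leaves fractional parts, whence the bound R.\<close>
    define x' where "x' = x - (\<Sum>t\<in>T. of_int \<lfloor>c t x\<rfloor> *\<^sub>R t)"
    have s: "(\<Sum>t\<in>T. of_int \<lfloor>c t x\<rfloor> *\<^sub>R t) \<in> L"
      using T(1) by (intro lattice_sum lattice_scale) auto
    have s2: "(\<Sum>t\<in>T. of_int \<lfloor>c t x\<rfloor> *\<^sub>R t) \<in> W"
      unfolding spT[symmetric] by (intro span_sum span_scale span_base)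
    have "x' \<in> L" using s x(1) by (auto simp: x'_def intro: lattice_diff)
    moreover have "l0 x' = l0 x" using l0W[OF s2] by (simp add: x'_def linear_eqE[OF l0(1)])
    moreover have "x' \<in> cball 0 R"
    proof -
      have "x' = l0 x *\<^sub>R u + (\<Sum>t\<in>T. frac (c t x) *\<^sub>R t)"
      proof -
        have "x' = (l0 x *\<^sub>R u + (\<Sum>t\<in>T. c t x *\<^sub>R t)) - (\<Sum>t\<in>T. of_int \<lfloor>c t x\<rfloor> *\<^sub>R t)"
          unfolding x'_def using expand[of x] x(1) by simp
        then show ?thesis by (simp add: frac_def scaleR_diff_left sum_subtractf)
      qed
      then have "norm x' \<le> norm (l0 x *\<^sub>R u) + norm (\<Sum>t\<in>T. frac (c t x) *\<^sub>R t)"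
        by (metis norm_triangle_ineq)
      also have "\<dots> \<le> norm u + (\<Sum>t\<in>T. norm t)"
      proof (intro add_mono order_trans[OF norm_sum] sum_mono)
        show "norm (l0 x *\<^sub>R u) \<le> norm u" using x(3,4) by (simp add: mult_left_le_one_le)
        show "norm (frac (c t x) *\<^sub>R t) \<le> norm t" for t
          using frac_ge_0[of "c t x"] frac_lt_1[of "c t x"] by (simp add: mult_left_le_one_le)
      qed
      finally show ?thesis by (simp add: R_def)
    qed
    ultimately show "g \<in> l0 ` (L \<inter> cball 0 R)" using x(2) by (metis IntI image_eqI)
  qed
  then have finG: "finite G" using finite_lattice_bounded[of "cball 0 R"] finite_subset by blast
  have "u \<in> ?M" using u(1) by (simp add: span_base)
  then have "1 \<in> G" using l0(2) by (force simp: G_def)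
  define g where "g = Min G"
  have gG: "g \<in> G" using finG \<open>1 \<in> G\<close> Min_in unfolding g_def by blast
  then have g0: "g > 0" by (auto simp: G_def)
  obtain v where v: "v \<in> ?M" "l0 v = g" using gG by (auto simp: G_def)
  have int: "l0 x / g \<in> \<int>" if x: "x \<in> ?M" for x
  proof (rule ccontr)
    assume n: "l0 x / g \<notin> \<int>"
    \<comment> \<open>Division with remainder: the remainder is a lattice point whose value is
      positive and below the minimum g.\<close>
    let ?y = "x - of_int \<lfloor>l0 x / g\<rfloor> *\<^sub>R v"
    have y: "?y \<in> ?M" using x v by (intro Mdiff) auto
    have "l0 ?y = frac (l0 x / g) * g"
      using g0 v by (simp add: linear_eqE[OF l0(1)] frac_def algebra_simps)
    moreover have "0 < frac (l0 x / g)" "frac (l0 x / g) < 1"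
      using n frac_lt_1 by (auto simp: frac_gt_0_iff)
    ultimately have *: "0 < l0 ?y" "l0 ?y < g" using g0 by auto
    moreover have "g \<le> 1" using gG by (auto simp: G_def)
    ultimately have "l0 ?y \<in> G" using y unfolding G_def by auto
    then show False using * Min_le[OF finG, of "l0 ?y"] by (simp add: g_def)
  qed
  define l where "l = (\<lambda>x. (1 / g) * l0 x)"
  have linl: "linear l" unfolding l_def using l0(1) linear_compose_scale_right[of l0 "1/g"] by simp
  show thesis
  proof
    show "l \<in> dual_lattice ?M" using int linl by (auto simp: dual_lattice_def l_def)
    show "l x = 0" if "x \<in> W" for x using l0W[OF that] by (simp add: l_def)
    show "v \<in> ?M" by (rule v)
    show lv: "l v = 1" using v g0 by (simp add: l_def)
    show "l u > 0" using l0(2) g0 by (simp add: l_def)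
    show "x - l x *\<^sub>R v \<in> W" if "x \<in> span (insert u W)" for x
    proof -
      have "x - l x *\<^sub>R v \<in> span (insert u W)" using that v by (auto intro: span_diff span_scale)
      moreover have "l0 (x - l x *\<^sub>R v) = 0"
        using v g0 by (simp add: linear_eqE[OF l0(1)] l_def)
      ultimately have "x - l x *\<^sub>R v = (\<Sum>t\<in>T. c t (x - l x *\<^sub>R v) *\<^sub>R t)"
        using expand[of "x - l x *\<^sub>R v"] by simp
      also have "\<dots> \<in> W" unfolding spT[symmetric] by (intro span_sum span_scale span_base)
      finally show ?thesis .
    qed
  qed
qed

text \<open>The hypothesis says that W is rational, so that L \<inter> W is a direct summand of L.
  By induction on the codimension one projects to the span of W and a further lattice vector u, and
  then removes the component along the vector v of \<open>primitive_form\<close>, whose coordinate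
  is integral at lattice points.\<close>

lemma integral_projection:
  assumes "W = span (L \<inter> W)"
  obtains h where "linear h" "\<And>x. x \<in> W \<Longrightarrow> h x = x" "\<And>x. x \<in> L \<Longrightarrow> h x \<in> L \<inter> W"
proof -
  have "\<exists>h. linear h \<and> (\<forall>x\<in>W. h x = x) \<and> (\<forall>x\<in>L. h x \<in> L \<inter> W)"
    using assms
  proof (induction "DIM('a) - dim W" arbitrary: W rule: less_induct)
    case less
    have subW: "subspace W" using less.prems by (metis subspace_span)
    show ?case
    proof (cases "L \<subseteq> W")
      case True
      then show ?thesis by (intro exI[of _ id]) (auto simp: linear_id)
    next
      case False
      then obtain u where u: "u \<in> L" "u \<notin> W" by blast
      let ?W' = "span (insert u W)"
      obtain l v where lv: "l \<in> dual_lattice (L \<inter> ?W')" "\<And>x. x \<in> W \<Longrightarrow> l x = 0"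
        "v \<in> L \<inter> ?W'" "l v = 1" "\<And>x. x \<in> ?W' \<Longrightarrow> x - l x *\<^sub>R v \<in> W"
        using primitive_form[OF less.prems u] by metis
      have "dim ?W' = Suc (dim W)"
        using u subW by (simp add: dim_insert span_eq_iff[THEN iffD2])
      moreover have "dim ?W' \<le> DIM('a)" by (rule dim_subset_UNIV)
      ultimately have dimlt: "DIM('a) - dim ?W' < DIM('a) - dim W" by linarith
      have W'1: "insert u W \<subseteq> span (L \<inter> ?W')"
      proof -
        have "L \<inter> W \<subseteq> L \<inter> ?W'" using span_superset[of "insert u W"] by auto
        then have "W \<subseteq> span (L \<inter> ?W')" using less.prems span_mono by metis
        moreover have "u \<in> L \<inter> ?W'" using u by (simp add: span_base)
        ultimately show ?thesis by (simp add: span_base)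
      qed
      have W': "?W' = span (L \<inter> ?W')"
        using span_minimal[OF W'1 subspace_span] span_minimal[of "L \<inter> ?W'" ?W'] by auto
      obtain h where h: "linear h" "\<forall>x\<in>?W'. h x = x" "\<forall>x\<in>L. h x \<in> L \<inter> ?W'"
        using less.hyps[OF dimlt W'] by blast
      have linl: "linear l" using lv(1) by (rule dual_latticeD)
      let ?h = "\<lambda>x. h x - l (h x) *\<^sub>R v"
      have "linear ?h"
        using h(1) linl linear_compose[of h l]
        by (intro linear_compose_sub linear_scaleR_const) (auto simp: o_def)
      moreover have "?h x = x" if "x \<in> W" for x
        using that h(2) lv(2) by (simp add: span_base)
      moreover have "?h x \<in> L \<inter> W" if "x \<in> L" for x
        using that h(3) lv dual_latticeD(2)[OF lv(1), of "h x"] by (auto intro!: lattice_diff lattice_scale)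
      ultimately show ?thesis by blast
    qed
  qed
  then show ?thesis using that by blast
qed

end

section \<open>Integer polynomials and integral piecewise linear functions\<close>

lemma prod_lessThan_append:
  "(\<Prod>j<a + b. if j < a then f j else g (j - a)) = (\<Prod>j<a. f j) * (\<Prod>j<b. g j)"
  for a b :: nat and f g :: "nat \<Rightarrow> 'b::comm_monoid_mult"
proof (induction b)
  case 0
  show ?case by (auto intro!: prod.cong)
qed (simp add: mult.assoc)

lemma sum_lessThan_append:
  "(\<Sum>j<a + b. if j < a then f j else g (j - a)) = (\<Sum>j<a. f j) + (\<Sum>j<b. g j)"
  for a b :: nat and f g :: "nat \<Rightarrow> 'b::comm_monoid_add"
proof (induction b)
  case 0
  show ?case by (auto intro!: sum.cong)
qed (simp add: add.assoc)

section \<open>Integer polynomials: closure properties, restriction to lines, division by a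
  form\<close>

lemma sym_power_zero: "(\<lambda>x. 0) \<in> sym_power k M"
  using sym_power.diff[OF sym_power.prod sym_power.prod, of k "\<lambda>_ _. 0" M "\<lambda>_ _. 0"]
  by (simp add: dual_lattice_zero)

lemma sym_power_neg: "p \<in> sym_power k M \<Longrightarrow> (\<lambda>x. - p x) \<in> sym_power k M"
  using sym_power.diff[OF sym_power_zero] by fastforce

lemma sym_power_add: "p \<in> sym_power k M \<Longrightarrow> q \<in> sym_power k M \<Longrightarrow> (\<lambda>x. p x + q x) \<in> sym_power k M"
  using sym_power.diff[OF _ sym_power_neg] by fastforce

lemma sym_power_sum:
  "(\<And>i. i \<in> I \<Longrightarrow> p i \<in> sym_power k M) \<Longrightarrow> (\<lambda>x. \<Sum>i\<in>I. p i x) \<in> sym_power k M"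
  by (induction I rule: infinite_finite_induct) (auto intro: sym_power_add sym_power_zero)

lemma sym_power_mono: "p \<in> sym_power k M' \<Longrightarrow> M \<subseteq> M' \<Longrightarrow> p \<in> sym_power k M"
  by (induction rule: sym_power.induct)
    (auto intro!: sym_power.intros dest: dual_lattice_mono[THEN subsetD])

lemma sym_power_compose:
  assumes "p \<in> sym_power k M" "linear h" "\<And>x. x \<in> M' \<Longrightarrow> h x \<in> M"
  shows "(\<lambda>x. p (h x)) \<in> sym_power k M'"
  using assms(1)
proof (induction rule: sym_power.induct)
  case (prod l)
  then show ?case
    using dual_lattice_compose[OF _ assms(2,3)] sym_power.prod[of k "\<lambda>j x. l j (h x)" M'] by blast
qed (rule sym_power.diff)

lemma sym_power_mult:
  assumes "p \<in> sym_power a M" "q \<in> sym_power b M"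
  shows "(\<lambda>x. p x * q x) \<in> sym_power (a + b) M"
  using assms(1)
proof (induction rule: sym_power.induct)
  case (prod l)
  show ?case using assms(2)
  proof (induction rule: sym_power.induct)
    case (prod l')
    let ?l = "\<lambda>j. if j < a then l j else l' (j - a)"
    have "(\<Prod>j<a + b. ?l j x) = (\<Prod>j<a. l j x) * (\<Prod>j<b. l' j x)" for x
      using prod_lessThan_append[of a "\<lambda>j. l j x" "\<lambda>j. l' j x" b] by (simp add: if_distribR)
    moreover have "(\<lambda>x. \<Prod>j<a + b. ?l j x) \<in> sym_power (a + b) M"
      using \<open>\<And>j. j < a \<Longrightarrow> l j \<in> dual_lattice M\<close> prod by (intro sym_power.prod) auto
    ultimately show ?case by simp
  next
    case (diff p' q')
    then show ?case using sym_power.diff[OF diff.IH] by (simp add: right_diff_distrib)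
  qed
next
  case (diff p' q')
  then show ?case using sym_power.diff[OF diff.IH] by (simp add: left_diff_distrib)
qed

lemma sym_power_form:
  assumes "l \<in> dual_lattice M"
  shows "l \<in> sym_power (Suc 0) M"
  using sym_power.prod[of "Suc 0" "\<lambda>_. l" M] assms by simp

lemma sym_power_one: "(\<lambda>x. 1) \<in> sym_power 0 M"
  using sym_power.prod[of 0 "\<lambda>_ _. 0" M] by simp

lemma sym_power_prod:
  assumes "finite S" "\<And>s. s \<in> S \<Longrightarrow> l s \<in> dual_lattice M"
  shows "(\<lambda>x. \<Prod>s\<in>S. l s x) \<in> sym_power (card S) M"
  using assms
proof (induction S rule: finite_induct)
  case (insert s S)
  then have "(\<lambda>x. l s x * (\<Prod>s\<in>S. l s x)) \<in> sym_power (Suc 0 + card S) M"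
    by (intro sym_power_mult sym_power_form) auto
  then show ?case using insert by simp
qed (simp add: sym_power_one)

lemma sym_power_degree_0:
  assumes "p \<in> sym_power 0 M"
  shows "p x = p y"
  using assms by (induction rule: sym_power.induct) auto

text \<open>Restriction to lines reduces statements on zero sets to the count of roots of a
  polynomial in one variable.\<close>

lemma sym_power_line:
  assumes "p \<in> sym_power k M"
  shows "\<exists>P. \<forall>t. p (x + t *\<^sub>R y) = poly P t"
  using assms
proof (induction rule: sym_power.induct)
  case (prod l)
  have "\<exists>P. \<forall>t. (\<Prod>j<n. l j (x + t *\<^sub>R y)) = poly P t" if "n \<le> k" for n
    using that
  proof (induction n)
    case 0
    show ?case by (intro exI[of _ 1]) simp
  next
    case (Suc n)
    then obtain P where P: "\<forall>t. (\<Prod>j<n. l j (x + t *\<^sub>R y)) = poly P t" by auto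
    have "linear (l n)" using Suc.prems prod[of n] by (auto dest: dual_latticeD)
    then have "l n (x + t *\<^sub>R y) = poly [:l n x, l n y:] t" for t
      by (simp add: linear_eqE)
    with P show ?case
      by (intro exI[of _ "P * [:l n x, l n y:]"]) (simp only: prod.lessThan_Suc poly_mult, simp)
  qed
  then show ?case by blast
next
  case (diff p q)
  then obtain P Q where "\<forall>t. p (x + t *\<^sub>R y) = poly P t" "\<forall>t. q (x + t *\<^sub>R y) = poly Q t" by blast
  then show ?case by (intro exI[of _ "P - Q"]) simp
qed

lemma sym_power_zero_on_line:
  assumes "p \<in> sym_power k M" "infinite {t. p (x + t *\<^sub>R y) = 0}"
  shows "p (x + t *\<^sub>R y) = 0"
proof -
  obtain P where P: "\<And>t. p (x + t *\<^sub>R y) = poly P t"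
    using sym_power_line[OF assms(1)] by blast
  have "P = 0" using assms(2) poly_roots_finite[of P] by (auto simp: P)
  then show ?thesis by (simp add: P)
qed

text \<open>For a product the difference telescopes, and
  \<open>l\<^sub>j x - l\<^sub>j (x - l x v) = l\<^sub>j v l x\<close> is an integer multiple of \<open>l x\<close>.\<close>
lemma sym_power_divide:
  assumes "p \<in> sym_power (Suc k) M" "l \<in> dual_lattice M" "v \<in> M"
  shows "\<exists>q \<in> sym_power k M. \<forall>x. p x - p (x - l x *\<^sub>R v) = l x * q x"
  using assms(1)
proof (induction rule: sym_power.induct)
  case (prod a)
  let ?h = "\<lambda>x. x - l x *\<^sub>R v"
  have ah: "a j (?h x) = a j x - a j v * l x" if "j < Suc k" for j x
    using prod[OF that] by (auto dest!: dual_latticeD(1) simp: linear_eqE)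
  have ah': "(\<lambda>x. a j (?h x)) \<in> dual_lattice M" if "j < Suc k" for j
  proof -
    have "(\<lambda>x. a j x - a j v * l x) \<in> dual_lattice M"
      using prod[OF that] assms(2,3) by (intro dual_lattice_diff dual_lattice_scale) (auto dest: dual_latticeD)
    then show ?thesis using ah[OF that] by simp
  qed
  have "\<exists>q \<in> sym_power n M. \<forall>x. (\<Prod>j<Suc n. a j x) - (\<Prod>j<Suc n. a j (?h x)) = l x * q x"
    if "n \<le> k" for n
    using that
  proof (induction n)
    case 0
    \<comment> \<open>\<open>sym_power 0 M\<close> is generated by the empty product 1, so an
      integer constant has to be built as a repeated sum.\<close>
    have "(\<lambda>x. a 0 v * 1) \<in> sym_power 0 M"
    proof -
      have "a 0 v \<in> \<int>" using prod[of 0] assms(3) by (auto dest: dual_latticeD)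
      then obtain n where n: "a 0 v = of_int n" by (auto elim: Ints_cases)
      have *: "(\<lambda>x. real m) \<in> sym_power 0 M" for m
        using sym_power_sum[of "{..<m}" "\<lambda>_ _. 1" 0 M] by (simp add: sym_power_one)
      show ?thesis
        using *[of "nat n"] sym_power_neg[OF *[of "nat (- n)"]] by (cases "n \<ge> 0") (simp_all add: n)
    qed
    then show ?case using ah[of 0] by (intro bexI[of _ "\<lambda>x. a 0 v * 1"]) (auto simp: algebra_simps)
  next
    case (Suc n)
    then obtain q where q: "q \<in> sym_power n M"
      "\<forall>x. (\<Prod>j<Suc n. a j x) - (\<Prod>j<Suc n. a j (?h x)) = l x * q x" by auto
    have sn: "Suc n < Suc k" using Suc.prems by simp
    \<comment> \<open>A generator of \<open>sym_power\<close> is a product of forms without a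
      scalar, so the integer \<open>a (Suc n) v\<close> is absorbed into the factor with index
      0.\<close>
    let ?b = "\<lambda>j x. if j = 0 then a (Suc n) v * a 0 (?h x) else a j (?h x)"
    let ?q = "\<lambda>x. q x * a (Suc n) x + (\<Prod>j<Suc n. ?b j x)"
    have "?b j \<in> dual_lattice M" if "j < Suc n" for j
      using that ah'[of j] sn dual_lattice_scale[OF ah'[of 0], of "a (Suc n) v"] prod[OF sn] assms(3)
        dual_latticeD(2) by (cases "j = 0") auto
    then have "(\<lambda>x. \<Prod>j<Suc n. ?b j x) \<in> sym_power (Suc n) M"
      by (intro sym_power.prod)
    moreover have "(\<lambda>x. q x * a (Suc n) x) \<in> sym_power (Suc n) M"
      using sym_power_mult[OF q(1) sym_power_form[OF prod[OF sn]]] by simp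
    ultimately have "?q \<in> sym_power (Suc n) M" by (rule sym_power_add[rotated])
    moreover have "(\<Prod>j<Suc (Suc n). a j x) - (\<Prod>j<Suc (Suc n). a j (?h x)) = l x * ?q x" for x
    proof -
      have b: "(\<Prod>j<Suc n. ?b j x) = a (Suc n) v * (\<Prod>j<Suc n. a j (?h x))"
        by (simp only: prod.lessThan_Suc_shift) simp
      have "(\<Prod>j<Suc (Suc n). a j x) - (\<Prod>j<Suc (Suc n). a j (?h x)) =
         ((\<Prod>j<Suc n. a j x) - (\<Prod>j<Suc n. a j (?h x))) * a (Suc n) x
         + (\<Prod>j<Suc n. a j (?h x)) * (a (Suc n) x - a (Suc n) (?h x))"
        by (simp only: prod.lessThan_Suc[of _ "Suc n"]) (simp add: algebra_simps del: prod.lessThan_Suc)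
      also have "\<dots> = l x * q x * a (Suc n) x + (\<Prod>j<Suc n. a j (?h x)) * (a (Suc n) v * l x)"
        using q(2) ah[OF sn] by (simp del: prod.lessThan_Suc)
      also have "\<dots> = l x * ?q x" unfolding b by (simp add: algebra_simps del: prod.lessThan_Suc)
      finally show ?thesis .
    qed
    ultimately show ?case by (intro bexI[of _ ?q] allI)
  qed
  then show ?case by blast
next
  case (diff p' q')
  obtain a where a: "a \<in> sym_power k M" "\<forall>x. p' x - p' (x - l x *\<^sub>R v) = l x * a x"
    using diff.IH(1) by (rule bexE)
  obtain b where b: "b \<in> sym_power k M" "\<forall>x. q' x - q' (x - l x *\<^sub>R v) = l x * b x"
    using diff.IH(2) by (rule bexE)
  have "(p' x - q' x) - (p' (x - l x *\<^sub>R v) - q' (x - l x *\<^sub>R v)) = l x * (a x - b x)" for x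
    using a(2)[THEN spec, of x] b(2)[THEN spec, of x] by (simp add: right_diff_distrib)
  with a b show ?case
    by (intro bexI[of _ "\<lambda>x. a x - b x"] sym_power.diff allI)
qed

text \<open>Composition with an integral projection onto W. It turns polynomials given on single
  cones into global ones, which can be subtracted from each other.\<close>

lemma (in euclidean_lattice) sym_power_extend:
  assumes "W = span (L \<inter> W)" "p \<in> sym_power k (L \<inter> W)"
  obtains p' where "p' \<in> sym_power k L" "\<And>x. x \<in> W \<Longrightarrow> p' x = p x"
proof -
  obtain h where "linear h" "\<And>x. x \<in> W \<Longrightarrow> h x = x" "\<And>x. x \<in> L \<Longrightarrow> h x \<in> L \<inter> W"
    using integral_projection[OF assms(1)] by blast
  then show ?thesis
    using that[of "\<lambda>x. p (h x)"] sym_power_compose[OF assms(2)] by auto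
qed

section \<open>Integral piecewise linear functions and maps, and sums of products of such
  functions\<close>

inductive_set pl_functions :: "'a::euclidean_space set \<Rightarrow> ('a \<Rightarrow> real) set"
  for M :: "'a set" where
  form: "l \<in> dual_lattice M \<Longrightarrow> l \<in> pl_functions M"
| diff: "f \<in> pl_functions M \<Longrightarrow> g \<in> pl_functions M \<Longrightarrow> (\<lambda>x. f x - g x) \<in> pl_functions M"
| max: "f \<in> pl_functions M \<Longrightarrow> g \<in> pl_functions M \<Longrightarrow> (\<lambda>x. max (f x) (g x)) \<in> pl_functions M"

lemma pl_zero: "(\<lambda>x. 0) \<in> pl_functions M"
  by (intro pl_functions.form dual_lattice_zero)

lemma pl_neg: "f \<in> pl_functions M \<Longrightarrow> (\<lambda>x. - f x) \<in> pl_functions M"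
  using pl_functions.diff[OF pl_zero] by fastforce

lemma pl_add: "f \<in> pl_functions M \<Longrightarrow> g \<in> pl_functions M \<Longrightarrow> (\<lambda>x. f x + g x) \<in> pl_functions M"
  using pl_functions.diff[OF _ pl_neg] by fastforce

lemma pl_min: "f \<in> pl_functions M \<Longrightarrow> g \<in> pl_functions M \<Longrightarrow> (\<lambda>x. min (f x) (g x)) \<in> pl_functions M"
  using pl_neg[OF pl_functions.max[OF pl_neg pl_neg], of f M g] by (simp add: minus_max_eq_min)

lemma pl_sum:
  "(\<And>i. i \<in> I \<Longrightarrow> f i \<in> pl_functions M) \<Longrightarrow> (\<lambda>x. \<Sum>i\<in>I. f i x) \<in> pl_functions M"
  by (induction I rule: infinite_finite_induct) (auto intro: pl_add pl_zero)

lemma pl_scale_nat: "f \<in> pl_functions M \<Longrightarrow> (\<lambda>x. real n * f x) \<in> pl_functions M"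
  using pl_sum[of "{..<n}" "\<lambda>_. f" M] by simp

lemma pl_scale:
  assumes "f \<in> pl_functions M" "c \<in> \<int>"
  shows "(\<lambda>x. c * f x) \<in> pl_functions M"
proof -
  obtain n where n: "c = of_int n" using assms(2) by (auto elim: Ints_cases)
  show ?thesis
    using pl_scale_nat[OF assms(1), of "nat n"] pl_neg[OF pl_scale_nat[OF assms(1), of "nat (- n)"]]
    by (cases "n \<ge> 0") (simp_all add: n)
qed

definition sign_constant :: "('a \<Rightarrow> real) set \<Rightarrow> 'a set \<Rightarrow> bool" where
  "sign_constant S C \<longleftrightarrow> (\<forall>s\<in>S. (\<forall>x\<in>C. 0 \<le> s x) \<or> (\<forall>x\<in>C. s x \<le> 0))"

lemma sign_constant_mono: "sign_constant S C \<Longrightarrow> S' \<subseteq> S \<Longrightarrow> C' \<subseteq> C \<Longrightarrow> sign_constant S' C'"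
  unfolding sign_constant_def by (meson subset_iff)

text \<open>The set \<open>T\<close> of possible pieces is recorded so that the walls of a maximum can be described
  by the differences of pieces.\<close>
definition pl_walls ::
  "'a::euclidean_space set \<Rightarrow> ('a \<Rightarrow> real) \<Rightarrow> ('a \<Rightarrow> real) set \<Rightarrow> ('a \<Rightarrow> real) set \<Rightarrow> bool" where
  "pl_walls M f S T \<longleftrightarrow> finite S \<and> S \<subseteq> dual_lattice M \<and> finite T \<and> T \<subseteq> dual_lattice M \<and>
     (\<forall>C. sign_constant S C \<longrightarrow> (\<exists>l\<in>T. \<forall>x\<in>C. f x = l x))"

lemma pl_wallsD:
  assumes "pl_walls M f S T"
  shows "finite S" "S \<subseteq> dual_lattice M" "finite T" "T \<subseteq> dual_lattice M"
    "sign_constant S C \<Longrightarrow> \<exists>l\<in>T. \<forall>x\<in>C. f x = l x"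
  using assms unfolding pl_walls_def by auto

lemma pl_walls_exist:
  assumes "f \<in> pl_functions M"
  shows "\<exists>S T. pl_walls M f S T"
  using assms
proof (induction rule: pl_functions.induct)
  case (form l)
  then have "pl_walls M l {} {l}" by (auto simp: pl_walls_def)
  then show ?case by blast
next
  case (diff f g)
  then obtain S T S' T' where st: "pl_walls M f S T" "pl_walls M g S' T'" by blast
  note * = pl_wallsD[OF st(1)] pl_wallsD[OF st(2)]
  let ?T = "(\<lambda>(a, b) x. a x - b x) ` (T \<times> T')"
  have "\<exists>l\<in>?T. \<forall>x\<in>C. f x - g x = l x" if "sign_constant (S \<union> S') C" for C
  proof -
    have "sign_constant S C" "sign_constant S' C" using that by (auto simp: sign_constant_def)
    then obtain a b where "a \<in> T" "b \<in> T'" "\<forall>x\<in>C. f x = a x" "\<forall>x\<in>C. g x = b x"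
      using *(5,10) by meson
    then show ?thesis by (intro bexI[of _ "\<lambda>x. a x - b x"]) auto
  qed
  moreover have "?T \<subseteq> dual_lattice M" using *(4,9) by (auto intro!: dual_lattice_diff)
  ultimately have "pl_walls M (\<lambda>x. f x - g x) (S \<union> S') ?T"
    using * unfolding pl_walls_def by blast
  then show ?case by blast
next
  case (max f g)
  then obtain S T S' T' where st: "pl_walls M f S T" "pl_walls M g S' T'" by blast
  note * = pl_wallsD[OF st(1)] pl_wallsD[OF st(2)]
  \<comment> \<open>Where all these differences keep their sign, one of the pieces in use for f and
    g dominates the other, whichever pieces these are.\<close>
  let ?D = "(\<lambda>(a, b) x. a x - b x) ` (T \<times> T')"
  have "\<exists>l\<in>T \<union> T'. \<forall>x\<in>C. max (f x) (g x) = l x" if sgn: "sign_constant (S \<union> S' \<union> ?D) C" for C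
  proof -
    have "sign_constant S C" "sign_constant S' C" using sgn by (auto intro: sign_constant_mono)
    then obtain a b where ab: "a \<in> T" "b \<in> T'" "\<forall>x\<in>C. f x = a x" "\<forall>x\<in>C. g x = b x"
      using *(5,10) by meson
    then have "(\<lambda>x. a x - b x) \<in> S \<union> S' \<union> ?D" by auto
    then have "(\<forall>x\<in>C. 0 \<le> a x - b x) \<or> (\<forall>x\<in>C. a x - b x \<le> 0)"
      using sgn unfolding sign_constant_def by (rule bspec[rotated])
    then show ?thesis
    proof
      assume "\<forall>x\<in>C. 0 \<le> a x - b x"
      then show ?thesis using ab by (intro bexI[of _ a]) auto
    next
      assume "\<forall>x\<in>C. a x - b x \<le> 0"
      then show ?thesis using ab by (intro bexI[of _ b]) auto
    qed
  qed
  moreover have "?D \<subseteq> dual_lattice M" using *(4,9) by (auto intro!: dual_lattice_diff)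
  moreover have "finite ?D" using *(3,8) by simp
  ultimately have "pl_walls M (\<lambda>x. max (f x) (g x)) (S \<union> S' \<union> ?D) (T \<union> T')"
    using *(1-4,6-9) unfolding pl_walls_def by simp
  then show ?case by blast
qed

text \<open>Integrality is tested by composition with integral forms; for a lattice M, staying in
  \<open>span M\<close> ensures that the values of these forms determine the image point.\<close>

definition pl_maps :: "'a::euclidean_space set \<Rightarrow> ('a \<Rightarrow> 'a) set" where
  "pl_maps M = {\<phi>. (\<forall>x\<in>span M. \<phi> x \<in> span M) \<and>
     (\<forall>l\<in>dual_lattice M. (\<lambda>x. l (\<phi> x)) \<in> pl_functions M)}"

lemma pl_compose:
  assumes "f \<in> pl_functions M" "\<phi> \<in> pl_maps M"
  shows "(\<lambda>x. f (\<phi> x)) \<in> pl_functions M"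
  using assms(1)
proof (induction rule: pl_functions.induct)
  case (form l)
  then show ?case using assms(2) by (auto simp: pl_maps_def)
qed (auto intro: pl_functions.intros)

inductive_set pl_power :: "nat \<Rightarrow> 'a::euclidean_space set \<Rightarrow> ('a \<Rightarrow> real) set"
  for k :: nat and M :: "'a set" where
  prod: "(\<And>j. j < k \<Longrightarrow> f j \<in> pl_functions M) \<Longrightarrow> (\<lambda>x. \<Prod>j<k. f j x) \<in> pl_power k M"
| diff: "p \<in> pl_power k M \<Longrightarrow> q \<in> pl_power k M \<Longrightarrow> (\<lambda>x. p x - q x) \<in> pl_power k M"

lemma pl_power_zero: "(\<lambda>x. 0) \<in> pl_power k M"
  using pl_power.diff[OF pl_power.prod pl_power.prod, of k "\<lambda>_ _. 0" M "\<lambda>_ _. 0"]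
  by (simp add: pl_zero)

lemma pl_power_add: "p \<in> pl_power k M \<Longrightarrow> q \<in> pl_power k M \<Longrightarrow> (\<lambda>x. p x + q x) \<in> pl_power k M"
  using pl_power.diff[OF _ pl_power.diff[OF pl_power_zero], of p k M q] by simp

lemma sym_power_subset_pl_power: "sym_power k M \<subseteq> pl_power k M"
proof
  fix p assume "p \<in> sym_power k M"
  then show "p \<in> pl_power k M"
    by (induction rule: sym_power.induct) (auto intro: pl_power.intros pl_functions.form)
qed

lemma pl_power_compose:
  assumes "p \<in> pl_power k M" "\<phi> \<in> pl_maps M"
  shows "(\<lambda>x. p (\<phi> x)) \<in> pl_power k M"
  using assms(1)
proof (induction rule: pl_power.induct)
  case (prod f)
  then show ?case using pl_power.prod[of k "\<lambda>j x. f j (\<phi> x)"] pl_compose[OF _ assms(2)] by auto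
qed (auto intro: pl_power.intros)

text \<open>The signs are kept in the integers c: for k = 0 the products are empty and cannot absorb
  them.\<close>

lemma pl_power_sum_of_products:
  assumes "p \<in> pl_power k M"
  shows "\<exists>(n::nat) (c::nat \<Rightarrow> int) g. (\<forall>i<n. \<forall>j<k. g i j \<in> pl_functions M) \<and>
    (\<forall>x. p x = (\<Sum>i<n. of_int (c i) * (\<Prod>j<k. g i j x)))"
proof -
  define R :: "('a \<Rightarrow> real) \<Rightarrow> nat \<Rightarrow> (nat \<Rightarrow> int) \<Rightarrow> (nat \<Rightarrow> nat \<Rightarrow> 'a \<Rightarrow> real) \<Rightarrow> bool"
    where "R p n c g \<longleftrightarrow> (\<forall>i<n. \<forall>j<k. g i j \<in> pl_functions M) \<and>
      (\<forall>x. p x = (\<Sum>i<n. of_int (c i) * (\<Prod>j<k. g i j x)))" for p n c g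
  have "\<exists>n c g. R p n c g"
    using assms
  proof (induction rule: pl_power.induct)
    case (prod f)
    then have "R (\<lambda>x. \<Prod>j<k. f j x) 1 (\<lambda>_. 1) (\<lambda>_. f)" by (auto simp: R_def)
    then show ?case by blast
  next
    case (diff p q)
    then obtain n c g n' c' g' where r: "R p n c g" "R q n' c' g'" by blast
    let ?c = "\<lambda>i. if i < n then c i else - c' (i - n)" and ?g = "\<lambda>i. if i < n then g i else g' (i - n)"
    have "p x - q x = (\<Sum>i<n + n'. of_int (?c i) * (\<Prod>j<k. ?g i j x))" for x
    proof -
      have "(\<Sum>i<n + n'. of_int (?c i) * (\<Prod>j<k. ?g i j x)) =
        (\<Sum>i<n + n'. if i < n then of_int (c i) * (\<Prod>j<k. g i j x)
           else of_int (- c' (i - n)) * (\<Prod>j<k. g' (i - n) j x))"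
        by (intro sum.cong) auto
      also have "\<dots> = (\<Sum>i<n. of_int (c i) * (\<Prod>j<k. g i j x))
          + (\<Sum>i<n'. of_int (- c' i) * (\<Prod>j<k. g' i j x))"
        by (rule sum_lessThan_append)
      finally show ?thesis using r by (simp add: R_def sum_negf)
    qed
    moreover have "?g i j \<in> pl_functions M" if "i < n + n'" "j < k" for i j
      using that r by (auto simp: R_def)
    ultimately have "R (\<lambda>x. p x - q x) (n + n') ?c ?g" by (simp add: R_def)
    then show ?case by blast
  qed
  then show ?thesis unfolding R_def .
qed

section \<open>Rational cones\<close>

text \<open>One more generator means one more parameter t; inductions over generators eliminate
  it.\<close>

lemma convex_cone_hull_insert:
  "x \<in> convex_cone hull (insert s S) \<longleftrightarrow> (\<exists>t\<ge>0. x - t *\<^sub>R s \<in> convex_cone hull S)"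
proof -
  have 1: "convex_cone hull {s} = (\<lambda>t. t *\<^sub>R s) ` {0..}"
  proof (rule hull_unique)
    have "convex_cone ((\<lambda>t. t *\<^sub>R s) ` {0::real..})"
      unfolding convex_cone_iff image_iff
      by (auto intro: bexI[of _ 0] bexI[of _ "_ + _"] bexI[of _ "_ * _"] simp: scaleR_add_left)
    then show "convex_cone ((\<lambda>t. t *\<^sub>R s) ` {0::real..})" .
  qed (auto simp: image_iff convex_cone_scaleR intro: bexI[of _ 1])
  have "x \<in> convex_cone hull (insert s S) \<longleftrightarrow> (\<exists>t\<ge>0. \<exists>y\<in>convex_cone hull S. x = t *\<^sub>R s + y)"
    using convex_cone_hull_Un[of "{s}" S] unfolding 1 by auto
  also have "\<dots> \<longleftrightarrow> (\<exists>t\<ge>0. x - t *\<^sub>R s \<in> convex_cone hull S)"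
  proof (intro arg_cong[of _ _ Ex] ext conj_cong refl iffI)
    fix t assume "x - t *\<^sub>R s \<in> convex_cone hull S"
    then show "\<exists>y\<in>convex_cone hull S. x = t *\<^sub>R s + y" by (intro bexI[of _ "x - t *\<^sub>R s"]) auto
  qed auto
  finally show ?thesis .
qed

lemma convex_cone_hull_finite:
  fixes S :: "'a::euclidean_space set"
  assumes "finite S"
  shows "convex_cone hull S = {\<Sum>s\<in>S. c s *\<^sub>R s | c. \<forall>s\<in>S. 0 \<le> c s}"
  using assms
proof (induction S rule: finite_induct)
  case empty
  then show ?case by simp
next
  case (insert s S)
  show ?case
  proof (rule set_eqI)
    fix x
    have "x \<in> convex_cone hull (insert s S) \<longleftrightarrow>
        (\<exists>t\<ge>0. \<exists>c. (\<forall>s\<in>S. 0 \<le> c s) \<and> x - t *\<^sub>R s = (\<Sum>s\<in>S. c s *\<^sub>R s))"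
      unfolding convex_cone_hull_insert insert.IH by auto
    also have "\<dots> \<longleftrightarrow> (\<exists>c. (\<forall>s\<in>insert s S. 0 \<le> c s) \<and> x = (\<Sum>s\<in>insert s S. c s *\<^sub>R s))"
    proof safe
      fix t :: real and c :: "'a \<Rightarrow> real" assume *: "0 \<le> t" "\<forall>s\<in>S. 0 \<le> c s" "x - t *\<^sub>R s = (\<Sum>s\<in>S. c s *\<^sub>R s)"
      have "(\<Sum>r\<in>S. (if r = s then t else c r) *\<^sub>R r) = (\<Sum>s\<in>S. c s *\<^sub>R s)"
        using insert.hyps by (intro sum.cong) auto
      then have "x = (\<Sum>r\<in>insert s S. (if r = s then t else c r) *\<^sub>R r)"
        using * insert.hyps by (simp add: algebra_simps)
      then show "\<exists>c. (\<forall>s\<in>insert s S. 0 \<le> c s) \<and> x = (\<Sum>s\<in>insert s S. c s *\<^sub>R s)"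
        using * by (intro exI[of _ "\<lambda>r. if r = s then t else c r"]) auto
    next
      fix c :: "'a \<Rightarrow> real" assume "\<forall>s\<in>insert s S. 0 \<le> c s"
      then show "\<exists>t\<ge>0. \<exists>d. (\<forall>s\<in>S. 0 \<le> d s) \<and> 
         (\<Sum>s\<in>insert s S. c s *\<^sub>R s) - t *\<^sub>R s = (\<Sum>s\<in>S. d s *\<^sub>R s)"
        using insert.hyps by (intro exI[of _ "c s"] conjI exI[of _ c]) auto
    qed
    finally show "x \<in> convex_cone hull (insert s S) \<longleftrightarrow>
      x \<in> {\<Sum>s\<in>insert s S. c s *\<^sub>R s | c. \<forall>s\<in>insert s S. 0 \<le> c s}" by auto
  qed
qed

lemma span_convex_cone_hull: "span (convex_cone hull S) = span S"
proof (rule subset_antisym)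
  have "convex_cone hull S \<subseteq> span S"
    by (intro hull_minimal span_superset convex_cone_span)
  then show "span (convex_cone hull S) \<subseteq> span S" by (rule span_minimal) simp
  show "span S \<subseteq> span (convex_cone hull S)" by (intro span_mono hull_subset)
qed

text \<open>The last clause is the rationality of the span, in the form that
  \<open>primitive_form\<close> and \<open>integral_projection\<close> require.\<close>

lemma rational_coneD:
  assumes "rational_cone L \<sigma>"
  shows "convex_cone \<sigma>" "convex \<sigma>" "closed \<sigma>" "\<sigma> \<subseteq> span L" "0 \<in> \<sigma>" "span \<sigma> = span (L \<inter> span \<sigma>)"
proof -
  obtain S where S: "finite S" "S \<subseteq> L" "\<sigma> = convex_cone hull S"
    using assms by (auto simp: rational_cone_def)
  show "convex_cone \<sigma>" "convex \<sigma>" "closed \<sigma>" "0 \<in> \<sigma>"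
    using S by (auto simp: convex_cone_convex_cone_hull convex_convex_cone_hull closed_convex_cone_hull
        convex_cone_hull_contains_0)
  have sp: "span \<sigma> = span S" unfolding S(3) by (rule span_convex_cone_hull)
  then show "\<sigma> \<subseteq> span L" using S(2) by (metis span_mono span_superset subset_trans)
  show "span \<sigma> = span (L \<inter> span \<sigma>)"
  proof (rule subset_antisym)
    show "span \<sigma> \<subseteq> span (L \<inter> span \<sigma>)"
      unfolding sp using S(2) by (intro span_mono) (auto intro: span_base)
    show "span (L \<inter> span \<sigma>) \<subseteq> span \<sigma>" by (intro span_minimal) auto
  qed
qed

text \<open>Fourier--Motzkin elimination of the coefficient of the new generator.\<close>
lemma (in euclidean_lattice) rational_cone_halfspaces:
  assumes "rational_cone L \<sigma>"
  shows "\<exists>N. finite N \<and> N \<subseteq> dual_lattice L \<and> \<sigma> = {x \<in> span L. \<forall>n\<in>N. 0 \<le> n x}"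
proof -
  obtain S where S: "finite S" "S \<subseteq> L" "\<sigma> = convex_cone hull S"
    using assms by (auto simp: rational_cone_def)
  have "\<exists>N. finite N \<and> N \<subseteq> dual_lattice L \<and> convex_cone hull S = {x \<in> span L. \<forall>n\<in>N. 0 \<le> n x}"
    using S(1,2)
  proof (induction S rule: finite_induct)
    case empty
    obtain B l where Bl: "finite B" "B \<subseteq> L" "\<And>b. b \<in> B \<Longrightarrow> l b \<in> dual_lattice L"
      "\<And>x. x \<in> span L \<Longrightarrow> x = (\<Sum>b\<in>B. l b x *\<^sub>R b)"
      using lattice_coords by metis
    let ?N = "l ` B \<union> (\<lambda>b x. - l b x) ` B"
    have "{x \<in> span L. \<forall>n\<in>?N. 0 \<le> n x} = {0}"
    proof (intro set_eqI iffI; clarsimp)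
      fix x assume x: "x \<in> span L" and N: "\<forall>n\<in>?N. 0 \<le> n x"
      have "l b \<in> ?N" "(\<lambda>x. - l b x) \<in> ?N" if "b \<in> B" for b using that by auto
      then have "0 \<le> l b x" "0 \<le> - l b x" if "b \<in> B" for b using that N by (auto dest: bspec)
      then have "l b x = 0" if "b \<in> B" for b using that by (metis neg_0_le_iff_le order_antisym)
      then show "x = 0" using Bl(4)[OF x] by simp
    next
      show "0 \<in> span L \<and> (\<forall>n\<in>?N. 0 \<le> n 0)"
        using linear_0[OF dual_latticeD(1)[OF Bl(3)]] by (auto simp: span_0)
    qed
    then show ?case using Bl by (intro exI[of _ ?N]) (auto intro: dual_lattice_neg)
  next
    case (insert s S)
    then obtain N where N: "finite N" "N \<subseteq> dual_lattice L"
      "convex_cone hull S = {x \<in> span L. \<forall>n\<in>N. 0 \<le> n x}" by auto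
    have sL: "s \<in> L" using insert.prems by simp
    \<comment> \<open>That \<open>x - t *\<^sub>R s\<close> lies in the old cone bounds t below by
      \<open>i x / i s\<close> if \<open>i s < 0\<close> and above by \<open>j x / j s\<close> if
      \<open>j s > 0\<close>. Nonnegativity of \<open>?P i j x\<close> says that these two bounds
      are compatible.\<close>
    let ?P = "\<lambda>i j x. j s * i x - i s * j x"
    let ?N = "{n\<in>N. 0 \<le> n s} \<union> (\<lambda>(i, j). ?P i j) ` ({i\<in>N. i s < 0} \<times> {j\<in>N. 0 < j s})"
    have lin: "n (x - t *\<^sub>R s) = n x - t * n s" if "n \<in> N" for n x t
      using that N(2) by (auto simp: linear_eqE dest!: dual_latticeD(1) subsetD)
    have "?N \<subseteq> dual_lattice L"
      using N(2) sL by (auto intro!: dual_lattice_diff dual_lattice_scale dest: dual_latticeD(2))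
    moreover have "convex_cone hull (insert s S) = {x \<in> span L. \<forall>n\<in>?N. 0 \<le> n x}"
    proof (intro set_eqI iffI)
      fix x assume "x \<in> convex_cone hull (insert s S)"
      then obtain t where t: "0 \<le> t" "x - t *\<^sub>R s \<in> span L" "\<forall>n\<in>N. 0 \<le> n (x - t *\<^sub>R s)"
        unfolding convex_cone_hull_insert N(3) by auto
      then have t: "0 \<le> t" "x - t *\<^sub>R s \<in> span L" "\<And>n. n \<in> N \<Longrightarrow> t * n s \<le> n x"
        by (auto simp: lin)
      have "x \<in> span L"
        using span_add[OF t(2) span_scale[OF span_base[OF sL], of t]] by simp
      moreover have "0 \<le> n x" if "n \<in> N" "0 \<le> n s" for n
        using t(1) t(3)[OF that(1)] that(2) by (meson mult_nonneg_nonneg order_trans)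
      moreover have "0 \<le> ?P i j x" if "i \<in> N" "i s < 0" "j \<in> N" "0 < j s" for i j
      proof -
        have "i s * j x \<le> i s * (t * j s)"
          using t(3)[OF that(3)] that(2) by (simp add: mult_left_mono_neg)
        also have "\<dots> = j s * (t * i s)" by simp
        also have "\<dots> \<le> j s * i x" using t(3)[OF that(1)] that(4) by simp
        finally show ?thesis by simp
      qed
      ultimately show "x \<in> {x \<in> span L. \<forall>n\<in>?N. 0 \<le> n x}" by auto
    next
      fix x assume x: "x \<in> {x \<in> span L. \<forall>n\<in>?N. 0 \<le> n x}"
      then have x1: "x \<in> span L" and x2: "\<And>n. n \<in> N \<Longrightarrow> 0 \<le> n s \<Longrightarrow> 0 \<le> n x"
        and x3: "\<And>i j. i \<in> N \<Longrightarrow> i s < 0 \<Longrightarrow> j \<in> N \<Longrightarrow> 0 < j s \<Longrightarrow> i s * j x \<le> j s * i x"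
      proof -
        fix i j assume "i \<in> N" "i s < 0" "j \<in> N" "0 < j s"
        then have "?P i j \<in> ?N" by (intro UnI2 image_eqI[of _ _ "(i, j)"]) auto
        moreover have "\<forall>n\<in>?N. 0 \<le> n x" using x by blast
        ultimately have "0 \<le> ?P i j x" by (rule bspec[rotated])
        then show "i s * j x \<le> j s * i x" by simp
      qed auto
      let ?T = "insert 0 ((\<lambda>i. i x / i s) ` {i\<in>N. i s < 0})"
      \<comment> \<open>The largest lower bound; 0 is among them because the coefficient of s must
        be nonnegative.\<close>
      define t where "t = Max ?T"
      have finT: "finite ?T" using N(1) by simp
      have t0: "0 \<le> t" unfolding t_def using finT by (intro Max_ge) auto
      have "t * n s \<le> n x" if n: "n \<in> N" for n
      proof (cases "n s" "0::real" rule: linorder_cases)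
        case less
        then have "n x / n s \<le> t" unfolding t_def using finT n by (intro Max_ge) auto
        with less show ?thesis by (simp add: field_simps)
      next
        case equal
        then show ?thesis using x2[OF n] by simp
      next
        case greater
        have "t \<in> ?T" unfolding t_def using finT by (intro Max_in) auto
        then have "t \<le> n x / n s"
        proof
          assume "t = 0"
          then show ?thesis using x2[OF n] greater by simp
        next
          assume "t \<in> (\<lambda>i. i x / i s) ` {i\<in>N. i s < 0}"
          then obtain i where i: "i \<in> N" "i s < 0" "t = i x / i s" by auto
          have "i s * n x \<le> i s * (t * n s)" using x3[OF i(1,2) n greater] i(2,3) by (simp add: mult.commute)
          then have "t * n s \<le> n x" using i(2) by (simp add: mult_le_cancel_left_neg)
          then show ?thesis using greater by (simp add: field_simps)
        qed
        then show ?thesis using greater by (simp add: field_simps)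
      qed
      then have "x - t *\<^sub>R s \<in> convex_cone hull S"
        unfolding N(3) using x1 sL by (auto simp: lin intro: span_diff span_scale span_base)
      then show "x \<in> convex_cone hull (insert s S)"
        unfolding convex_cone_hull_insert using t0 by blast
    qed
    moreover have "finite ?N" using N(1) by simp
    ultimately show ?case by blast
  qed
  then show ?thesis unfolding S(3) .
qed

lemma convex_cone_sum:
  assumes "convex_cone C" "\<And>i. i \<in> I \<Longrightarrow> f i \<in> C"
  shows "sum f I \<in> C"
  using assms(2) by (induction I rule: infinite_finite_induct)
    (auto intro: convex_cone_add[OF assms(1)] simp: convex_cone_contains_0[OF assms(1)])

lemma sum_sign_split:
  fixes l :: "'a \<Rightarrow> real"
  assumes "finite S"
  shows "sum f S = sum f {s\<in>S. l s = 0} + sum f {s\<in>S. 0 < l s} + sum f {s\<in>S. l s < 0}"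
proof -
  have "S = {s\<in>S. l s = 0} \<union> {s\<in>S. 0 < l s} \<union> {s\<in>S. l s < 0}" by auto
  moreover have "sum f ({s\<in>S. l s = 0} \<union> {s\<in>S. 0 < l s} \<union> {s\<in>S. l s < 0})
      = sum f {s\<in>S. l s = 0} + sum f {s\<in>S. 0 < l s} + sum f {s\<in>S. l s < 0}"
    using assms by (subst sum.union_disjoint; auto)+
  ultimately show ?thesis by simp
qed

text \<open>The generators on the wall are \<open>l s t - l t s\<close> for generators \<open>s\<close>, \<open>t\<close> on opposite sides.\<close>
lemma (in euclidean_lattice) rational_cone_cut:
  assumes "rational_cone L \<sigma>" "l \<in> dual_lattice L"
  shows "rational_cone L {x \<in> \<sigma>. 0 \<le> l x}"
proof -
  obtain S where S: "finite S" "S \<subseteq> L" "\<sigma> = convex_cone hull S"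
    using assms by (auto simp: rational_cone_def)
  have linl: "linear l" using assms(2) by (rule dual_latticeD)
  let ?P = "{s\<in>S. 0 < l s}" and ?N = "{s\<in>S. l s < 0}" and ?Z = "{s\<in>S. l s = 0}"
  let ?G = "{s\<in>S. 0 \<le> l s} \<union> (\<lambda>(s, t). l s *\<^sub>R t - l t *\<^sub>R s) ` (?P \<times> ?N)"
  have "{x \<in> \<sigma>. 0 \<le> l x} = convex_cone hull ?G"
  proof (rule subset_antisym)
    have cc: "convex_cone {x \<in> \<sigma>. 0 \<le> l x}"
      using rational_coneD(1)[OF assms(1)] by (auto simp: convex_cone_iff linear_eqE[OF linl])
    have S\<sigma>: "S \<subseteq> \<sigma>" unfolding S(3) by (rule hull_subset)
    have "l s *\<^sub>R t - l t *\<^sub>R s \<in> \<sigma>" if "s \<in> ?P" "t \<in> ?N" for s t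
    proof -
      have "l s *\<^sub>R t + (- l t) *\<^sub>R s \<in> \<sigma>"
        using that S\<sigma> rational_coneD(1)[OF assms(1)] by (intro convex_cone_add convex_cone_scaleR) auto
      then show ?thesis by simp
    qed
    then have "?G \<subseteq> {x \<in> \<sigma>. 0 \<le> l x}" using S\<sigma> by (auto simp: linear_eqE[OF linl])
    then show "convex_cone hull ?G \<subseteq> {x \<in> \<sigma>. 0 \<le> l x}" using cc by (rule hull_minimal)
    show "{x \<in> \<sigma>. 0 \<le> l x} \<subseteq> convex_cone hull ?G"
    proof clarify
      fix x assume "x \<in> \<sigma>" and lx: "0 \<le> l x"
      then obtain c where c: "\<And>s. s \<in> S \<Longrightarrow> 0 \<le> c s" "x = (\<Sum>s\<in>S. c s *\<^sub>R s)"
        unfolding S(3) convex_cone_hull_finite[OF S(1)] by auto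
      let ?H = "convex_cone hull ?G"
      have H: "convex_cone ?H" by (rule convex_cone_convex_cone_hull)
      note Hsum = convex_cone_sum[OF H] and Ssplit = sum_sign_split[OF S(1), of _ l]
      \<comment> \<open>The contributions to l x of the generators on the positive and, with sign
        reversed, on the negative side, so that l x = P - N.\<close>
      define P where "P = (\<Sum>s\<in>?P. c s * l s)"
      define N where "N = (\<Sum>s\<in>?N. c s * - l s)"
      have "l x = (\<Sum>s\<in>S. c s * l s)" unfolding c(2) by (simp add: linear_sum[OF linl] linear_eqE[OF linl])
      then have lxPN: "l x = P - N" unfolding Ssplit P_def N_def by (simp add: sum_negf)
      have P0: "0 \<le> P" and N0: "0 \<le> N"
        unfolding P_def N_def using c(1) by (auto intro!: sum_nonneg mult_nonneg_nonneg simp: mult_nonneg_nonpos)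
      have gen: "c s *\<^sub>R s \<in> ?H" if "s \<in> S" "0 \<le> l s" for s
        using that c(1) by (intro convex_cone_scaleR[OF H] hull_inc) auto
      show "x \<in> ?H"
      proof (cases "P = 0")
        case True
        then have "N = 0" using lxPN lx N0 by linarith
        then have "c s * - l s = 0" if "s \<in> ?N" for s
          using S(1) c(1) that unfolding N_def by (subst (asm) sum_nonneg_eq_0_iff) (auto simp: mult_nonneg_nonpos)
        then have "(\<Sum>s\<in>?N. c s *\<^sub>R s) = 0" by (intro sum.neutral) auto
        then have "x = (\<Sum>s\<in>?Z. c s *\<^sub>R s) + (\<Sum>s\<in>?P. c s *\<^sub>R s)"
          unfolding c(2) Ssplit by simp
        then show ?thesis using gen by (auto intro!: convex_cone_add[OF H] Hsum)
      next
        case False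
        then have P: "0 < P" using P0 by simp
        \<comment> \<open>Wall generators with the weights \<open>c s * c t / P\<close> absorb the
          whole negative part of x and the fraction N / P of its positive part. The remaining
          fraction 1 - N / P is nonnegative because l x is.\<close>
        have "(\<Sum>s\<in>?P. \<Sum>t\<in>?N. (c s * c t / P) *\<^sub>R (l s *\<^sub>R t - l t *\<^sub>R s))
          = (\<Sum>s\<in>?P. \<Sum>t\<in>?N. ((c s * l s) * (c t / P)) *\<^sub>R t + ((c t * - l t) * (c s / P)) *\<^sub>R s)"
          by (intro sum.cong refl) (simp add: scaleR_diff_right algebra_simps)
        also have "\<dots> = (\<Sum>s\<in>?P. \<Sum>t\<in>?N. ((c s * l s) * (c t / P)) *\<^sub>R t)
           + (\<Sum>s\<in>?P. \<Sum>t\<in>?N. ((c t * - l t) * (c s / P)) *\<^sub>R s)"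
          by (simp only: sum.distrib)
        also have "(\<Sum>s\<in>?P. \<Sum>t\<in>?N. ((c s * l s) * (c t / P)) *\<^sub>R t) = (\<Sum>t\<in>?N. (P * (c t / P)) *\<^sub>R t)"
          unfolding P_def by (subst sum.swap) (simp only: sum_distrib_right scaleR_sum_left)
        also have "\<dots> = (\<Sum>t\<in>?N. c t *\<^sub>R t)" using P by simp
        also have "(\<Sum>s\<in>?P. \<Sum>t\<in>?N. ((c t * - l t) * (c s / P)) *\<^sub>R s) = (\<Sum>s\<in>?P. (N * (c s / P)) *\<^sub>R s)"
          unfolding N_def by (simp only: sum_distrib_right scaleR_sum_left)
        finally have pairs: "(\<Sum>s\<in>?P. \<Sum>t\<in>?N. (c s * c t / P) *\<^sub>R (l s *\<^sub>R t - l t *\<^sub>R s))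
          = (\<Sum>t\<in>?N. c t *\<^sub>R t) + (\<Sum>s\<in>?P. (N * (c s / P)) *\<^sub>R s)" .
        have "c s = N * (c s / P) + (1 - N / P) * c s" for s by (simp add: left_diff_distrib)
        then have "c s *\<^sub>R s = (N * (c s / P)) *\<^sub>R s + ((1 - N / P) * c s) *\<^sub>R s" for s
          by (metis scaleR_add_left)
        then have "(\<Sum>s\<in>?P. c s *\<^sub>R s) = (\<Sum>s\<in>?P. (N * (c s / P)) *\<^sub>R s + ((1 - N / P) * c s) *\<^sub>R s)"
          by (intro sum.cong refl)
        then have "x = (\<Sum>s\<in>?Z. c s *\<^sub>R s) + (\<Sum>s\<in>?P. ((1 - N / P) * c s) *\<^sub>R s) +
           (\<Sum>s\<in>?P. \<Sum>t\<in>?N. (c s * c t / P) *\<^sub>R (l s *\<^sub>R t - l t *\<^sub>R s))"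
          unfolding pairs c(2) Ssplit by (simp add: sum.distrib)
        moreover have "((1 - N / P) * c s) *\<^sub>R s \<in> ?H" if "s \<in> ?P" for s
        proof -
          have "0 \<le> 1 - N / P" using P lx lxPN by simp
          then show ?thesis
            using that gen[of s] convex_cone_scaleR[OF H, of "1 - N / P" "c s *\<^sub>R s"] by simp
        qed
        moreover have "(c s * c t / P) *\<^sub>R (l s *\<^sub>R t - l t *\<^sub>R s) \<in> ?H" if "s \<in> ?P" "t \<in> ?N" for s t
          using that c(1) P by (intro convex_cone_scaleR[OF H] hull_inc) auto
        moreover have "c s *\<^sub>R s \<in> ?H" if "s \<in> ?Z" for s using gen that by auto
        ultimately show ?thesis by (auto intro!: convex_cone_add[OF H] Hsum simp del: scaleR_diff_right)
      qed
    qed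
  qed
  moreover have "?G \<subseteq> L"
    using S(2) assms(2) by (auto intro!: lattice_diff lattice_scale dest: dual_latticeD(2))
  moreover have "finite ?G" using S(1) by simp
  ultimately show ?thesis unfolding rational_cone_def by blast
qed

section \<open>Estimates and gluing for piecewise linear functions on rational cones\<close>

context euclidean_lattice
begin

text \<open>A covering suffices to combine estimates for the linear pieces, so the cells are not
  arranged into a fan.\<close>

lemma rational_cone_sign_cells:
  assumes "finite S" "S \<subseteq> dual_lattice L" "rational_cone L \<sigma>"
  shows "\<exists>\<C>. finite \<C> \<and> \<Union>\<C> = \<sigma> \<and> (\<forall>C\<in>\<C>. rational_cone L C \<and> sign_constant S C)"
  using assms
proof (induction S rule: finite_induct)
  case empty
  then show ?case by (intro exI[of _ "{\<sigma>}"]) (auto simp: sign_constant_def)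
next
  case (insert s S)
  then obtain \<C> where \<C>: "finite \<C>" "\<Union>\<C> = \<sigma>" "\<And>C. C \<in> \<C> \<Longrightarrow> rational_cone L C"
    "\<And>C. C \<in> \<C> \<Longrightarrow> sign_constant S C" by auto
  let ?\<C> = "(\<lambda>C. {x\<in>C. 0 \<le> s x}) ` \<C> \<union> (\<lambda>C. {x\<in>C. 0 \<le> - s x}) ` \<C>"
  have "\<Union>?\<C> = \<sigma>" using \<C>(2) by auto
  moreover have "rational_cone L C \<and> sign_constant (insert s S) C" if "C \<in> ?\<C>" for C
  proof -
    obtain C' where C': "C' \<in> \<C>" "C = {x\<in>C'. 0 \<le> s x} \<or> C = {x\<in>C'. 0 \<le> - s x}"
      using \<open>C \<in> ?\<C>\<close> by blast
    have "s \<in> dual_lattice L" "(\<lambda>x. - s x) \<in> dual_lattice L"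
      using insert.prems by (auto intro: dual_lattice_neg)
    then have "rational_cone L C" using C' \<C>(3) rational_cone_cut[of C'] by blast
    moreover have "sign_constant S C" using \<C>(4)[OF C'(1)] C'(2) by (auto intro: sign_constant_mono)
    then have "sign_constant (insert s S) C" using C'(2) by (auto simp: sign_constant_def)
    ultimately show ?thesis by blast
  qed
  ultimately show ?case using \<C>(1) by (intro exI[of _ ?\<C>]) auto
qed

text \<open>The estimate is arranged at the finitely many generators, where l vanishes if m does. It
  extends to \<sigma> because its solutions form a convex cone.\<close>

lemma pl_dominated_linear:
  assumes "rational_cone L \<sigma>" "l \<in> dual_lattice L" "m \<in> dual_lattice L"
    "\<And>x. x \<in> \<sigma> \<Longrightarrow> 0 \<le> m x" "\<And>x. x \<in> \<sigma> \<Longrightarrow> m x = 0 \<Longrightarrow> l x = 0"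
  shows "\<exists>N::nat. \<forall>x\<in>\<sigma>. \<bar>l x\<bar> \<le> real N * m x"
proof -
  obtain S where S: "finite S" "S \<subseteq> L" "\<sigma> = convex_cone hull S"
    using assms by (auto simp: rational_cone_def)
  have "S \<subseteq> \<sigma>" unfolding S(3) by (rule hull_subset)
  have "\<exists>N::nat. \<bar>l s\<bar> \<le> real N * m s" if "s \<in> S" for s
  proof (cases "m s = 0")
    case True
    then show ?thesis using that \<open>S \<subseteq> \<sigma>\<close> assms(5) by auto
  next
    case False
    then have "0 < m s" using that \<open>S \<subseteq> \<sigma>\<close> assms(4)[of s] by auto
    moreover obtain N where "\<bar>l s\<bar> / m s \<le> real N" using real_arch_simple by blast
    ultimately show ?thesis by (auto simp: field_simps)
  qed
  then obtain N where N: "\<And>s. s \<in> S \<Longrightarrow> \<bar>l s\<bar> \<le> real (N s) * m s" by metis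
  let ?N = "\<Sum>s\<in>S. N s"
  have lin: "linear l" "linear m" using assms(2,3) by (auto dest: dual_latticeD)
  have "convex_cone {x. \<bar>l x\<bar> \<le> real ?N * m x}"
    unfolding convex_cone_iff
  proof (intro conjI ballI allI impI; simp only: mem_Collect_eq linear_eqE[OF lin(1)] linear_eqE[OF lin(2)])
    fix x y assume "\<bar>l x\<bar> \<le> real ?N * m x" "\<bar>l y\<bar> \<le> real ?N * m y"
    then show "\<bar>l x + l y\<bar> \<le> real ?N * (m x + m y)" unfolding distrib_left by linarith
  next
    fix x and c :: real assume "\<bar>l x\<bar> \<le> real ?N * m x" "0 \<le> c"
    then show "\<bar>c * l x\<bar> \<le> real ?N * (c * m x)"
      using mult_left_mono[of "\<bar>l x\<bar>" "real ?N * m x" c] by (simp add: abs_mult mult.left_commute)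
  qed
  moreover have "S \<subseteq> {x. \<bar>l x\<bar> \<le> real ?N * m x}"
  proof safe
    fix s assume s: "s \<in> S"
    have "real (N s) \<le> real ?N" using s S(1) by (intro of_nat_mono member_le_sum) auto
    then show "\<bar>l s\<bar> \<le> real ?N * m s"
      using N[OF s] assms(4)[of s] s \<open>S \<subseteq> \<sigma>\<close> by (meson mult_right_mono order_trans subsetD)
  qed
  ultimately have "\<sigma> \<subseteq> {x. \<bar>l x\<bar> \<le> real ?N * m x}"
    unfolding S(3) by (rule hull_minimal[rotated])
  then show ?thesis by (intro exI[of _ ?N]) auto
qed

text \<open>A Lojasiewicz inequality with exponent 1, obtained from the cells on which both
  functions are linear. Since N is a natural number, \<open>N * D\<close> is again an integral
  piecewise linear function.\<close>

lemma pl_dominated: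
  assumes "rational_cone L \<sigma>" "e \<in> pl_functions L" "D \<in> pl_functions L"
    "\<And>x. x \<in> \<sigma> \<Longrightarrow> 0 \<le> D x" "\<And>x. x \<in> \<sigma> \<Longrightarrow> D x = 0 \<Longrightarrow> e x = 0"
  shows "\<exists>N::nat. \<forall>x\<in>\<sigma>. \<bar>e x\<bar> \<le> real N * D x"
proof -
  obtain S T S' T' where st: "pl_walls L e S T" "pl_walls L D S' T'"
    using pl_walls_exist assms(2,3) by blast
  note * = pl_wallsD[OF st(1)] pl_wallsD[OF st(2)]
  obtain \<C> where \<C>: "finite \<C>" "\<Union>\<C> = \<sigma>" "\<And>C. C \<in> \<C> \<Longrightarrow> rational_cone L C \<and> sign_constant (S \<union> S') C"
    using rational_cone_sign_cells[OF _ _ assms(1), of "S \<union> S'"] *(1,2,6,7) by auto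
  have "\<exists>N::nat. \<forall>x\<in>C. \<bar>e x\<bar> \<le> real N * D x" if C: "C \<in> \<C>" for C
  proof -
    have "sign_constant S C" "sign_constant S' C" using \<C>(3)[OF C] by (auto intro: sign_constant_mono)
    then obtain l m where lm: "l \<in> T" "m \<in> T'" "\<forall>x\<in>C. e x = l x" "\<forall>x\<in>C. D x = m x"
      using *(5,10) by meson
    have "C \<subseteq> \<sigma>" using C \<C>(2) by auto
    then have "\<exists>N::nat. \<forall>x\<in>C. \<bar>l x\<bar> \<le> real N * m x"
      using lm \<C>(3)[OF C] *(4,9) assms(4,5)[OF subsetD[OF \<open>C \<subseteq> \<sigma>\<close>]]
      by (intro pl_dominated_linear) auto
    then show ?thesis using lm by auto
  qed
  then obtain N where N: "\<And>C x. C \<in> \<C> \<Longrightarrow> x \<in> C \<Longrightarrow> \<bar>e x\<bar> \<le> real (N C) * D x" by metis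
  have "\<bar>e x\<bar> \<le> real (\<Sum>C\<in>\<C>. N C) * D x" if "x \<in> \<sigma>" for x
  proof -
    obtain C where C: "C \<in> \<C>" "x \<in> C" using \<open>x \<in> \<sigma>\<close> \<C>(2) by auto
    have "real (N C) \<le> real (\<Sum>C\<in>\<C>. N C)" using C \<C>(1) by (intro of_nat_mono member_le_sum) auto
    then show ?thesis using N[OF C] assms(4)[OF that] by (meson mult_right_mono order_trans)
  qed
  then show ?thesis by blast
qed

text \<open>For one cone, add up the negative parts of its defining inequalities; for a union, take
  the minimum.\<close>

lemma pl_zero_set:
  assumes "finite \<K>" "\<K> \<noteq> {}" "\<And>\<sigma>. \<sigma> \<in> \<K> \<Longrightarrow> rational_cone L \<sigma>"
  shows "\<exists>D\<in>pl_functions L. (\<forall>x. 0 \<le> D x) \<and> (\<forall>x\<in>span L. D x = 0 \<longleftrightarrow> x \<in> \<Union>\<K>)"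
proof -
  have single: "\<exists>D\<in>pl_functions L. (\<forall>x. 0 \<le> D x) \<and> (\<forall>x\<in>span L. D x = 0 \<longleftrightarrow> x \<in> \<sigma>)"
    if \<sigma>: "rational_cone L \<sigma>" for \<sigma>
  proof -
    obtain N where N: "finite N" "N \<subseteq> dual_lattice L" "\<sigma> = {x \<in> span L. \<forall>n\<in>N. 0 \<le> n x}"
      using rational_cone_halfspaces[OF \<sigma>] by blast
    let ?D = "\<lambda>x. \<Sum>n\<in>N. max 0 (- n x)"
    have "?D \<in> pl_functions L"
      using N(2) by (intro pl_sum pl_functions.max pl_zero pl_neg pl_functions.form) auto
    moreover have "?D x = 0 \<longleftrightarrow> (\<forall>n\<in>N. 0 \<le> n x)" for x
      using N(1) by (subst sum_nonneg_eq_0_iff) (auto simp: max_def split: if_splits)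
    moreover have "0 \<le> ?D x" for x by (intro sum_nonneg) simp
    ultimately show ?thesis using N(3) by (intro bexI[of _ ?D]) auto
  qed
  show ?thesis
    using assms
  proof (induction \<K> rule: finite_ne_induct)
    case (singleton \<sigma>)
    then show ?case using single[of \<sigma>] by simp
  next
    case (insert \<sigma> \<K>)
    obtain D where D: "D \<in> pl_functions L" "\<And>x. 0 \<le> D x" "\<And>x. x \<in> span L \<Longrightarrow> D x = 0 \<longleftrightarrow> x \<in> \<sigma>"
      using single[of \<sigma>] insert.prems by auto
    obtain D' where D': "D' \<in> pl_functions L" "\<And>x. 0 \<le> D' x" "\<And>x. x \<in> span L \<Longrightarrow> D' x = 0 \<longleftrightarrow> x \<in> \<Union>\<K>"
    proof -
      have "\<exists>D\<in>pl_functions L. (\<forall>x. 0 \<le> D x) \<and> (\<forall>x\<in>span L. D x = 0 \<longleftrightarrow> x \<in> \<Union>\<K>)"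
        using insert.prems by (intro insert.IH) auto
      then show ?thesis using that by blast
    qed
    have "min (D x) (D' x) = 0 \<longleftrightarrow> x \<in> \<Union>(insert \<sigma> \<K>)" if "x \<in> span L" for x
      using D(2)[of x] D'(2)[of x] D(3)[OF that] D'(3)[OF that] by (auto simp: min_def split: if_splits)
    then show ?case
      using D D' by (intro bexI[of _ "\<lambda>x. min (D x) (D' x)"] pl_min) auto
  qed
qed

text \<open>The function \<open>g - f\<close>, truncated at a multiple of a function vanishing exactly on \<open>\<Union>\<K>\<close>.\<close>
lemma pl_glue:
  assumes \<K>: "finite \<K>" "\<K> \<noteq> {}" "\<And>\<sigma>. \<sigma> \<in> \<K> \<Longrightarrow> rational_cone L \<sigma>"
    and \<sigma>: "rational_cone L \<sigma>" and fg: "f \<in> pl_functions L" "g \<in> pl_functions L"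
    and eq: "\<And>x. x \<in> \<Union>\<K> \<Longrightarrow> x \<in> \<sigma> \<Longrightarrow> f x = g x"
  shows "\<exists>h\<in>pl_functions L. (\<forall>x\<in>\<Union>\<K>. h x = f x) \<and> (\<forall>x\<in>\<sigma>. h x = g x)"
proof -
  obtain D where D: "D \<in> pl_functions L" "\<And>x. 0 \<le> D x" "\<And>x. x \<in> span L \<Longrightarrow> D x = 0 \<longleftrightarrow> x \<in> \<Union>\<K>"
    using pl_zero_set[OF \<K>] by auto
  have \<sigma>L: "\<sigma> \<subseteq> span L" and \<K>L: "\<Union>\<K> \<subseteq> span L"
    using rational_coneD(4)[OF \<sigma>] rational_coneD(4)[OF \<K>(3)] by blast+
  have "(\<lambda>x. g x - f x) \<in> pl_functions L" using fg by (intro pl_functions.diff)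
  then obtain N :: nat where N: "\<forall>x\<in>\<sigma>. \<bar>g x - f x\<bar> \<le> real N * D x"
    using pl_dominated[OF \<sigma>, of "\<lambda>x. g x - f x" D] D eq \<sigma>L by (metis eq_iff_diff_eq_0 subsetD)
  define h where "h = (\<lambda>x. f x + max (- (real N * D x)) (min (g x - f x) (real N * D x)))"
  have "h \<in> pl_functions L"
    unfolding h_def using fg D(1)
    by (intro pl_add pl_functions.max pl_min pl_neg pl_scale_nat pl_functions.diff)
  moreover have "h x = f x" if "x \<in> \<Union>\<K>" for x
  proof -
    have "D x = 0" using that \<K>L D(3) by blast
    then show ?thesis by (simp add: h_def)
  qed
  moreover have "h x = g x" if "x \<in> \<sigma>" for x
    using N[rule_format, OF that] by (auto simp: h_def max_def min_def abs_le_iff)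
  ultimately show ?thesis by blast
qed

text \<open>Gluing takes place in each lattice coordinate separately; the images of \<phi> and
  \<psi> are recovered from their coordinates because they lie in \<open>span L\<close>.\<close>

lemma pl_maps_glue:
  assumes \<K>: "finite \<K>" "\<K> \<noteq> {}" "\<And>\<sigma>. \<sigma> \<in> \<K> \<Longrightarrow> rational_cone L \<sigma>"
    and \<sigma>: "rational_cone L \<sigma>" and fg: "\<phi> \<in> pl_maps L" "\<psi> \<in> pl_maps L"
    and eq: "\<And>x. x \<in> \<Union>\<K> \<Longrightarrow> x \<in> \<sigma> \<Longrightarrow> \<phi> x = \<psi> x"
  shows "\<exists>\<theta>\<in>pl_maps L. (\<forall>x\<in>\<Union>\<K>. \<theta> x = \<phi> x) \<and> (\<forall>x\<in>\<sigma>. \<theta> x = \<psi> x)"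
proof -
  have \<sigma>L: "\<sigma> \<subseteq> span L" and \<K>L: "\<Union>\<K> \<subseteq> span L"
    using rational_coneD(4)[OF \<sigma>] rational_coneD(4)[OF \<K>(3)] by blast+
  obtain B l where Bl: "finite B" "B \<subseteq> L" "\<And>b. b \<in> B \<Longrightarrow> l b \<in> dual_lattice L"
    "\<And>x. x \<in> span L \<Longrightarrow> x = (\<Sum>b\<in>B. l b x *\<^sub>R b)"
    using lattice_coords by metis
  have "\<exists>h\<in>pl_functions L. (\<forall>x\<in>\<Union>\<K>. h x = l b (\<phi> x)) \<and> (\<forall>x\<in>\<sigma>. h x = l b (\<psi> x))" if "b \<in> B" for b
    using fg Bl(3)[OF that] eq by (intro pl_glue[OF \<K> \<sigma>]) (auto simp: pl_maps_def)
  then obtain h where h: "\<And>b. b \<in> B \<Longrightarrow> h b \<in> pl_functions L"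
    "\<And>b x. b \<in> B \<Longrightarrow> x \<in> \<Union>\<K> \<Longrightarrow> h b x = l b (\<phi> x)" "\<And>b x. b \<in> B \<Longrightarrow> x \<in> \<sigma> \<Longrightarrow> h b x = l b (\<psi> x)"
    by metis
  let ?\<theta> = "\<lambda>x. \<Sum>b\<in>B. h b x *\<^sub>R b"
  have "(\<lambda>x. m (?\<theta> x)) \<in> pl_functions L" if m: "m \<in> dual_lattice L" for m
  proof -
    have "(\<lambda>x. \<Sum>b\<in>B. m b * h b x) \<in> pl_functions L"
      using Bl(2) m h(1) by (intro pl_sum pl_scale) (auto intro: dual_latticeD(2))
    then show ?thesis
      by (simp add: linear_sum[OF dual_latticeD(1)[OF m]] linear_scale[OF dual_latticeD(1)[OF m]] mult.commute)
  qed
  moreover have "?\<theta> x \<in> span L" for x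
    using Bl(2) by (intro span_sum span_scale) (auto intro: span_base)
  ultimately have "?\<theta> \<in> pl_maps L" by (simp add: pl_maps_def)
  moreover have "?\<theta> x = \<phi> x" if "x \<in> \<Union>\<K>" for x
  proof -
    have "\<phi> x \<in> span L" using fg(1) that \<K>L by (auto simp: pl_maps_def)
    then show ?thesis using Bl(4)[of "\<phi> x"] h(2)[OF _ that] by simp
  qed
  moreover have "?\<theta> x = \<psi> x" if "x \<in> \<sigma>" for x
  proof -
    have "\<psi> x \<in> span L" using fg(2) that \<sigma>L by (auto simp: pl_maps_def)
    then show ?thesis using Bl(4)[of "\<psi> x"] h(3)[OF _ that] by simp
  qed
  ultimately show ?thesis by (intro bexI[of _ ?\<theta>] conjI ballI)
qed

end

section \<open>Piecewise polynomials on rational fans\<close>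

lemma rational_fanD:
  assumes "rational_fan L F"
  shows "finite F" "\<sigma> \<in> F \<Longrightarrow> rational_cone L \<sigma>"
    "\<sigma> \<in> F \<Longrightarrow> \<tau> face_of \<sigma> \<Longrightarrow> \<tau> \<noteq> {} \<Longrightarrow> \<tau> \<in> F"
    "\<sigma> \<in> F \<Longrightarrow> \<tau> \<in> F \<Longrightarrow> \<sigma> \<inter> \<tau> face_of \<sigma>" "\<sigma> \<in> F \<Longrightarrow> \<tau> \<in> F \<Longrightarrow> \<sigma> \<inter> \<tau> face_of \<tau>"
  using assms unfolding rational_fan_def by blast+

lemma rational_fan_Int:
  assumes "rational_fan L F" "\<sigma> \<in> F" "\<tau> \<in> F"
  shows "\<sigma> \<inter> \<tau> \<in> F"
proof -
  have "0 \<in> \<sigma> \<inter> \<tau>"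
    using rational_coneD(5)[OF rational_fanD(2)[OF assms(1)]] assms(2,3) by blast
  then show ?thesis
    using rational_fanD(3)[OF assms(1,2) rational_fanD(4)[OF assms]] by blast
qed

text \<open>Each step adds a minimal remaining set, so the collection stays closed under passing to
  smaller members of F. For a fan this means that all proper faces of a cone are present when the
  cone is reached.\<close>

lemma finite_downset_induct [consumes 1, case_names empty insert]:
  fixes F :: "'b set set"
  assumes "finite F" "P {}"
    and step: "\<And>A \<tau>. A \<subseteq> F \<Longrightarrow> (\<And>\<sigma> \<rho>. \<sigma> \<in> A \<Longrightarrow> \<rho> \<in> F \<Longrightarrow> \<rho> \<subseteq> \<sigma> \<Longrightarrow> \<rho> \<in> A) \<Longrightarrow> \<tau> \<in> F \<Longrightarrow> \<tau> \<notin> A \<Longrightarrow>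
      (\<And>\<rho>. \<rho> \<in> F \<Longrightarrow> \<rho> \<subset> \<tau> \<Longrightarrow> \<rho> \<in> A) \<Longrightarrow> P A \<Longrightarrow> P (insert \<tau> A)"
  shows "P F"
proof -
  have "\<exists>A\<subseteq>F. card A = n \<and> (\<forall>\<sigma>\<in>A. \<forall>\<rho>\<in>F. \<rho> \<subseteq> \<sigma> \<longrightarrow> \<rho> \<in> A) \<and> P A" if "n \<le> card F" for n
    using that
  proof (induction n)
    case 0
    show ?case using assms(2) by (intro exI[of _ "{}"]) simp
  next
    case (Suc n)
    then obtain A where A: "A \<subseteq> F" "card A = n" "\<And>\<sigma> \<rho>. \<sigma> \<in> A \<Longrightarrow> \<rho> \<in> F \<Longrightarrow> \<rho> \<subseteq> \<sigma> \<Longrightarrow> \<rho> \<in> A" "P A"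
      by auto
    have "F - A \<noteq> {}" using A(1,2) Suc.prems by auto
    moreover have "finite (F - A)" using assms(1) by simp
    ultimately obtain \<tau> where \<tau>: "\<tau> \<in> F - A" "\<And>\<rho>. \<rho> \<in> F - A \<Longrightarrow> \<rho> \<subseteq> \<tau> \<Longrightarrow> \<rho> = \<tau>"
      by (metis finite_has_minimal)
    have "P (insert \<tau> A)" using A \<tau> by (intro step) auto
    moreover have "\<rho> \<in> insert \<tau> A" if "\<sigma> \<in> insert \<tau> A" "\<rho> \<in> F" "\<rho> \<subseteq> \<sigma>" for \<sigma> \<rho>
      using that A(3) \<tau>(2)[of \<rho>] by (cases "\<sigma> = \<tau>") blast+
    moreover have "card (insert \<tau> A) = Suc n"
      using \<tau>(1) A(1,2) assms(1) by (simp add: finite_subset)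
    ultimately show ?case using A(1) \<tau>(1) by (intro exI[of _ "insert \<tau> A"]) auto
  qed
  from this[of "card F"] obtain A where "A \<subseteq> F" "card A = card F" "P A" by auto
  then show ?thesis using assms(1) card_subset_eq by blast
qed

section \<open>Retractions onto a cone of a fan\<close>

context euclidean_lattice
begin

lemma pl_maps_id: "(\<lambda>x. x) \<in> pl_maps L"
  by (auto simp: pl_maps_def intro: pl_functions.form)

text \<open>On \<open>\<tau>\<close> the map is projected to the span of \<open>T\<close> and then pushed into \<open>T\<close> by adding a multiple
  of an interior lattice vector of \<open>T\<close>; the multiple vanishes on \<open>\<Union>\<K>\<close>.\<close>
lemma pl_maps_into_cone:
  assumes \<K>: "finite \<K>" "\<K> \<noteq> {}" "\<And>\<sigma>. \<sigma> \<in> \<K> \<Longrightarrow> rational_cone L \<sigma>"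
    and \<tau>: "rational_cone L \<tau>" and T: "rational_cone L T" and \<phi>: "\<phi> \<in> pl_maps L"
    and into: "\<And>x. x \<in> \<Union>\<K> \<Longrightarrow> x \<in> \<tau> \<Longrightarrow> \<phi> x \<in> T"
  shows "\<exists>\<theta>\<in>pl_maps L. (\<forall>x\<in>\<Union>\<K>. \<theta> x = \<phi> x) \<and> (\<forall>x\<in>\<tau>. \<theta> x \<in> T)"
proof -
  obtain D where D: "D \<in> pl_functions L" "\<And>x. 0 \<le> D x" "\<And>x. x \<in> span L \<Longrightarrow> D x = 0 \<longleftrightarrow> x \<in> \<Union>\<K>"
    using pl_zero_set[OF \<K>] by auto
  obtain N where N: "finite N" "N \<subseteq> dual_lattice L" "T = {x \<in> span L. \<forall>n\<in>N. 0 \<le> n x}"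
    using rational_cone_halfspaces[OF T] by blast
  obtain G where G: "finite G" "G \<subseteq> L" "T = convex_cone hull G"
    using T by (auto simp: rational_cone_def)
  obtain h where h: "linear h" "\<And>x. x \<in> span T \<Longrightarrow> h x = x" "\<And>x. x \<in> L \<Longrightarrow> h x \<in> L \<inter> span T"
    using integral_projection[OF rational_coneD(6)[OF T]] by metis
  have \<tau>L: "\<tau> \<subseteq> span L" using rational_coneD(4)[OF \<tau>] .
  have h_span: "h x \<in> span T" if "x \<in> span L" for x
  proof -
    have "h x \<in> span (h ` L)" using that linear_span_image[OF h(1), of L] by blast
    also have "\<dots> \<subseteq> span T" using h(3) by (intro span_minimal) auto
    finally show ?thesis .
  qed
  have hpl: "(\<lambda>x. n (h (\<phi> x))) \<in> pl_functions L" if "n \<in> dual_lattice L" for n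
  proof -
    have "(\<lambda>x. n (h x)) \<in> dual_lattice L" using dual_lattice_compose[OF that h(1), of L] h(3) by blast
    then show ?thesis using \<phi> by (auto simp: pl_maps_def)
  qed
  have "\<exists>k::nat. \<forall>x\<in>\<tau>. \<bar>max 0 (- n (h (\<phi> x)))\<bar> \<le> real k * D x" if n: "n \<in> N" for n
  proof (rule pl_dominated[OF \<tau> _ D(1,2)])
    show "(\<lambda>x. max 0 (- n (h (\<phi> x)))) \<in> pl_functions L"
      using n N(2) by (intro pl_functions.max pl_zero pl_neg hpl) auto
    fix x assume x: "x \<in> \<tau>" "D x = 0"
    then have "x \<in> \<Union>\<K>" using D(3) \<tau>L by blast
    then have "\<phi> x \<in> T" using into x(1) by blast
    then have "h (\<phi> x) \<in> T" using h(2) by (simp add: span_base)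
    then show "max 0 (- n (h (\<phi> x))) = 0" using N(3) n by auto
  qed
  then obtain k where k: "\<And>n x. n \<in> N \<Longrightarrow> x \<in> \<tau> \<Longrightarrow> \<bar>max 0 (- n (h (\<phi> x)))\<bar> \<le> real (k n) * D x"
    by metis
  define K where "K = (\<Sum>n\<in>N. k n)"
  \<comment> \<open>A lattice vector in the relative interior of T: an inequality of T that is an
    equality at u is one at all generators.\<close>
  define u where "u = (\<Sum>g\<in>G. g)"
  have uL: "u \<in> L" unfolding u_def using G(2) by (intro lattice_sum) auto
  define \<psi> where "\<psi> = (\<lambda>x. h (\<phi> x) + (real K * D x) *\<^sub>R u)"
  have \<psi>T: "\<psi> x \<in> T" if x: "x \<in> \<tau>" for x
  proof -
    have \<phi>x: "\<phi> x \<in> span L" using \<phi> x \<tau>L by (auto simp: pl_maps_def)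
    have TL: "span T \<subseteq> span L" using rational_coneD(4)[OF T] by (metis span_minimal subspace_span)
    have "\<psi> x \<in> span L"
      unfolding \<psi>_def using h_span[OF \<phi>x] TL uL by (intro span_add span_scale) (auto intro: span_base)
    moreover have "0 \<le> n (\<psi> x)" if n: "n \<in> N" for n
    proof -
      have linn: "linear n" using n N(2) by (auto dest: dual_latticeD)
      have eq: "n (\<psi> x) = n (h (\<phi> x)) + real K * D x * n u"
        by (simp add: \<psi>_def linear_eqE[OF linn])
      have nG: "0 \<le> n g" if "g \<in> G" for g
        using hull_inc[OF that, of convex_cone] n N(3) G(3) by auto
      have nu: "n u = (\<Sum>g\<in>G. n g)" by (simp add: u_def linear_sum[OF linn])
      \<comment> \<open>If n u = 0, then n vanishes on \<open>span T\<close>, which contains the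
        values of h on \<open>span L\<close>. Otherwise integrality gives n u \<ge> 1, so the
        summand along u outweighs the negative part of n, which is at most
        \<open>K * D\<close>.\<close>
      show ?thesis
      proof (cases "n u = 0")
        case True
        then have "\<And>g. g \<in> G \<Longrightarrow> n g = 0"
          using nG G(1) unfolding nu by (subst (asm) sum_nonneg_eq_0_iff) auto
        then have "n y = 0" if "y \<in> span T" for y
          using linear_eq_0_on_span[OF linn, of G y] that unfolding G(3) span_convex_cone_hull by blast
        then show ?thesis using True eq h_span[OF \<phi>x] by simp
      next
        case False
        moreover have "0 \<le> n u" unfolding nu using nG by (intro sum_nonneg)
        moreover have "n u \<in> \<int>" using dual_latticeD(2)[of n L u] n N(2) uL by auto
        ultimately have "1 \<le> n u" by (auto elim!: Ints_cases)
        have "- n (h (\<phi> x)) \<le> real (k n) * D x" using k[OF n x] by linarith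
        also have "\<dots> \<le> real K * D x"
          unfolding K_def using n N(1) D(2)[of x] by (intro mult_right_mono of_nat_mono member_le_sum) auto
        also have "\<dots> \<le> real K * D x * n u"
          using \<open>1 \<le> n u\<close> D(2)[of x] mult_left_mono[of 1 "n u" "real K * D x"] by simp
        finally show ?thesis unfolding eq by simp
      qed
    qed
    ultimately show ?thesis unfolding N(3) by blast
  qed
  have "\<psi> \<in> pl_maps L"
    unfolding pl_maps_def
  proof (intro CollectI conjI ballI)
    fix x assume "x \<in> span L"
    then have "h (\<phi> x) \<in> span T" using \<phi> h_span by (auto simp: pl_maps_def)
    moreover have "span T \<subseteq> span L" using rational_coneD(4)[OF T] by (metis span_minimal subspace_span)
    ultimately show "\<psi> x \<in> span L"
      unfolding \<psi>_def using uL by (intro span_add span_scale) (auto intro: span_base)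
  next
    fix l assume l: "l \<in> dual_lattice L"
    have "(\<lambda>x. n (h (\<phi> x)) + l u * (real K * D x)) \<in> pl_functions L" if "n \<in> dual_lattice L" for n
      using that l uL D(1) by (intro pl_add pl_scale pl_scale_nat hpl) (auto dest: dual_latticeD(2))
    from this[OF l] show "(\<lambda>x. l (\<psi> x)) \<in> pl_functions L"
      by (simp add: \<psi>_def linear_eqE[OF dual_latticeD(1)[OF l]] mult.commute)
  qed
  moreover have "\<phi> x = \<psi> x" if "x \<in> \<Union>\<K>" "x \<in> \<tau>" for x
  proof -
    have "D x = 0" using that D(3) \<tau>L by blast
    moreover have "h (\<phi> x) = \<phi> x" using into[OF that] h(2) by (simp add: span_base)
    ultimately show ?thesis by (simp add: \<psi>_def)
  qed
  ultimately obtain \<theta> where "\<theta> \<in> pl_maps L" "\<forall>x\<in>\<Union>\<K>. \<theta> x = \<phi> x" "\<forall>x\<in>\<tau>. \<theta> x = \<psi> x"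
    using pl_maps_glue[OF \<K> \<tau> \<phi>, of \<psi>] by auto
  then show ?thesis using \<psi>T by (intro bexI[of _ \<theta>]) auto
qed

text \<open>Faces are treated first, and every extension also keeps the values on Q, where the map
  is the identity. A point of the new cone \<tau> that lies in an earlier cone lies in an
  intersection with \<tau> that is itself an earlier cone, so its image is already in Q \<inter>
  \<tau>.\<close>

lemma fan_retraction:
  assumes F: "rational_fan L F" and Q: "Q \<in> F"
  shows "\<exists>\<phi>\<in>pl_maps L. (\<forall>x\<in>Q. \<phi> x = x) \<and> (\<forall>\<tau>\<in>F. \<forall>x\<in>\<tau>. \<phi> x \<in> Q \<inter> \<tau>)"
  using rational_fanD(1)[OF F]
proof (induction F rule: finite_downset_induct)
  case empty
  then show ?case using pl_maps_id by auto
next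
  case (insert A \<tau>)
  obtain \<phi> where \<phi>: "\<phi> \<in> pl_maps L" "\<And>x. x \<in> Q \<Longrightarrow> \<phi> x = x" "\<And>\<sigma> x. \<sigma> \<in> A \<Longrightarrow> x \<in> \<sigma> \<Longrightarrow> \<phi> x \<in> Q \<inter> \<sigma>"
    using insert.IH by auto
  have QA: "rational_cone L \<sigma>" if "\<sigma> \<in> insert Q A" for \<sigma>
    using that Q insert.hyps(1) rational_fanD(2)[OF F] by auto
  have finA: "finite (insert Q A)" using insert.hyps(1) rational_fanD(1)[OF F] finite_subset by auto
  have "\<phi> x \<in> Q \<inter> \<tau>" if x: "x \<in> \<Union>(insert Q A)" "x \<in> \<tau>" for x
  proof (cases "x \<in> Q")
    case True
    then show ?thesis using \<phi>(2) x by simp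
  next
    case False
    then obtain \<sigma> where \<sigma>: "\<sigma> \<in> A" "x \<in> \<sigma>" using x by auto
    then have "\<tau> \<inter> \<sigma> \<in> F" using insert.hyps(1,3) by (intro rational_fan_Int[OF F]) auto
    then have "\<tau> \<inter> \<sigma> \<in> A" using insert.hyps(2)[OF \<sigma>(1)] by blast
    then show ?thesis using \<phi>(3)[of "\<tau> \<inter> \<sigma>" x] \<sigma> x by auto
  qed
  moreover have "rational_cone L (Q \<inter> \<tau>)"
    using rational_fanD(2)[OF F] rational_fan_Int[OF F Q insert.hyps(3)] by blast
  moreover have "rational_cone L \<tau>" using rational_fanD(2)[OF F insert.hyps(3)] .
  ultimately obtain \<theta> where \<theta>: "\<theta> \<in> pl_maps L" "\<forall>x\<in>\<Union>(insert Q A). \<theta> x = \<phi> x" "\<forall>x\<in>\<tau>. \<theta> x \<in> Q \<inter> \<tau>"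
    using pl_maps_into_cone[OF finA _ QA, of \<tau> "Q \<inter> \<tau>" \<phi>] \<phi>(1) by auto
  have "\<theta> x = x" if "x \<in> Q" for x using \<theta>(2) \<phi>(2) that by auto
  moreover have "\<theta> x \<in> Q \<inter> \<sigma>" if "\<sigma> \<in> insert \<tau> A" "x \<in> \<sigma>" for \<sigma> x
  proof (cases "\<sigma> = \<tau>")
    case True
    then show ?thesis using that \<theta>(3) by blast
  next
    case False
    then have "\<sigma> \<in> A" using that by simp
    then have "\<theta> x = \<phi> x" using \<theta>(2) that(2) by blast
    then show ?thesis using \<phi>(3)[OF \<open>\<sigma> \<in> A\<close> that(2)] by simp
  qed
  ultimately show ?case using \<theta>(1) by (intro bexI[of _ \<theta>]) auto
qed

text \<open>If \<open>g\<close> represents \<open>f\<close> on the cones treated so far and \<open>e\<close> represents \<open>f - g\<close> on \<open>\<tau>\<close>, then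
  \<open>e\<close> composed with the retraction onto \<open>\<tau>\<close> vanishes on the former cones.\<close>
lemma piecewise_pl_power:
  assumes F: "rational_fan L F"
    and f: "\<And>\<sigma>. \<sigma> \<in> F \<Longrightarrow> \<exists>g\<in>pl_power k L. \<forall>x\<in>\<sigma>. f x = g x"
  shows "\<exists>g\<in>pl_power k L. \<forall>x\<in>\<Union>F. f x = g x"
proof -
  have "\<exists>g\<in>pl_power k L. \<forall>x\<in>\<Union>A. f x = g x" if "finite A" "A \<subseteq> F" for A
    using that
  proof (induction A rule: finite_induct)
    case empty
    then show ?case using pl_power_zero by auto
  next
    case (insert \<tau> A)
    obtain g where g: "g \<in> pl_power k L" "\<forall>x\<in>\<Union>A. f x = g x" using insert by auto
    obtain g' where g': "g' \<in> pl_power k L" "\<forall>x\<in>\<tau>. f x = g' x" using f[of \<tau>] insert.prems by auto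
    have \<tau>F: "\<tau> \<in> F" using insert.prems by simp
    obtain \<phi> where \<phi>: "\<phi> \<in> pl_maps L" "\<And>x. x \<in> \<tau> \<Longrightarrow> \<phi> x = x"
      "\<And>\<sigma> x. \<sigma> \<in> F \<Longrightarrow> x \<in> \<sigma> \<Longrightarrow> \<phi> x \<in> \<tau> \<inter> \<sigma>"
      using fan_retraction[OF F \<tau>F] by auto
    define e where "e = (\<lambda>x. g' x - g x)"
    have e: "e \<in> pl_power k L" unfolding e_def using g g' by (intro pl_power.diff)
    define r where "r = (\<lambda>x. g x + e (\<phi> x))"
    have "r \<in> pl_power k L"
      unfolding r_def using g(1) pl_power_compose[OF e \<phi>(1)] by (rule pl_power_add)
    moreover have "f x = r x" if x: "x \<in> \<Union>(insert \<tau> A)" for x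
    proof (cases "x \<in> \<tau>")
      case True
      then show ?thesis using \<phi>(2) g'(2) by (simp add: r_def e_def)
    next
      case False
      then obtain \<sigma> where \<sigma>: "\<sigma> \<in> A" "x \<in> \<sigma>" using x by auto
      then have "\<phi> x \<in> \<tau> \<inter> \<sigma>" using \<phi>(3) insert.prems by auto
      then have "e (\<phi> x) = 0" using g(2) g'(2) \<sigma>(1) by (auto simp: e_def)
      then show ?thesis using g(2) \<sigma> by (auto simp: r_def)
    qed
    ultimately show ?case by blast
  qed
  then show ?thesis using rational_fanD(1)[OF F] by blast
qed

lemma PP_pl_power:
  assumes F: "rational_fan L F" and f: "f \<in> PP L k F"
  shows "\<exists>g\<in>pl_power k L. \<forall>x\<in>\<Union>F. f x = g x"
proof (rule piecewise_pl_power[OF F])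
  fix \<sigma> assume \<sigma>: "\<sigma> \<in> F"
  then obtain p where p: "p \<in> sym_power k (L \<inter> span \<sigma>)" "\<forall>x\<in>\<sigma>. f x = p x"
    using f by (auto simp: PP_def)
  obtain p' where "p' \<in> sym_power k L" "\<And>x. x \<in> span \<sigma> \<Longrightarrow> p' x = p x"
    using sym_power_extend[OF rational_coneD(6)[OF rational_fanD(2)[OF F \<sigma>]] p(1)] by metis
  then show "\<exists>g\<in>pl_power k L. \<forall>x\<in>\<sigma>. f x = g x"
    using p(2) sym_power_subset_pl_power[of k L] by (intro bexI[of _ p']) (auto simp: span_base)
qed

end

section \<open>Unimodular fans\<close>

lemma sym_power_1: "p \<in> sym_power 1 M \<Longrightarrow> p \<in> dual_lattice M"
proof (induction rule: sym_power.induct)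
  case (prod l)
  then show ?case using prod[of 0] by simp
qed (rule dual_lattice_diff)

text \<open>The point a + b is the midpoint of 2a and 2b, so the face contains 2a and therefore
  a.\<close>

lemma face_of_cone_addD:
  assumes "\<tau> face_of \<sigma>" "convex_cone \<tau>" "a \<in> \<sigma>" "b \<in> \<sigma>" "a + b \<in> \<tau>" "convex_cone \<sigma>"
  shows "a \<in> \<tau>"
proof (cases "a = b")
  case True
  then have "(1/2) *\<^sub>R (a + b) \<in> \<tau>" using assms by (intro convex_cone_scaleR) auto
  then show ?thesis using True by (simp add: scaleR_2[symmetric])
next
  case False
  have "2 *\<^sub>R a \<in> \<sigma>" "2 *\<^sub>R b \<in> \<sigma>" using assms by (auto intro: convex_cone_scaleR)
  moreover have "a + b \<in> open_segment (2 *\<^sub>R a) (2 *\<^sub>R b)"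
    using False unfolding in_segment by (auto intro!: exI[of _ "1/2"])
  ultimately have "2 *\<^sub>R a \<in> \<tau>" using face_ofD[OF assms(1)] assms(5) by blast
  then have "(1/2) *\<^sub>R (2 *\<^sub>R a) \<in> \<tau>" using convex_cone_scaleR[OF assms(2), of "1/2" "2 *\<^sub>R a"] by simp
  then show ?thesis by simp
qed

lemma cone_coordinates:
  fixes S :: "'a::euclidean_space set" and l :: "'a \<Rightarrow> 'a \<Rightarrow> real"
  assumes "finite S" and lin: "\<forall>s\<in>S. linear (l s)"
    and dual_eq: "\<forall>s\<in>S. \<forall>t\<in>S. l s t = (if t = s then 1 else 0)"
  shows "x \<in> span S \<Longrightarrow> x = (\<Sum>s\<in>S. l s x *\<^sub>R s)"
    and "T \<subseteq> S \<Longrightarrow> convex_cone hull T = {x \<in> span S. (\<forall>s\<in>S. 0 \<le> l s x) \<and> (\<forall>s\<in>S - T. l s x = 0)}"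
proof -
  note l = lin[rule_format] and dual = dual_eq[rule_format]
  show expand: "x = (\<Sum>s\<in>S. l s x *\<^sub>R s)" if "x \<in> span S" for x
    using biorthogonal_expansion[OF assms that] .
  assume T: "T \<subseteq> S"
  have finT: "finite T" using T assms(1) finite_subset by blast
  have coeff: "l s (\<Sum>t\<in>T. c t *\<^sub>R t) = (if s \<in> T then c s else 0)" if s: "s \<in> S" for s and c :: "'a \<Rightarrow> real"
  proof -
    have "l s (\<Sum>t\<in>T. c t *\<^sub>R t) = (\<Sum>t\<in>T. c t * l s t)"
      by (simp add: linear_sum[OF l[OF s]] linear_scale[OF l[OF s]])
    also have "\<dots> = (\<Sum>t\<in>T. if t = s then c t else 0)"
      using s T by (intro sum.cong) (auto simp: dual subset_iff)
    finally show ?thesis using finT by simp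
  qed
  show "convex_cone hull T = {x \<in> span S. (\<forall>s\<in>S. 0 \<le> l s x) \<and> (\<forall>s\<in>S - T. l s x = 0)}" (is "_ = ?R")
  proof (intro subset_antisym subsetI)
    fix x assume "x \<in> convex_cone hull T"
    then obtain c where c: "\<forall>s\<in>T. 0 \<le> c s" "x = (\<Sum>t\<in>T. c t *\<^sub>R t)"
      unfolding convex_cone_hull_finite[OF finT] by blast
    have "x \<in> span S" unfolding c(2) using T by (intro span_sum span_scale) (auto intro: span_base)
    then show "x \<in> ?R" using c coeff by auto
  next
    fix x assume x: "x \<in> ?R"
    have "x = (\<Sum>s\<in>S. l s x *\<^sub>R s)" using x expand by blast
    also have "\<dots> = (\<Sum>s\<in>T. l s x *\<^sub>R s)"
      using x T assms(1) by (intro sum.mono_neutral_right) auto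
    finally show "x \<in> convex_cone hull T"
      unfolding convex_cone_hull_finite[OF finT] using x T by (intro CollectI exI[of _ "\<lambda>s. l s x"]) auto
  qed
qed

text \<open>The coordinates outside T are nonnegative on the larger cone, so they vanish inside a
  segment only if they vanish at both ends.\<close>

lemma cone_hull_face:
  fixes S :: "'a::euclidean_space set"
  assumes "finite S" "independent S" "T \<subseteq> S"
  shows "convex_cone hull T face_of convex_cone hull S"
proof -
  obtain l where l: "\<And>s. linear (l s)" "\<And>s t. t \<in> S \<Longrightarrow> l s t = (if t = s then 1 else (0::real))"
    using biorthogonal_forms[OF assms(2)] by metis
  have "\<forall>s\<in>S. linear (l s)" "\<forall>s\<in>S. \<forall>t\<in>S. l s t = (if t = s then 1 else 0)" using l by auto
  note hull = cone_coordinates(2)[OF assms(1) this]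
  have S: "convex_cone hull S = {x \<in> span S. \<forall>s\<in>S. 0 \<le> l s x}"
    using hull[of S] by auto
  show ?thesis
    unfolding face_of_def
  proof (intro conjI ballI impI)
    show "convex_cone hull T \<subseteq> convex_cone hull S" using assms(3) by (rule hull_mono)
    show "convex (convex_cone hull T)" by (rule convex_convex_cone_hull)
    have *: "a \<in> convex_cone hull T"
      if ab: "a \<in> convex_cone hull S" "b \<in> convex_cone hull S" and x: "x \<in> convex_cone hull T" "x \<in> open_segment a b"
      for a b x
    proof -
      obtain u where u: "0 < u" "u < 1" "x = (1 - u) *\<^sub>R a + u *\<^sub>R b" using x(2) by (auto simp: in_segment)
      have "l s a = 0" if s: "s \<in> S - T" for s
      proof -
        have nn: "0 \<le> l s a" "0 \<le> l s b" using ab s unfolding S by auto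
        have "0 = l s x" using x(1) s unfolding hull[OF assms(3)] by simp
        also have "\<dots> = (1 - u) * l s a + u * l s b" unfolding u(3) by (simp add: linear_eqE[OF l(1)])
        finally have "(1 - u) * l s a = 0"
          using nn u by (smt (verit) mult_nonneg_nonneg)
        then show ?thesis using u by simp
      qed
      then show ?thesis using ab(1) unfolding S hull[OF assms(3)] by blast
    qed
    fix a b x assume "a \<in> convex_cone hull S" "b \<in> convex_cone hull S" "x \<in> convex_cone hull T" "x \<in> open_segment a b"
    then show "a \<in> convex_cone hull T" "b \<in> convex_cone hull T"
      using *[of a b x] *[of b a x] by (auto simp: open_segment_commute)
  qed
qed

lemma dim_cone_hull:
  fixes S :: "'a::euclidean_space set"
  assumes "independent S"
  shows "dim (convex_cone hull S) = card S"
  using span_convex_cone_hull[of S] dim_eq_card_independent[OF assms] by (metis dim_span)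

lemma convex_cone_hull_singleton: "x \<in> convex_cone hull {v} \<longleftrightarrow> (\<exists>t\<ge>0. x = t *\<^sub>R v)"
  by (simp add: convex_cone_hull_insert)

text \<open>This justifies the definite description: the integral coordinate of v shows that lattice
  points on the ray are natural multiples of v, and a competitor differs from v by factors whose
  product is 1.\<close>

lemma (in euclidean_lattice) primitive_vector_basis:
  assumes B: "lattice_basis L B" "v \<in> B"
  shows "primitive_vector L (convex_cone hull {v}) = v"
  unfolding primitive_vector_def
proof (rule the_equality)
  let ?r = "convex_cone hull {v}"
  obtain l where l: "l \<in> dual_lattice L" "\<And>c. c \<in> B \<Longrightarrow> l c = (if c = v then 1 else 0)"
    using dual_basis[OF B] by metis
  note linl = dual_latticeD(1)[OF l(1)]
  have v: "v \<in> L \<inter> ?r" "v \<noteq> 0"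
    using lattice_basis_subset[OF B(1)] B(2) dependent_zero[of B] by (auto intro: hull_inc)
  have mult: "\<exists>n::nat. w = of_nat n *\<^sub>R v" if w: "w \<in> L \<inter> ?r" for w
  proof -
    obtain t where t: "0 \<le> t" "w = t *\<^sub>R v" using w convex_cone_hull_singleton by blast
    have "l w = t" using l(2)[OF B(2)] t(2) by (simp add: linear_eqE[OF linl])
    then have "t \<in> \<int>" using dual_latticeD(2)[OF l(1)] w by auto
    then have "t = of_nat (nat \<lfloor>t\<rfloor>)" using t(1) by (auto elim!: Ints_cases)
    then show ?thesis using t(2) by metis
  qed
  then show "v \<in> L \<inter> ?r \<and> v \<noteq> 0 \<and> (\<forall>w\<in>L \<inter> ?r. \<exists>n::nat. w = of_nat n *\<^sub>R v)"
    using v by blast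
  fix v' assume v': "v' \<in> L \<inter> ?r \<and> v' \<noteq> 0 \<and> (\<forall>w\<in>L \<inter> ?r. \<exists>n::nat. w = of_nat n *\<^sub>R v')"
  obtain n m :: nat where nm: "v' = of_nat n *\<^sub>R v" "v = of_nat m *\<^sub>R v'" using mult v' v by blast
  have "1 = real m * real n" using l(2)[OF B(2)] nm by (metis linear_eqE(3)[OF linl] mult.right_neutral)
  then have "m * n = 1" by (metis of_nat_1 of_nat_eq_iff of_nat_mult)
  then show "v' = v" using nm by simp
qed

section \<open>Generators of the cones of a unimodular fan and their hat functions\<close>

locale unimodular = euclidean_lattice L for L :: "'a::euclidean_space set" +
  fixes F :: "'a set set"
  assumes unimodular: "unimodular_fan L F"
begin

lemma fan: "rational_fan L F"
  using unimodular by (simp add: unimodular_fan_def)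

text \<open>Taken from the rays of the fan and not from a chosen basis, so that it matches the index
  set of \<open>Psi_cone\<close> and is compatible with intersections of cones.\<close>

definition gens :: "'a set \<Rightarrow> 'a set" where
  "gens \<sigma> = {v \<in> primitive_vector L ` rays F. v \<in> \<sigma>}"

lemma finite_rays: "finite (rays F)"
  using rational_fanD(1)[OF fan] by (simp add: rays_def)

lemma ray_primitive:
  assumes "r \<in> rays F"
  shows "r = convex_cone hull {primitive_vector L r}" "\<exists>B. lattice_basis L B \<and> primitive_vector L r \<in> B"
proof -
  have r: "r \<in> F" "dim r = 1" using assms by (auto simp: rays_def)
  obtain B S where BS: "lattice_basis L B" "S \<subseteq> B" "r = convex_cone hull S"
    using unimodular r(1) unfolding unimodular_fan_def by blast
  have "independent S" using lattice_basis_subset(3)[OF BS(1)] BS(2) independent_mono by blast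
  then have "card S = 1" using dim_cone_hull[of S] BS(3) r(2) by simp
  then obtain v where v: "S = {v}" by (auto simp: card_1_singleton_iff)
  then have "primitive_vector L r = v" using primitive_vector_basis[OF BS(1), of v] BS by simp
  then show "r = convex_cone hull {primitive_vector L r}" "\<exists>B. lattice_basis L B \<and> primitive_vector L r \<in> B"
    using BS v by auto
qed

text \<open>The generators S given by unimodularity are recovered from the fan. Each s in S spans a
  face of \<sigma>, hence a ray of F. Conversely, a primitive v in \<sigma> spans a face of
  \<sigma>, which contains every s in S with positive coordinate in v; such an s lies on the ray of
  v, and as both are primitive they coincide.\<close>

lemma gens_basis:
  assumes \<sigma>: "\<sigma> \<in> F"
  shows "\<exists>B. lattice_basis L B \<and> gens \<sigma> \<subseteq> B \<and> \<sigma> = convex_cone hull (gens \<sigma>)"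
proof -
  obtain B S where BS: "lattice_basis L B" "S \<subseteq> B" "\<sigma> = convex_cone hull S"
    using unimodular \<sigma> unfolding unimodular_fan_def by blast
  note B = lattice_basis_subset[OF BS(1)]
  have S: "finite S" "independent S" using B BS(2) finite_subset independent_mono by blast+
  have "gens \<sigma> = S"
  proof (intro subset_antisym subsetI)
    fix s assume s: "s \<in> S"
    let ?r = "convex_cone hull {s}"
    have "?r face_of \<sigma>" unfolding BS(3) using S s by (intro cone_hull_face) auto
    then have "?r \<in> F" using rational_fanD(3)[OF fan \<sigma>] convex_cone_hull_nonempty by blast
    moreover have "dim ?r = 1"
    proof -
      have "independent {s}" using S(2) s independent_mono[of S "{s}"] by blast
      then show ?thesis using dim_cone_hull by fastforce
    qed
    ultimately have "?r \<in> rays F" by (simp add: rays_def)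
    moreover have "primitive_vector L ?r = s" using primitive_vector_basis[OF BS(1)] BS(2) s by blast
    moreover have "s \<in> \<sigma>" unfolding BS(3) using s by (rule hull_inc)
    ultimately show "s \<in> gens \<sigma>" unfolding gens_def by (metis (mono_tags, lifting) image_eqI mem_Collect_eq)
  next
    fix v assume "v \<in> gens \<sigma>"
    then obtain r where r: "r \<in> rays F" "v = primitive_vector L r" "v \<in> \<sigma>" by (auto simp: gens_def)
    have r\<sigma>: "r = convex_cone hull {v}" using ray_primitive(1)[OF r(1)] r(2) by simp
    obtain B' where B': "lattice_basis L B'" "v \<in> B'" using ray_primitive(2)[OF r(1)] r(2) by auto
    have vL: "v \<in> L" "v \<noteq> 0" using lattice_basis_subset[OF B'(1)] B'(2) dependent_zero by blast+
    have rF: "r \<in> F" using r(1) by (simp add: rays_def)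
    have cc: "convex_cone \<sigma>" "convex_cone r" using BS(3) r\<sigma> convex_cone_convex_cone_hull by auto
    have "r \<subseteq> \<sigma>" unfolding r\<sigma> using r(3) cc(1) by (intro hull_minimal) auto
    then have face: "r face_of \<sigma>" using rational_fanD(4)[OF fan \<sigma> rF] by (simp add: Int_absorb1)
    have "\<forall>s\<in>S. \<exists>l. l \<in> dual_lattice L \<and> (\<forall>c\<in>B. l c = (if c = s then 1 else 0))"
      using dual_basis[OF BS(1)] BS(2) by (metis subsetD)
    then obtain l where l: "\<And>s. s \<in> S \<Longrightarrow> l s \<in> dual_lattice L"
      "\<And>s c. s \<in> S \<Longrightarrow> c \<in> B \<Longrightarrow> l s c = (if c = s then 1 else 0)" by metis
    have lS: "\<forall>s\<in>S. linear (l s)" "\<forall>s\<in>S. \<forall>t\<in>S. l s t = (if t = s then 1 else 0)"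
      using l(1) dual_latticeD(1) l(2) BS(2) by blast+
    note coords = cone_coordinates[OF S(1) lS]
    have v1: "v \<in> span S" "\<And>s. s \<in> S \<Longrightarrow> 0 \<le> l s v"
      using r(3) coords(2)[of S] unfolding BS(3) by auto
    have "\<exists>s\<in>S. l s v \<noteq> 0"
    proof (rule ccontr)
      assume "\<not> ?thesis"
      then have "(\<Sum>s\<in>S. l s v *\<^sub>R s) = 0" by (intro sum.neutral) auto
      then show False using coords(1)[OF v1(1)] vL(2) by simp
    qed
    then obtain s where s: "s \<in> S" "0 < l s v" using v1(2) by force
    have v_split: "v = l s v *\<^sub>R s + (\<Sum>t\<in>S - {s}. l t v *\<^sub>R t)"
      using coords(1)[OF v1(1)] sum.remove[OF S(1) s(1), of "\<lambda>s. l s v *\<^sub>R s"] by (rule trans)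
    have S\<sigma>: "S \<subseteq> \<sigma>" unfolding BS(3) by (rule hull_subset)
    have "l s v *\<^sub>R s \<in> r"
    proof (rule face_of_cone_addD[OF face cc(2) _ _ _ cc(1)])
      show "l s v *\<^sub>R s \<in> \<sigma>" using s S\<sigma> cc(1) by (intro convex_cone_scaleR) auto
      show "(\<Sum>t\<in>S - {s}. l t v *\<^sub>R t) \<in> \<sigma>"
        using S\<sigma> v1(2) cc(1) by (intro convex_cone_sum convex_cone_scaleR) auto
      show "l s v *\<^sub>R s + (\<Sum>t\<in>S - {s}. l t v *\<^sub>R t) \<in> r"
        using v_split r\<sigma> hull_inc[of v "{v}" convex_cone] by simp
    qed
    then have "(1 / l s v) *\<^sub>R (l s v *\<^sub>R s) \<in> r"
      using convex_cone_scaleR[OF cc(2), of "1 / l s v" "l s v *\<^sub>R s"] s(2) by simp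
    then have "s \<in> r" using s(2) by simp
    then obtain t where t: "0 \<le> t" "s = t *\<^sub>R v" unfolding r\<sigma> convex_cone_hull_singleton by blast
    obtain m where m: "m \<in> dual_lattice L" "m v = 1" using dual_basis[OF B'] B'(2) by metis
    have "m s = t" using t(2) m by (simp add: linear_eqE[OF dual_latticeD(1)[OF m(1)]])
    moreover have "s \<in> L" using s(1) BS(2) B(2) by blast
    ultimately have "t \<in> \<int>" using dual_latticeD(2)[OF m(1)] by auto
    moreover have "l s v \<in> \<int>" using dual_latticeD(2)[OF l(1)[OF s(1)] vL(1)] .
    \<comment> \<open>Both factors are integers, being values of integral forms at lattice vectors;
      as t is nonnegative, it equals 1.\<close>
    moreover have "1 = t * l s v"
      using l(2)[OF s(1), of s] s(1) BS(2) t(2) linear_eqE(3)[OF lS(1)[rule_format, OF s(1)], of t v] by auto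
    ultimately obtain a b :: int where ab: "t = of_int a" "l s v = of_int b" "1 = a * b"
      by (metis Ints_cases of_int_1 of_int_eq_iff of_int_mult)
    have "0 \<le> a" using t(1) ab(1) by simp
    then have "a = 1" using ab(3) zmult_eq_1_iff[of a b] by auto
    then show "v \<in> S" using t(2) ab(1) s(1) by simp
  qed
  then show ?thesis using BS by blast
qed

lemma gens_finite: "finite (gens \<sigma>)"
  using finite_rays by (simp add: gens_def)

lemma gens_independent: "\<sigma> \<in> F \<Longrightarrow> independent (gens \<sigma>)"
  using gens_basis lattice_basis_subset(3) independent_mono by metis

lemma dim_gens:
  assumes "\<sigma> \<in> F"
  shows "dim \<sigma> = card (gens \<sigma>)"
  using gens_basis[OF assms] dim_cone_hull[OF gens_independent[OF assms]] by metis

lemma gens_dual: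
  assumes "\<sigma> \<in> F"
  shows "\<exists>l\<in>dual_lattice L. \<forall>w\<in>gens \<sigma>. l w = (if w = v then 1 else 0)"
proof (cases "v \<in> gens \<sigma>")
  case True
  obtain B where B: "lattice_basis L B" "gens \<sigma> \<subseteq> B" using gens_basis[OF assms] by blast
  obtain l where "l \<in> dual_lattice L" "\<And>c. c \<in> B \<Longrightarrow> l c = (if c = v then 1 else 0)"
    using dual_basis[OF B(1), of v] B(2) True by blast
  then show ?thesis using B(2) by (intro bexI[of _ l]) auto
next
  case False
  then show ?thesis by (intro bexI[of _ "\<lambda>_. 0"] dual_lattice_zero) auto
qed

lemma linear_eq_on_cone:
  assumes "\<sigma> \<in> F" "linear l" "linear m" "\<And>w. w \<in> gens \<sigma> \<Longrightarrow> l w = (m w :: real)" "x \<in> span \<sigma>"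
  shows "l x = m x"
proof -
  have "x \<in> span (gens \<sigma>)" using gens_basis[OF assms(1)] assms(5) span_convex_cone_hull by metis
  then show ?thesis using linear_eq_on_span[OF assms(2,3)] assms(4) by blast
qed

text \<open>This justifies the definite description of \<open>Psi\<close>. Existence: the coordinate
  forms on the single cones agree on an intersection since they agree at its generators. Uniqueness:
  in degree 1 the restriction to a cone is linear and determined by the values at the generators,
  and outside the support the value is prescribed.\<close>

lemma hat_function:
  assumes r: "r \<in> rays F"
  shows "Psi L F r \<in> PP L 1 F \<and>
     (\<forall>r' \<in> rays F. Psi L F r (primitive_vector L r') = (if r' = r then 1 else 0)) \<and>
     (\<forall>x. x \<notin> \<Union>F \<longrightarrow> Psi L F r x = 0)"
proof -
  let ?v = "primitive_vector L r"
  let ?Q = "\<lambda>g. g \<in> PP L 1 F \<and> (\<forall>r' \<in> rays F. g (primitive_vector L r') = (if r' = r then 1 else 0)) \<and>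
     (\<forall>x. x \<notin> \<Union>F \<longrightarrow> g x = 0)"
  have "\<forall>\<sigma>\<in>F. \<exists>l\<in>dual_lattice L. \<forall>w\<in>gens \<sigma>. l w = (if w = ?v then 1 else 0)"
    using gens_dual by blast
  then obtain l where l: "\<And>\<sigma>. \<sigma> \<in> F \<Longrightarrow> l \<sigma> \<in> dual_lattice L"
    "\<And>\<sigma> w. \<sigma> \<in> F \<Longrightarrow> w \<in> gens \<sigma> \<Longrightarrow> l \<sigma> w = (if w = ?v then 1 else 0)" by metis
  have agree: "l \<sigma> x = l \<tau> x" if "\<sigma> \<in> F" "\<tau> \<in> F" "x \<in> \<sigma>" "x \<in> \<tau>" for \<sigma> \<tau> x
  proof (rule linear_eq_on_cone)
    show "\<sigma> \<inter> \<tau> \<in> F" using rational_fan_Int[OF fan] that by blast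
    show "x \<in> span (\<sigma> \<inter> \<tau>)" using that by (simp add: span_base)
    show "l \<sigma> w = l \<tau> w" if "w \<in> gens (\<sigma> \<inter> \<tau>)" for w
      using that l(2) \<open>\<sigma> \<in> F\<close> \<open>\<tau> \<in> F\<close> by (auto simp: gens_def)
  qed (use that l(1) in \<open>auto dest: dual_latticeD(1)\<close>)
  define g where "g = (\<lambda>x. if x \<in> \<Union>F then l (SOME \<sigma>. \<sigma> \<in> F \<and> x \<in> \<sigma>) x else 0)"
  have g: "g x = l \<sigma> x" if "\<sigma> \<in> F" "x \<in> \<sigma>" for x \<sigma>
  proof -
    have "(SOME \<sigma>. \<sigma> \<in> F \<and> x \<in> \<sigma>) \<in> F \<and> x \<in> (SOME \<sigma>. \<sigma> \<in> F \<and> x \<in> \<sigma>)"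
      using that by (intro someI[of "\<lambda>\<sigma>. \<sigma> \<in> F \<and> x \<in> \<sigma>"]) blast
    then have "l (SOME \<sigma>. \<sigma> \<in> F \<and> x \<in> \<sigma>) x = l \<sigma> x" using agree that by blast
    moreover have "x \<in> \<Union>F" using that by blast
    ultimately show ?thesis unfolding g_def by (simp only: if_True)
  qed
  have "continuous_on (\<Union>F) g"
  proof -
    have "continuous_on (\<Union>\<sigma>\<in>F. \<sigma>) g"
    proof (rule continuous_on_closed_Union)
      show "finite F" using rational_fanD(1)[OF fan] .
      show "closed \<sigma>" if "\<sigma> \<in> F" for \<sigma> using rational_coneD(3)[OF rational_fanD(2)[OF fan that]] .
      show "continuous_on \<sigma> g" if "\<sigma> \<in> F" for \<sigma>
      proof -
        have "bounded_linear (l \<sigma>)" using l(1)[OF that] dual_latticeD(1) linear_conv_bounded_linear by blast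
        then have "continuous_on \<sigma> (l \<sigma>)" by (rule linear_continuous_on)
        then show ?thesis using g[OF that] by (metis continuous_on_cong)
      qed
    qed
    then show ?thesis by simp
  qed
  moreover have "\<exists>p\<in>sym_power 1 (L \<inter> span \<sigma>). \<forall>x\<in>\<sigma>. g x = p x" if \<sigma>: "\<sigma> \<in> F" for \<sigma>
  proof -
    have "l \<sigma> \<in> sym_power 1 L" using sym_power_form[OF l(1)[OF \<sigma>]] by simp
    then have "l \<sigma> \<in> sym_power 1 (L \<inter> span \<sigma>)" by (rule sym_power_mono) simp
    then show ?thesis using g[OF \<sigma>] by blast
  qed
  ultimately have "g \<in> PP L 1 F" by (simp add: PP_def)
  moreover have "g (primitive_vector L r') = (if r' = r then 1 else 0)" if r': "r' \<in> rays F" for r'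
  proof -
    let ?w = "primitive_vector L r'"
    have "r' \<in> F" using r' by (simp add: rays_def)
    moreover have w: "?w \<in> r'" using ray_primitive(1)[OF r'] hull_inc[of ?w "{?w}" convex_cone] by simp
    moreover have "?w \<in> gens r'" using w r' by (auto simp: gens_def)
    ultimately have "g ?w = (if ?w = ?v then 1 else 0)" using g l(2) by simp
    moreover have "?w = ?v \<longleftrightarrow> r' = r" using ray_primitive(1)[OF r'] ray_primitive(1)[OF r] by metis
    ultimately show ?thesis by simp
  qed
  moreover have "g x = 0" if "x \<notin> \<Union>F" for x using that by (simp add: g_def)
  ultimately have Qg: "?Q g" by blast
  have "g' = g" if Qg': "?Q g'" for g'
  proof
    fix x
    show "g' x = g x"
    proof (cases "x \<in> \<Union>F")
      case False
      then show ?thesis using Qg' Qg by simp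
    next
      case True
      then obtain \<sigma> where \<sigma>: "\<sigma> \<in> F" "x \<in> \<sigma>" by blast
      obtain p where p: "p \<in> sym_power 1 (L \<inter> span \<sigma>)" "\<forall>x\<in>\<sigma>. g x = p x"
        using Qg \<sigma>(1) unfolding PP_def by blast
      obtain p' where p': "p' \<in> sym_power 1 (L \<inter> span \<sigma>)" "\<forall>x\<in>\<sigma>. g' x = p' x"
        using Qg' \<sigma>(1) unfolding PP_def by blast
      have "p' x = p x"
      proof (rule linear_eq_on_cone[OF \<sigma>(1)])
        show "linear p'" "linear p" using sym_power_1 p(1) p'(1) dual_latticeD(1) by blast+
        show "p' w = p w" if w: "w \<in> gens \<sigma>" for w
        proof -
          obtain r' where "r' \<in> rays F" "w = primitive_vector L r'" "w \<in> \<sigma>" using w by (auto simp: gens_def)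
          then have "g' w = g w" "w \<in> \<sigma>" using Qg \<open>?Q g'\<close> by auto
          then show ?thesis using p(2) p'(2) by simp
        qed
        show "x \<in> span \<sigma>" using \<sigma> by (simp add: span_base)
      qed
      then show ?thesis using p(2) p'(2) \<sigma>(2) by simp
    qed
  qed
  then have "\<exists>!g. ?Q g" using Qg by blast
  then show ?thesis unfolding Psi_def by (rule theI')
qed

lemma Psi_linear:
  assumes r: "r \<in> rays F" and \<sigma>: "\<sigma> \<in> F"
  shows "\<exists>l\<in>dual_lattice L. (\<forall>w\<in>gens \<sigma>. l w = (if w = primitive_vector L r then 1 else 0)) \<and>
    (\<forall>x\<in>\<sigma>. Psi L F r x = l x)"
proof -
  let ?v = "primitive_vector L r"
  obtain l where l: "l \<in> dual_lattice L" "\<forall>w\<in>gens \<sigma>. l w = (if w = ?v then 1 else 0)"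
    using gens_dual[OF \<sigma>] by blast
  have hat: "Psi L F r \<in> PP L 1 F"
    "\<And>r'. r' \<in> rays F \<Longrightarrow> Psi L F r (primitive_vector L r') = (if r' = r then 1 else 0)"
    using hat_function[OF r] by blast+
  obtain p where p: "p \<in> sym_power 1 (L \<inter> span \<sigma>)" "\<forall>x\<in>\<sigma>. Psi L F r x = p x"
    using hat(1) \<sigma> unfolding PP_def by blast
  have "p x = l x" if "x \<in> \<sigma>" for x
  proof (rule linear_eq_on_cone[OF \<sigma>])
    show "linear p" "linear l" using sym_power_1 p(1) l(1) dual_latticeD(1) by blast+
    show "p w = l w" if w: "w \<in> gens \<sigma>" for w
    proof -
      obtain r' where r': "r' \<in> rays F" "w = primitive_vector L r'" "w \<in> \<sigma>" using w by (auto simp: gens_def)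
      have "w = ?v \<longleftrightarrow> r' = r" using ray_primitive(1)[OF r'(1)] ray_primitive(1)[OF r] r'(2) by metis
      then have "p w = (if w = ?v then 1 else 0)" using hat(2)[OF r'(1)] r'(2,3) p(2) by auto
      then show ?thesis using l(2) w by simp
    qed
    show "x \<in> span \<sigma>" using that by (simp add: span_base)
  qed
  then show ?thesis using l p(2) by (intro bexI[of _ l]) auto
qed

lemma primitive_inj: "inj_on (primitive_vector L) (rays F)"
  using ray_primitive(1) by (metis inj_onI)

lemma Psi_cone_sym_power:
  assumes \<tau>: "\<tau> \<in> F" and \<sigma>: "\<sigma> \<in> F"
  shows "\<exists>q\<in>sym_power (dim \<tau>) L. \<forall>x\<in>\<sigma>. Psi_cone L F \<tau> x = q x"
proof -
  let ?R = "{r \<in> rays F. primitive_vector L r \<in> \<tau>}"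
  have "\<forall>r\<in>?R. \<exists>l. l \<in> dual_lattice L \<and> (\<forall>x\<in>\<sigma>. Psi L F r x = l x)"
    using Psi_linear[OF _ \<sigma>] by blast
  from bchoice[OF this] obtain l where
    "\<forall>r\<in>?R. l r \<in> dual_lattice L \<and> (\<forall>x\<in>\<sigma>. Psi L F r x = l r x)" by (rule exE)
  then have l: "\<And>r. r \<in> ?R \<Longrightarrow> l r \<in> dual_lattice L" "\<And>r x. r \<in> ?R \<Longrightarrow> x \<in> \<sigma> \<Longrightarrow> Psi L F r x = l r x"
    by blast+
  have im: "gens \<tau> = primitive_vector L ` ?R" by (auto simp: gens_def)
  have inj: "inj_on (primitive_vector L) ?R" using primitive_inj by (rule inj_on_subset) blast
  have "card ?R = dim \<tau>" unfolding dim_gens[OF \<tau>] im by (rule card_image[OF inj, symmetric])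
  moreover have "(\<lambda>x. \<Prod>r\<in>?R. l r x) \<in> sym_power (card ?R) L"
    using finite_rays l(1) by (intro sym_power_prod) auto
  moreover have "Psi_cone L F \<tau> x = (\<Prod>r\<in>?R. l r x)" if x: "x \<in> \<sigma>" for x
    unfolding Psi_cone_def by (rule prod.cong[OF refl l(2)[OF _ x]])
  ultimately show ?thesis by (intro bexI[of _ "\<lambda>x. \<Prod>r\<in>?R. l r x"]) simp_all
qed

text \<open>Some generator of \<tau> is not in \<sigma>. Its hat function is 0 at all generators of
  \<sigma>, hence on \<sigma>, and it is one of the factors.\<close>

lemma Psi_cone_eq_0:
  assumes \<tau>: "\<tau> \<in> F" and \<sigma>: "\<sigma> \<in> F" and "\<not> \<tau> \<subseteq> \<sigma>" and x: "x \<in> \<sigma>"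
  shows "Psi_cone L F \<tau> x = 0"
proof -
  have "\<not> gens \<tau> \<subseteq> \<sigma>"
  proof
    assume "gens \<tau> \<subseteq> \<sigma>"
    then have "convex_cone hull (gens \<tau>) \<subseteq> \<sigma>"
      using rational_coneD(1)[OF rational_fanD(2)[OF fan \<sigma>]] by (rule hull_minimal)
    then show False using gens_basis[OF \<tau>] \<open>\<not> \<tau> \<subseteq> \<sigma>\<close> by metis
  qed
  then obtain r where r: "r \<in> rays F" "primitive_vector L r \<in> \<tau>" "primitive_vector L r \<notin> \<sigma>"
    by (auto simp: gens_def)
  obtain l where l: "l \<in> dual_lattice L" "\<forall>w\<in>gens \<sigma>. l w = (if w = primitive_vector L r then 1 else 0)"
    "\<forall>x\<in>\<sigma>. Psi L F r x = l x" using Psi_linear[OF r(1) \<sigma>] by blast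
  have "l w = 0" if "w \<in> gens \<sigma>" for w using l(2) that r(3) by (auto simp: gens_def)
  then have "l x = 0"
    using linear_eq_on_cone[OF \<sigma> dual_latticeD(1)[OF l(1)] linear_zero, of x] x by (simp add: span_base)
  then have "Psi L F r x = 0" using l(3) x by simp
  then show ?thesis unfolding Psi_cone_def using r finite_rays by (intro prod_zero) auto
qed

lemma Psi_cone_self:
  assumes \<tau>: "\<tau> \<in> F" and l: "\<forall>v\<in>gens \<tau>. l v \<in> dual_lattice L"
    "\<forall>v\<in>gens \<tau>. \<forall>w\<in>gens \<tau>. l v w = (if w = v then 1 else 0)" and x: "x \<in> \<tau>"
  shows "Psi_cone L F \<tau> x = (\<Prod>v\<in>gens \<tau>. l v x)"
proof -
  let ?R = "{r \<in> rays F. primitive_vector L r \<in> \<tau>}"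
  have gens: "gens \<tau> = primitive_vector L ` ?R" by (auto simp: gens_def)
  have inj: "inj_on (primitive_vector L) ?R" using primitive_inj by (rule inj_on_subset) auto
  have "Psi L F r x = l (primitive_vector L r) x" if r: "r \<in> ?R" for r
  proof -
    have v: "primitive_vector L r \<in> gens \<tau>" using r gens by blast
    obtain m where m: "m \<in> dual_lattice L" "\<forall>w\<in>gens \<tau>. m w = (if w = primitive_vector L r then 1 else 0)"
      "\<forall>x\<in>\<tau>. Psi L F r x = m x" using Psi_linear[of r, OF _ \<tau>] r by blast
    have "m x = l (primitive_vector L r) x"
    proof (rule linear_eq_on_cone[OF \<tau> dual_latticeD(1)[OF m(1)] dual_latticeD(1)[OF l(1)[rule_format, OF v]]])
      show "m w = l (primitive_vector L r) w" if "w \<in> gens \<tau>" for w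
        using m(2) l(2) v that by simp
      show "x \<in> span \<tau>" using x by (rule span_base)
    qed
    then show ?thesis using m(3) x by simp
  qed
  then show ?thesis unfolding Psi_cone_def gens prod.reindex[OF inj] o_def by (rule prod.cong[OF refl])
qed

end

text \<open>Starting from x in the hyperplane of v, one moves in the direction y, the sum of the
  other generators. Far out the points lie in the facet opposite to v, where p vanishes while the
  factors already split off are positive. So q has infinitely many zeros on this line and vanishes
  on all of it, in particular at x.\<close>

lemma sym_power_vanishing_factor:
  fixes S :: "'a::euclidean_space set" and l :: "'a \<Rightarrow> 'a \<Rightarrow> real"
  assumes S: "finite S" "S \<subseteq> M"
    and l: "\<forall>s\<in>S. l s \<in> dual_lattice M"
    and dual_eq: "\<forall>s\<in>S. \<forall>t\<in>S. l s t = (if t = s then 1 else 0)"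
    and p0: "\<forall>v\<in>S. \<forall>x\<in>convex_cone hull (S - {v}). p x = 0"
    and q: "q \<in> sym_power m M" "\<forall>x\<in>span S. p x = (\<Prod>s\<in>T. l s x) * q x"
    and T: "T \<subseteq> S" "v \<in> S" "v \<notin> T" and x: "x \<in> span S" "l v x = 0"
  shows "q x = 0"
proof -
  have lin_eq: "\<forall>s\<in>S. linear (l s)" using l dual_latticeD(1) by blast
  note lin = lin_eq[rule_format] and dual = dual_eq[rule_format]
  note hull = cone_coordinates(2)[OF S(1) lin_eq dual_eq]
  define y where "y = (\<Sum>w\<in>S - {v}. w)"
  have ly: "l s y = (if s = v then 0 else 1)" if s: "s \<in> S" for s
  proof -
    have "l s y = (\<Sum>w\<in>S - {v}. l s w)" by (simp add: y_def linear_sum[OF lin[OF s]])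
    also have "\<dots> = (\<Sum>w\<in>S - {v}. if w = s then 1 else 0)" using s dual by (intro sum.cong) auto
    finally show ?thesis using S(1) s by simp
  qed
  have yS: "y \<in> span S" unfolding y_def by (intro span_sum) (auto intro: span_base)
  \<comment> \<open>From this parameter on every coordinate other than that of v is
    positive.\<close>
  define t0 where "t0 = 1 + (\<Sum>s\<in>S. \<bar>l s x\<bar>)"
  have q0: "q (x + t *\<^sub>R y) = 0" if t: "t0 \<le> t" for t
  proof -
    have z: "x + t *\<^sub>R y \<in> span S" using x(1) yS by (intro span_add span_scale)
    have pos: "0 < l s (x + t *\<^sub>R y)" if "s \<in> S" "s \<noteq> v" for s
    proof -
      have "\<bar>l s x\<bar> \<le> (\<Sum>s\<in>S. \<bar>l s x\<bar>)" using that S(1) by (intro member_le_sum) auto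
      then show ?thesis using t that by (simp add: linear_eqE[OF lin] ly t0_def)
    qed
    have zero: "l v (x + t *\<^sub>R y) = 0" using x(2) T(2) by (simp add: linear_eqE[OF lin] ly)
    have "0 \<le> l s (x + t *\<^sub>R y)" if "s \<in> S" for s
      using pos[OF that] zero by (cases "s = v") auto
    then have "x + t *\<^sub>R y \<in> convex_cone hull (S - {v})"
      unfolding hull[of "S - {v}", OF Diff_subset] using z zero by auto
    then have "p (x + t *\<^sub>R y) = 0" using p0 T(2) by blast
    moreover have "(\<Prod>s\<in>T. l s (x + t *\<^sub>R y)) > 0"
      using pos T by (intro prod_pos) auto
    ultimately show ?thesis using q(2)[rule_format, OF z] by simp
  qed
  have "infinite {t0..}" by (rule infinite_Ici)
  then have "infinite {t. q (x + t *\<^sub>R y) = 0}" using q0 by (rule_tac infinite_super[of "{t0..}"]) auto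
  from sym_power_zero_on_line[OF q(1) this, of 0] show ?thesis by simp
qed

lemma sym_power_divide_coordinates:
  fixes S :: "'a::euclidean_space set" and l :: "'a \<Rightarrow> 'a \<Rightarrow> real"
  assumes S: "finite S" "S \<subseteq> M"
    and l: "\<forall>s\<in>S. l s \<in> dual_lattice M"
    and dual: "\<forall>s\<in>S. \<forall>t\<in>S. l s t = (if t = s then 1 else 0)"
    and p: "p \<in> sym_power k M" "\<forall>v\<in>S. \<forall>x\<in>convex_cone hull (S - {v}). p x = 0"
  shows "card S \<le> k \<Longrightarrow> \<exists>q\<in>sym_power (k - card S) M. \<forall>x\<in>span S. p x = (\<Prod>s\<in>S. l s x) * q x"
    and "k < card S \<Longrightarrow> x \<in> span S \<Longrightarrow> p x = 0"
proof -
  have lin: "linear (l s)" if "s \<in> S" for s using l that dual_latticeD(1) by blast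
  note vanish = sym_power_vanishing_factor[OF S l dual p(2)]
  have factor: "\<exists>q\<in>sym_power (k - card T) M. \<forall>x\<in>span S. p x = (\<Prod>s\<in>T. l s x) * q x"
    if "finite T" "T \<subseteq> S" "card T \<le> k" for T
    using that
  proof (induction T rule: finite_induct)
    case empty
    then show ?case using p(1) by auto
  next
    case (insert v T)
    then obtain q where q: "q \<in> sym_power (k - card T) M" "\<forall>x\<in>span S. p x = (\<Prod>s\<in>T. l s x) * q x"
      by auto
    have v: "v \<in> S" "T \<subseteq> S" using insert.prems by auto
    have deg: "k - card T = Suc (k - card (insert v T))" using insert.prems insert.hyps by simp
    obtain q' where q': "q' \<in> sym_power (k - card (insert v T)) M" "\<forall>x. q x - q (x - l v x *\<^sub>R v) = l v x * q' x"
      using sym_power_divide[OF q(1)[unfolded deg] l[rule_format, OF v(1)], of v] v(1) S(2) by blast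
    have "q x = l v x * q' x" if x: "x \<in> span S" for x
    proof -
      let ?x = "x - l v x *\<^sub>R v"
      have "?x \<in> span S" using x v(1) by (intro span_diff span_scale) (auto intro: span_base)
      moreover have "l v ?x = 0" using v(1) dual[rule_format, OF v(1) v(1)] by (simp add: linear_eqE[OF lin])
      ultimately have "q ?x = 0" using vanish[OF q v(2,1) insert.hyps(2)] by blast
      then show ?thesis using q'(2)[THEN spec, of x] by simp
    qed
    then show ?case using q(2) q'(1) insert.hyps by (intro bexI[of _ q']) (auto simp: mult_ac)
  qed
  show "\<exists>q\<in>sym_power (k - card S) M. \<forall>x\<in>span S. p x = (\<Prod>s\<in>S. l s x) * q x" if "card S \<le> k"
    using factor[of S] S(1) that by blast
  show "p x = 0" if k: "k < card S" and x: "x \<in> span S"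
  proof -
    obtain T where T: "T \<subseteq> S" "card T = k" "finite T"
      using obtain_subset_with_card_n[of k S] k by auto
    then obtain v where v: "v \<in> S" "v \<notin> T" using k by (metis less_irrefl subsetI subset_antisym)
    obtain q where q: "q \<in> sym_power (k - card T) M" "\<forall>x\<in>span S. p x = (\<Prod>s\<in>T. l s x) * q x"
      using factor[of T] T by blast
    have "q 0 = 0" using vanish[OF q T(1) v span_0] linear_0[OF lin[OF v(1)]] by blast
    moreover have "q x = q 0" using q(1) T(2) sym_power_degree_0[of q M x 0] by simp
    ultimately show ?thesis using q(2)[rule_format, OF x] by simp
  qed
qed

section \<open>The representation of a piecewise polynomial on a unimodular fan\<close>

context unimodular
begin

theorem PP_representation:
  assumes f: "f \<in> PP L k F"
  shows "\<exists>a. (\<forall>\<sigma>\<in>F. dim \<sigma> \<le> k \<longrightarrow> a \<sigma> \<in> sym_power (k - dim \<sigma>) L) \<and>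
     (\<forall>x\<in>\<Union>F. f x = (\<Sum>\<sigma> \<in> {\<sigma>\<in>F. dim \<sigma> \<le> k}. a \<sigma> x * Psi_cone L F \<sigma> x))"
proof -
  let ?Fk = "{\<sigma>\<in>F. dim \<sigma> \<le> k}"
  let ?sum = "\<lambda>a x. \<Sum>\<sigma>\<in>?Fk. a \<sigma> x * Psi_cone L F \<sigma> x"
  have finF: "finite F" "finite ?Fk" using rational_fanD(1)[OF fan] by auto
  \<comment> \<open>Cones not yet treated have coefficient 0, so that setting one coefficient adds
    exactly one term. For a cone of dimension above k the degree \<open>k - dim \<sigma>\<close> is
    truncated to 0, but such a cone does not occur in the sum.\<close>
  define R where "R A a \<longleftrightarrow> (\<forall>\<sigma>. a \<sigma> \<in> sym_power (k - dim \<sigma>) L) \<and> (\<forall>\<sigma>. \<sigma> \<notin> A \<longrightarrow> a \<sigma> = (\<lambda>_. 0)) \<and>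
    (\<forall>x\<in>\<Union>A. f x = ?sum a x)" for A and a :: "'a set \<Rightarrow> 'a \<Rightarrow> real"
  have "\<exists>a. R F a"
    using finF(1)
  proof (induction F rule: finite_downset_induct)
    case empty
    have "R {} (\<lambda>_ _. 0)" by (simp add: R_def sym_power_zero)
    then show ?case by blast
  next
    case (insert A \<tau>)
    then obtain a where a: "R A a" by blast
    then have a1: "\<And>\<sigma>. a \<sigma> \<in> sym_power (k - dim \<sigma>) L" and a2: "a \<tau> = (\<lambda>_. 0)"
      and a3: "\<And>\<sigma> x. \<sigma> \<in> A \<Longrightarrow> x \<in> \<sigma> \<Longrightarrow> f x = ?sum a x"
      using insert.hyps(4) unfolding R_def by blast+
    have \<tau>: "\<tau> \<in> F" using insert.hyps by simp
    let ?S = "gens \<tau>"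
    have \<tau>S: "\<tau> = convex_cone hull ?S" using gens_basis[OF \<tau>] by blast
    have SL: "?S \<subseteq> L" using gens_basis[OF \<tau>] lattice_basis_subset(2) by blast
    have span\<tau>: "span \<tau> = span ?S" using \<tau>S span_convex_cone_hull by metis
    have "\<forall>v\<in>?S. \<exists>l\<in>dual_lattice L. \<forall>w\<in>?S. l w = (if w = v then 1 else 0)"
      using gens_dual[OF \<tau>] by blast
    then obtain l where l: "\<forall>v\<in>?S. l v \<in> dual_lattice L"
      "\<forall>v\<in>?S. \<forall>w\<in>?S. l v w = (if w = v then 1 else 0)" by metis
    obtain p0 where p0: "p0 \<in> sym_power k (L \<inter> span \<tau>)" "\<forall>x\<in>\<tau>. f x = p0 x"
      using f \<tau> unfolding PP_def by blast
    obtain p1 where p1: "p1 \<in> sym_power k L" "\<And>x. x \<in> span \<tau> \<Longrightarrow> p1 x = p0 x"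
      using sym_power_extend[OF rational_coneD(6)[OF rational_fanD(2)[OF fan \<tau>]] p0(1)] by metis
    \<comment> \<open>On \<tau> every \<open>Psi_cone\<close> is replaced by a global polynomial;
      this makes the error a polynomial, to which division applies.\<close>
    have "\<forall>\<sigma>\<in>F. \<exists>q\<in>sym_power (dim \<sigma>) L. \<forall>x\<in>\<tau>. Psi_cone L F \<sigma> x = q x"
      using Psi_cone_sym_power[OF _ \<tau>] by blast
    then obtain q where q: "\<And>\<sigma>. \<sigma> \<in> F \<Longrightarrow> q \<sigma> \<in> sym_power (dim \<sigma>) L"
      "\<And>\<sigma> x. \<sigma> \<in> F \<Longrightarrow> x \<in> \<tau> \<Longrightarrow> Psi_cone L F \<sigma> x = q \<sigma> x" by metis
    define e where "e = (\<lambda>x. p1 x - (\<Sum>\<sigma>\<in>?Fk. a \<sigma> x * q \<sigma> x))"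
    have "(\<lambda>x. a \<sigma> x * q \<sigma> x) \<in> sym_power k L" if "\<sigma> \<in> ?Fk" for \<sigma>
      using sym_power_mult[OF a1[of \<sigma>] q(1)[of \<sigma>]] that by simp
    then have eP: "e \<in> sym_power k L"
      unfolding e_def using p1(1) by (intro sym_power.diff sym_power_sum) auto
    have e\<tau>: "e x = f x - ?sum a x" if x: "x \<in> \<tau>" for x
    proof -
      have "p1 x = f x" using p1(2) p0(2) x by (simp add: span_base)
      moreover have "(\<Sum>\<sigma>\<in>?Fk. a \<sigma> x * q \<sigma> x) = ?sum a x" using q(2) x by (intro sum.cong) auto
      ultimately show ?thesis by (simp add: e_def)
    qed
    have e0: "\<forall>v\<in>?S. \<forall>x\<in>convex_cone hull (?S - {v}). e x = 0"
    proof (intro ballI)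
      fix v x assume v: "v \<in> ?S" and x: "x \<in> convex_cone hull (?S - {v})"
      let ?\<rho> = "convex_cone hull (?S - {v})"
      have face: "?\<rho> face_of \<tau>"
        using cone_hull_face[OF gens_finite gens_independent[OF \<tau>], of "?S - {v}"] \<tau>S by auto
      then have \<rho>F: "?\<rho> \<in> F" using rational_fanD(3)[OF fan \<tau>] convex_cone_hull_nonempty by blast
      have sub: "?\<rho> \<subseteq> \<tau>" using face by (rule face_of_imp_subset)
      have "v \<notin> ?\<rho>"
      proof
        assume "v \<in> ?\<rho>"
        then have "v \<in> span (?S - {v})" using span_convex_cone_hull span_base by blast
        then show False using gens_independent[OF \<tau>] v unfolding dependent_def by blast
      qed
      moreover have "v \<in> \<tau>" using v by (simp add: gens_def)
      ultimately have "?\<rho> \<in> A" using insert.hyps(5)[OF \<rho>F] sub by blast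
      then show "e x = 0" using a3 e\<tau> x sub by auto
    qed
    note divide = sym_power_divide_coordinates[OF gens_finite SL l eP e0]
    have A\<tau>: "Psi_cone L F \<tau> x = 0" if "\<sigma> \<in> A" "x \<in> \<sigma>" for \<sigma> x
    proof -
      have "\<sigma> \<in> F" using insert.hyps(1) that(1) by blast
      moreover have "\<not> \<tau> \<subseteq> \<sigma>" using insert.hyps(2)[OF that(1) \<tau>] insert.hyps(4) by blast
      ultimately show ?thesis using Psi_cone_eq_0[OF \<tau>] that(2) by blast
    qed
    have "\<exists>b\<in>sym_power (k - dim \<tau>) L. (\<forall>x\<in>\<tau>. e x = (if \<tau> \<in> ?Fk then b x * Psi_cone L F \<tau> x else 0))"
    proof (cases "dim \<tau> \<le> k")
      case True
      then obtain b where b: "b \<in> sym_power (k - dim \<tau>) L" "\<forall>x\<in>span ?S. e x = (\<Prod>v\<in>?S. l v x) * b x"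
        using divide(1) dim_gens[OF \<tau>] by metis
      have "e x = b x * Psi_cone L F \<tau> x" if x: "x \<in> \<tau>" for x
      proof -
        have "x \<in> span ?S" using x span\<tau> span_base by blast
        then show ?thesis using b(2) Psi_cone_self[OF \<tau> l x] by simp
      qed
      then show ?thesis using b(1) True \<tau> by auto
    next
      case False
      then have "e x = 0" if "x \<in> \<tau>" for x
        using divide(2)[of x] span\<tau> span_base[OF that] dim_gens[OF \<tau>] by simp
      then show ?thesis using False sym_power_zero by auto
    qed
    then obtain b where b: "b \<in> sym_power (k - dim \<tau>) L"
      "\<And>x. x \<in> \<tau> \<Longrightarrow> e x = (if \<tau> \<in> ?Fk then b x * Psi_cone L F \<tau> x else 0)" by blast
    define a' where "a' = a(\<tau> := b)"
    have sum': "?sum a' x = ?sum a x + (if \<tau> \<in> ?Fk then b x * Psi_cone L F \<tau> x else 0)" for x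
    proof -
      have "?sum a' x = (\<Sum>\<sigma>\<in>?Fk. a \<sigma> x * Psi_cone L F \<sigma> x + (if \<sigma> = \<tau> then b x * Psi_cone L F \<tau> x else 0))"
        by (intro sum.cong) (auto simp: a'_def a2)
      then show ?thesis using finF(2) by (simp add: sum.distrib)
    qed
    have "R (insert \<tau> A) a'"
      unfolding R_def
    proof (intro conjI allI ballI impI)
      show "a' \<sigma> \<in> sym_power (k - dim \<sigma>) L" for \<sigma> using a1 b(1) by (simp add: a'_def)
      show "a' \<sigma> = (\<lambda>_. 0)" if "\<sigma> \<notin> insert \<tau> A" for \<sigma> using that a unfolding R_def a'_def by auto
      fix x assume x: "x \<in> \<Union>(insert \<tau> A)"
      show "f x = ?sum a' x"
      proof (cases "x \<in> \<tau>")
        case True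
        show ?thesis using e\<tau>[OF True] b(2)[OF True] sum'[of x] by (simp only: diff_eq_eq add.commute)
      next
        case False
        then obtain \<sigma> where "\<sigma> \<in> A" "x \<in> \<sigma>" using x by blast
        then show ?thesis using a3[of \<sigma> x] A\<tau>[of \<sigma> x] sum'[of x] by simp
      qed
    qed
    then show ?case by blast
  qed
  then obtain a where "R F a" by blast
  then show ?thesis unfolding R_def by (intro exI[of _ a]) simp
qed

end

section \<open>Cutting a tropical fan along a hyperplane\<close>

lemma convex_shrink_segment:
  assumes "convex S" "x \<in> S" "x + e *\<^sub>R v \<in> S" "0 < e'" "e' \<le> e"
  shows "x + e' *\<^sub>R v \<in> S"
proof -
  have "(1 - e' / e) *\<^sub>R x + (e' / e) *\<^sub>R (x + e *\<^sub>R v) \<in> S"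
    using assms by (intro convexD) auto
  moreover have "(1 - e' / e) *\<^sub>R x + (e' / e) *\<^sub>R (x + e *\<^sub>R v) = x + e' *\<^sub>R v"
    using assms by (simp add: algebra_simps)
  ultimately show ?thesis by simp
qed

text \<open>This set is the smallest face of S that contains x: the segments from its points to x
  can be prolonged beyond x within S.\<close>

lemma face_extending_segments:
  fixes S :: "'a::euclidean_space set"
  assumes "convex S" "x \<in> S"
  shows "{y \<in> S. \<exists>e>0. x + e *\<^sub>R (x - y) \<in> S} face_of S"
  unfolding face_of_def
proof (intro conjI ballI impI)
  let ?T = "{y \<in> S. \<exists>e>0. x + e *\<^sub>R (x - y) \<in> S}"
  show "?T \<subseteq> S" by auto
  note shrink = convex_shrink_segment[OF assms]
  show "convex ?T"
  proof (rule convexI)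
    fix y z and u v :: real assume y: "y \<in> ?T" and z: "z \<in> ?T" and uv: "0 \<le> u" "0 \<le> v" "u + v = 1"
    obtain e f where e: "e > 0" "x + e *\<^sub>R (x - y) \<in> S" and f: "f > 0" "x + f *\<^sub>R (x - z) \<in> S"
      using y z by auto
    let ?g = "min e f"
    have "u *\<^sub>R (x + ?g *\<^sub>R (x - y)) + v *\<^sub>R (x + ?g *\<^sub>R (x - z)) \<in> S"
      using e f uv by (intro convexD[OF assms(1)] shrink[of e "x - y" ?g] shrink[of f "x - z" ?g]) auto
    moreover have "u *\<^sub>R (x + ?g *\<^sub>R (x - y)) + v *\<^sub>R (x + ?g *\<^sub>R (x - z)) =
        (u + v) *\<^sub>R x + ?g *\<^sub>R ((u + v) *\<^sub>R x - (u *\<^sub>R y + v *\<^sub>R z))"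
      by (simp add: algebra_simps)
    ultimately have "x + ?g *\<^sub>R (x - (u *\<^sub>R y + v *\<^sub>R z)) \<in> S" using uv by simp
    moreover have "u *\<^sub>R y + v *\<^sub>R z \<in> S" using y z uv by (intro convexD[OF assms(1)]) auto
    moreover have "?g > 0" using e f by simp
    ultimately show "u *\<^sub>R y + v *\<^sub>R z \<in> ?T" by blast
  qed
  have *: "a \<in> ?T" if ab: "a \<in> S" "b \<in> S" and z: "z \<in> ?T" "z \<in> open_segment a b" for a b z
  proof -
    obtain u where u: "0 < u" "u < 1" "z = (1 - u) *\<^sub>R a + u *\<^sub>R b"
      using z(2) by (auto simp: in_segment)
    obtain e where e: "e > 0" "x + e *\<^sub>R (x - z) \<in> S" using z(1) by auto
    have p: "0 < 1 + e * u" using e u by (simp add: add_pos_pos)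
    \<comment> \<open>A point beyond x as seen from z, averaged with b, is a point beyond x as seen
      from a; r is the ratio left after dividing the weights by \<open>1 + e * u\<close>.\<close>
    define r where "r = e * (1 - u) / (1 + e * u)"
    have r: "r > 0" unfolding r_def using e u p by simp
    have "(1 / (1 + e * u)) *\<^sub>R (x + e *\<^sub>R (x - z)) + (e * u / (1 + e * u)) *\<^sub>R b \<in> S"
      using e(1) u p by (intro convexD[OF assms(1) e(2) ab(2)]) (auto simp: field_simps)
    moreover have "(1 / (1 + e * u)) *\<^sub>R (x + e *\<^sub>R (x - z)) + (e * u / (1 + e * u)) *\<^sub>R b
        = x + r *\<^sub>R (x - a)"
    proof -
      have "(1 / (1 + e * u)) *\<^sub>R (x + e *\<^sub>R (x - z)) + (e * u / (1 + e * u)) *\<^sub>R b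
          = (1 / (1 + e * u)) *\<^sub>R ((1 + e) *\<^sub>R x - (e * (1 - u)) *\<^sub>R a)"
        unfolding u(3) by (simp add: algebra_simps)
      also have "\<dots> = ((1 + e) / (1 + e * u)) *\<^sub>R x - r *\<^sub>R a"
        by (simp add: r_def scaleR_diff_right)
      also have "(1 + e) / (1 + e * u) = 1 + r" using p by (simp add: r_def field_simps)
      finally show ?thesis by (simp add: algebra_simps)
    qed
    ultimately have "x + r *\<^sub>R (x - a) \<in> S" by (simp only:)
    then show ?thesis using r ab by blast
  qed
  fix a b z assume "a \<in> S" "b \<in> S" "z \<in> ?T" "z \<in> open_segment a b"
  then show "a \<in> ?T" "b \<in> ?T" using *[of a b z] *[of b a z] by (auto simp: open_segment_commute)
qed

text \<open>For x in the relative interior of \<rho>, the smallest faces of S and of T that contain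
  x intersect in \<rho>: a segment that can be prolonged beyond x in S and in T can be prolonged in
  S \<inter> T by the smaller amount.\<close>

lemma face_of_Int_decompose:
  fixes S T :: "'a::euclidean_space set"
  assumes "convex S" "convex T" and \<rho>: "\<rho> face_of S \<inter> T" "\<rho> \<noteq> {}"
  obtains A B where "A face_of S" "B face_of T" "\<rho> = A \<inter> B"
proof -
  have conv: "convex \<rho>" using \<rho>(1) by (rule face_of_imp_convex)
  then obtain x where x: "x \<in> rel_interior \<rho>" using \<rho>(2) rel_interior_eq_empty by auto
  have x\<rho>: "x \<in> \<rho>" using x rel_interior_subset by blast
  have \<rho>sub: "\<rho> \<subseteq> S \<inter> T" using \<rho>(1) by (rule face_of_imp_subset)
  let ?E = "\<lambda>S. {y \<in> S. \<exists>e>0. x + e *\<^sub>R (x - y) \<in> S}"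
  have "\<rho> = ?E S \<inter> ?E T"
  proof (intro set_eqI iffI)
    fix y assume y: "y \<in> \<rho>"
    obtain e where e: "e > 1" "(1 - e) *\<^sub>R y + e *\<^sub>R x \<in> \<rho>"
      using x y convex_rel_interior_iff[OF conv \<rho>(2)] by blast
    then have "x + (e - 1) *\<^sub>R (x - y) \<in> \<rho>" by (simp add: algebra_simps)
    then have "x + (e - 1) *\<^sub>R (x - y) \<in> S" "x + (e - 1) *\<^sub>R (x - y) \<in> T" using \<rho>sub by blast+
    moreover have "e - 1 > 0" using e by simp
    ultimately show "y \<in> ?E S \<inter> ?E T" using y \<rho>sub by blast
  next
    fix y assume "y \<in> ?E S \<inter> ?E T"
    then obtain e f where y: "y \<in> S" "y \<in> T" and e: "e > 0" "x + e *\<^sub>R (x - y) \<in> S"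
      and f: "f > 0" "x + f *\<^sub>R (x - y) \<in> T" by auto
    define g where "g = min e f"
    let ?w = "x + g *\<^sub>R (x - y)"
    have g: "g > 0" "g \<le> e" "g \<le> f" using e f by (simp_all add: g_def)
    have w: "?w \<in> S \<inter> T"
      using convex_shrink_segment[OF assms(1) _ e(2) g(1,2)]
        convex_shrink_segment[OF assms(2) _ f(2) g(1,3)] x\<rho> \<rho>sub by blast
    show "y \<in> \<rho>"
    proof (cases "y = x")
      case False
      have "x \<in> open_segment y ?w"
      proof -
        have "(1 - 1 / (1 + g)) *\<^sub>R y + (1 / (1 + g)) *\<^sub>R ?w
            = (1 / (1 + g) + g / (1 + g)) *\<^sub>R x + (1 - 1 / (1 + g) - g / (1 + g)) *\<^sub>R y"
          by (simp add: algebra_simps)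
        moreover have "1 / (1 + g) + g / (1 + g) = 1" using g by (simp add: add_divide_distrib[symmetric])
        ultimately have "x = (1 - 1 / (1 + g)) *\<^sub>R y + (1 / (1 + g)) *\<^sub>R ?w" by (simp add: algebra_simps)
        moreover have "0 < 1 / (1 + g)" "1 / (1 + g) < 1" using g by auto
        moreover have "y \<noteq> ?w"
        proof
          assume "y = ?w"
          then have "(1 + g) *\<^sub>R (x - y) = 0" by (simp add: algebra_simps)
          then show False using g False by auto
        qed
        ultimately show ?thesis unfolding in_segment by blast
      qed
      then show ?thesis using face_ofD[OF \<rho>(1)] y w x\<rho> by blast
    qed (use x\<rho> in simp)
  qed
  moreover have "?E S face_of S" "?E T face_of T"
    using face_extending_segments assms(1,2) x\<rho> \<rho>sub by blast+
  ultimately show ?thesis using that by blast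
qed

lemma cone_dim_face:
  fixes \<sigma> \<tau> :: "'a::euclidean_space set"
  assumes "convex \<sigma>" "\<tau> face_of \<sigma>" "0 \<in> \<tau>" "dim \<sigma> \<le> dim \<tau>"
  shows "\<tau> = \<sigma>"
proof (rule ccontr)
  assume "\<tau> \<noteq> \<sigma>"
  then have "aff_dim \<tau> < aff_dim \<sigma>" using face_of_aff_dim_lt assms(1,2) by blast
  moreover have "0 \<in> \<sigma>" using assms(2,3) face_of_imp_subset by blast
  ultimately show False using assms(3,4) by (simp add: aff_dim_zero hull_inc)
qed

lemma face_Int_span:
  fixes \<sigma> \<tau> :: "'a::euclidean_space set"
  assumes "convex \<sigma>" "\<tau> face_of \<sigma>" "0 \<in> \<tau>" "x \<in> \<sigma>" "x \<in> span \<tau>"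
  shows "x \<in> \<tau>"
  using face_of_imp_eq_affine_Int[OF assms(1,2)] affine_hull_span_0[of \<tau>] assms(3-5)
  by (auto simp: hull_inc)

text \<open>If l took both signs, a segment in C would meet the kernel of l in a point of \<tau>;
  being a face, \<tau> would contain the ends of the segment, where l is not 0.\<close>

lemma face_one_side:
  fixes C \<tau> :: "'a::euclidean_space set" and l :: "'a \<Rightarrow> real"
  assumes "convex_cone C" "\<tau> face_of C" "0 \<in> \<tau>" "linear l"
    and ker: "\<And>x. x \<in> span C \<Longrightarrow> l x = 0 \<Longrightarrow> x \<in> span \<tau>"
    and \<tau>0: "\<And>x. x \<in> \<tau> \<Longrightarrow> l x = 0"
    and x: "x \<in> C" "0 < l x" and y: "y \<in> C"
  shows "0 \<le> l y"
proof (rule ccontr)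
  assume "\<not> 0 \<le> l y"
  then have ly: "l y < 0" by simp
  note l = linear_eqE[OF assms(4)]
  define u where "u = l x / (l x - l y)"
  have u: "0 < u" "u < 1" unfolding u_def using x ly by (auto simp: field_simps)
  let ?z = "(1 - u) *\<^sub>R x + u *\<^sub>R y"
  have conv: "convex C" using assms(1) by (simp add: convex_cone_def)
  have z: "?z \<in> C" using x y u by (intro convexD[OF conv]) auto
  have "l ?z = 0" unfolding l u_def using x ly by (simp add: field_simps)
  then have "?z \<in> span \<tau>" using ker z by (simp add: span_base)
  then have "?z \<in> \<tau>" using face_Int_span[OF conv assms(2,3) z] by simp
  moreover have "?z \<in> open_segment x y" using u x ly by (auto simp: in_segment)
  ultimately have "x \<in> \<tau>" using face_ofD[OF assms(2)] x y by blast
  then show False using \<tau>0 x by force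
qed

lemma span_eq_of_subset_dim:
  fixes S T :: "'a::euclidean_space set"
  assumes "S \<subseteq> T" "dim T \<le> dim S"
  shows "span S = span T"
  using assms by (intro subspace_dim_equal span_mono) auto

text \<open>A suitable multiple of p moves any point of \<sigma> into the half-space, so the cut
  loses no dimension.\<close>

lemma span_cone_cut:
  fixes \<sigma> :: "'a::euclidean_space set" and l :: "'a \<Rightarrow> real"
  assumes "convex_cone \<sigma>" "linear l" "p \<in> \<sigma>" "0 < l p"
  shows "span {x \<in> \<sigma>. 0 \<le> l x} = span \<sigma>"
proof (rule subset_antisym)
  show "span {x \<in> \<sigma>. 0 \<le> l x} \<subseteq> span \<sigma>" by (intro span_mono) auto
  have "\<sigma> \<subseteq> span {x \<in> \<sigma>. 0 \<le> l x}"
  proof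
    fix x assume x: "x \<in> \<sigma>"
    define c where "c = \<bar>l x\<bar> / l p"
    have c: "0 \<le> c" unfolding c_def using assms by simp
    have "x + c *\<^sub>R p \<in> \<sigma>" using x c assms by (intro convex_cone_add convex_cone_scaleR)
    moreover have "0 \<le> l (x + c *\<^sub>R p)" using assms by (simp add: linear_eqE c_def)
    ultimately have "x + c *\<^sub>R p \<in> span {x \<in> \<sigma>. 0 \<le> l x}" by (intro span_base) simp
    moreover have "p \<in> span {x \<in> \<sigma>. 0 \<le> l x}" using assms by (intro span_base) simp
    ultimately have "(x + c *\<^sub>R p) - c *\<^sub>R p \<in> span {x \<in> \<sigma>. 0 \<le> l x}" by (intro span_diff span_scale)
    then show "x \<in> span {x \<in> \<sigma>. 0 \<le> l x}" by simp
  qed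
  then show "span \<sigma> \<subseteq> span {x \<in> \<sigma>. 0 \<le> l x}" by (rule span_minimal) simp
qed

lemma dim_kernel:
  fixes \<sigma> :: "'a::euclidean_space set" and l :: "'a \<Rightarrow> real"
  assumes "linear l" "p \<in> span \<sigma>" "l p \<noteq> 0"
  shows "dim \<sigma> = Suc (dim {x \<in> span \<sigma>. l x = 0})"
proof -
  let ?K = "{x \<in> span \<sigma>. l x = 0}"
  have K: "subspace ?K"
    using assms(1) by (auto simp: subspace_def linear_eqE span_add span_scale span_0)
  have "p \<notin> span ?K" using K assms(3) by (metis (mono_tags, lifting) mem_Collect_eq span_eq_iff)
  then have "dim (insert p ?K) = Suc (dim ?K)" by (simp add: dim_insert)
  moreover have "span (insert p ?K) = span \<sigma>"
  proof (rule subset_antisym)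
    show "span (insert p ?K) \<subseteq> span \<sigma>" using assms(2) by (intro span_minimal) auto
    show "span \<sigma> \<subseteq> span (insert p ?K)"
    proof
      fix x assume x: "x \<in> span \<sigma>"
      have "x - (l x / l p) *\<^sub>R p \<in> ?K"
        using x assms by (auto simp: linear_eqE intro: span_diff span_scale)
      then show "x \<in> span (insert p ?K)" unfolding span_insert by (auto intro: span_base)
    qed
  qed
  ultimately show ?thesis by (metis dim_span)
qed

text \<open>The intersection with \<sigma> is a face of \<rho> of full dimension, hence \<rho>
  itself.\<close>

lemma fan_subset_of_dim:
  fixes F :: "'a::euclidean_space set set"
  assumes F: "rational_fan L F" "\<rho> \<in> F" "\<sigma> \<in> F" "C \<subseteq> \<rho>" "C \<subseteq> \<sigma>" "dim \<rho> \<le> dim C"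
  shows "\<rho> \<subseteq> \<sigma>"
proof -
  have "0 \<in> \<rho> \<inter> \<sigma>" using rational_coneD(5) rational_fanD(2)[OF F(1)] F(2,3) by blast
  moreover have "dim \<rho> \<le> dim (\<rho> \<inter> \<sigma>)" using F(4-6) dim_subset[of C "\<rho> \<inter> \<sigma>"] by simp
  ultimately have "\<rho> \<inter> \<sigma> = \<rho>"
    using cone_dim_face[OF _ rational_fanD(4)[OF F(1-3)]] rational_coneD(2)[OF rational_fanD(2)[OF F(1,2)]] by blast
  then show ?thesis by blast
qed

lemma maximal_cone_exists:
  assumes "finite F" "\<sigma> \<in> F"
  obtains M where "M \<in> maximal_cones F" "\<sigma> \<subseteq> M"
  using finite_has_maximal2[OF assms] unfolding maximal_cones_def by blast

lemma maximal_cones_eq: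
  assumes "rational_fan L F" "pure_dimensional d F"
  shows "maximal_cones F = {\<sigma> \<in> F. dim \<sigma> = d}"
proof (intro set_eqI iffI)
  fix \<sigma> assume "\<sigma> \<in> maximal_cones F"
  then show "\<sigma> \<in> {\<sigma> \<in> F. dim \<sigma> = d}" using assms(2) by (auto simp: pure_dimensional_def maximal_cones_def)
next
  fix \<sigma> assume \<sigma>: "\<sigma> \<in> {\<sigma> \<in> F. dim \<sigma> = d}"
  then obtain M where M: "M \<in> maximal_cones F" "\<sigma> \<subseteq> M"
    using maximal_cone_exists[OF rational_fanD(1)[OF assms(1)]] by blast
  then have "M \<in> F" "dim M = d" using assms(2) by (auto simp: pure_dimensional_def maximal_cones_def)
  then have "M \<subseteq> \<sigma>" using fan_subset_of_dim[OF assms(1), of M \<sigma> \<sigma>] \<sigma> M(2) by auto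
  then show "\<sigma> \<in> maximal_cones F" using M by (simp add: subset_antisym)
qed

lemma fan_dim_le:
  assumes "rational_fan L F" "pure_dimensional d F" "\<sigma> \<in> F"
  shows "dim \<sigma> \<le> d"
proof -
  obtain M where "M \<in> maximal_cones F" "\<sigma> \<subseteq> M"
    using maximal_cone_exists[OF rational_fanD(1)[OF assms(1)] assms(3)] by blast
  then show ?thesis using dim_subset[of \<sigma> M] assms(2) by (auto simp: pure_dimensional_def)
qed

section \<open>The fan obtained by cutting along a hyperplane\<close>

definition sides :: "('a::real_vector \<Rightarrow> real) \<Rightarrow> 'a set set" where
  "sides l = {{x. 0 \<le> l x}, {x. l x \<le> 0}, {x. l x = 0}}"

text \<open>The wall counts as a side and thereby supplies the new faces; a cone on one side of the
  wall reappears unchanged.\<close>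

definition cut_fan :: "('a::real_vector \<Rightarrow> real) \<Rightarrow> 'a set set \<Rightarrow> 'a set set" where
  "cut_fan l F = {\<sigma> \<inter> h | \<sigma> h. \<sigma> \<in> F \<and> h \<in> sides l}"

lemma sides_facts:
  fixes l :: "'a::euclidean_space \<Rightarrow> real"
  assumes "linear l" "h \<in> sides l"
  shows "convex h" "0 \<in> h" "T face_of h \<Longrightarrow> T = {} \<or> T \<in> sides l"
    "h' \<in> sides l \<Longrightarrow> h \<inter> h' face_of h" "h' \<in> sides l \<Longrightarrow> h \<noteq> h' \<Longrightarrow> h \<inter> h' \<subseteq> {x. l x = 0}"
proof -
  obtain a where a: "\<And>x. l x = a \<bullet> x"
    using adjoint_works[OF assms(1), of _ 1] by (metis inner_commute inner_real_def mult.right_neutral)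
  have s: "sides l = {{x. a \<bullet> x \<ge> 0}, {x. a \<bullet> x \<le> 0}, {x. a \<bullet> x = 0}}" by (simp add: sides_def a)
  show c: "convex h"
    using assms(2) by (auto simp: s convex_halfspace_ge convex_halfspace_le convex_hyperplane)
  show "0 \<in> h" using assms(2) by (auto simp: s)
  consider "h = {x. 0 \<le> a \<bullet> x}" | "h = {x. a \<bullet> x \<le> 0}" | "h = {x. a \<bullet> x = 0}"
    using assms(2) unfolding s by blast
  note h_cases = this
  show "T = {} \<or> T \<in> sides l" if T: "T face_of h"
  proof -
    from h_cases have "T = {} \<or> T = {x. a \<bullet> x = 0} \<or> T = h"
    proof cases
      case 1
      show ?thesis using T unfolding 1 face_of_halfspace_ge .
    next
      case 2
      show ?thesis using T unfolding 2 face_of_halfspace_le .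
    next
      case 3
      show ?thesis using T unfolding 3 face_of_affine_eq[OF affine_hyperplane] by simp
    qed
    then show ?thesis using assms(2) unfolding s by auto
  qed
  have hyp: "{x. a \<bullet> x = 0} face_of h"
    using h_cases
  proof cases
    case 1
    show ?thesis unfolding 1 face_of_halfspace_ge by simp
  next
    case 2
    show ?thesis unfolding 2 face_of_halfspace_le by simp
  next
    case 3
    show ?thesis unfolding 3 by (simp add: face_of_refl convex_hyperplane)
  qed
  show "h \<inter> h' face_of h" if h': "h' \<in> sides l"
  proof -
    have "h \<inter> h' = h \<or> h \<inter> h' = {x. a \<bullet> x = 0}" using assms(2) h' unfolding s by force
    then show ?thesis using c face_of_refl[of h] hyp by auto
  qed
  show "h \<inter> h' \<subseteq> {x. l x = 0}" if "h' \<in> sides l" "h \<noteq> h'"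
    using assms(2) that unfolding sides_def by auto
qed

context euclidean_lattice
begin

lemma cut_rational_cone:
  assumes "rational_cone L \<sigma>" "l \<in> dual_lattice L" "h \<in> sides l"
  shows "rational_cone L (\<sigma> \<inter> h)"
proof -
  have pos: "rational_cone L (\<tau> \<inter> {x. 0 \<le> l x})" if "rational_cone L \<tau>" for \<tau>
    using rational_cone_cut[OF that assms(2)] unfolding Collect_conj_eq Collect_mem_eq .
  have neg: "rational_cone L (\<tau> \<inter> {x. l x \<le> 0})" if "rational_cone L \<tau>" for \<tau>
    using rational_cone_cut[OF that dual_lattice_neg[OF assms(2)]]
    unfolding Collect_conj_eq Collect_mem_eq neg_0_le_iff_le .
  have "\<sigma> \<inter> {x. l x = 0} = \<sigma> \<inter> {x. 0 \<le> l x} \<inter> {x. l x \<le> 0}" by auto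
  then have "rational_cone L (\<sigma> \<inter> {x. l x = 0})" using pos neg assms(1) by auto
  then show ?thesis using assms pos neg by (auto simp: sides_def)
qed

lemma cut_fan_rational:
  assumes F: "rational_fan L F" and l: "l \<in> dual_lattice L"
  shows "rational_fan L (cut_fan l F)"
  unfolding rational_fan_def
proof (intro conjI ballI allI impI)
  have linl: "linear l" using l by (rule dual_latticeD)
  have "cut_fan l F = (\<lambda>(\<sigma>, h). \<sigma> \<inter> h) ` (F \<times> sides l)" by (auto simp: cut_fan_def)
  then show "finite (cut_fan l F)" using rational_fanD(1)[OF F] by (simp add: sides_def)
  show "rational_cone L C" if "C \<in> cut_fan l F" for C
    using that cut_rational_cone[OF rational_fanD(2)[OF F] l] by (auto simp: cut_fan_def)
  show "\<tau> \<in> cut_fan l F" if C: "C \<in> cut_fan l F" and \<tau>: "\<tau> face_of C \<and> \<tau> \<noteq> {}" for C \<tau>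
  proof -
    obtain \<sigma> h where \<sigma>h: "C = \<sigma> \<inter> h" "\<sigma> \<in> F" "h \<in> sides l" using C unfolding cut_fan_def by blast
    obtain A B where AB: "A face_of \<sigma>" "B face_of h" "\<tau> = A \<inter> B"
      using face_of_Int_decompose[of \<sigma> h \<tau>] rational_coneD(2)[OF rational_fanD(2)[OF F \<sigma>h(2)]]
        sides_facts(1)[OF linl \<sigma>h(3)] \<tau> \<sigma>h(1) by metis
    have "A \<in> F" using rational_fanD(3)[OF F \<sigma>h(2) AB(1)] \<tau> AB(3) by blast
    moreover have "B \<in> sides l" using sides_facts(3)[OF linl \<sigma>h(3) AB(2)] \<tau> AB(3) by blast
    ultimately show ?thesis using AB(3) by (auto simp: cut_fan_def)
  qed
  have *: "C \<inter> C' face_of C" if CC: "C \<in> cut_fan l F" "C' \<in> cut_fan l F" for C C'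
  proof -
    obtain \<sigma> h where \<sigma>h: "C = \<sigma> \<inter> h" "\<sigma> \<in> F" "h \<in> sides l" using CC(1) unfolding cut_fan_def by blast
    obtain \<sigma>' h' where \<sigma>h': "C' = \<sigma>' \<inter> h'" "\<sigma>' \<in> F" "h' \<in> sides l" using CC(2) unfolding cut_fan_def by blast
    have "(\<sigma> \<inter> \<sigma>') \<inter> (h \<inter> h') face_of \<sigma> \<inter> h"
      using rational_fanD(4)[OF F \<sigma>h(2) \<sigma>h'(2)] sides_facts(4)[OF linl \<sigma>h(3) \<sigma>h'(3)] by (rule face_of_Int_Int)
    then show ?thesis using \<sigma>h(1) \<sigma>h'(1) by (simp add: Int_ac)
  qed
  show "C \<inter> C' face_of C" "C \<inter> C' face_of C'" if "C \<in> cut_fan l F" "C' \<in> cut_fan l F" for C C'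
    using *[OF that] *[OF that(2,1)] by (simp_all add: Int_commute)
qed

text \<open>If l takes both signs on M, both halves of M have full dimension and the slice by the
  wall lies in either; otherwise one half is M. Hence no piece of lower dimension is maximal, which
  keeps the fan pure.\<close>

lemma cut_fan_cover:
  assumes F: "rational_fan L F" and l: "l \<in> dual_lattice L" and M: "M \<in> F" and h: "h \<in> sides l"
  obtains C where "C \<in> cut_fan l F" "M \<inter> h \<subseteq> C" "C \<subseteq> M" "dim C = dim M"
proof -
  have linl: "linear l" using l by (rule dual_latticeD)
  have Mc: "convex_cone M" using rational_coneD(1)[OF rational_fanD(2)[OF F M]] .
  have side: "M \<inter> {x. 0 \<le> l x} \<in> cut_fan l F" "M \<inter> {x. l x \<le> 0} \<in> cut_fan l F"
    using M by (auto simp: cut_fan_def sides_def)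
  have pos: "dim (M \<inter> {x. 0 \<le> l x}) = dim M" if "p \<in> M" "0 < l p" for p
    using span_cone_cut[OF Mc linl that] unfolding Collect_conj_eq Collect_mem_eq by (metis dim_span)
  have neg: "dim (M \<inter> {x. l x \<le> 0}) = dim M" if "p \<in> M" "l p < 0" for p
    using span_cone_cut[OF Mc linear_compose_neg[OF linl] that(1)] that(2)
    unfolding Collect_conj_eq Collect_mem_eq neg_0_le_iff_le neg_0_less_iff_less by (metis dim_span)
  show ?thesis
  proof (cases "(\<forall>x\<in>M. l x \<le> 0) \<or> (\<forall>x\<in>M. 0 \<le> l x)")
    case True
    then have "M \<inter> {x. l x \<le> 0} = M \<or> M \<inter> {x. 0 \<le> l x} = M" by blast
    then have "M \<in> cut_fan l F" using side by auto
    then show ?thesis using that[of M] by blast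
  next
    case False
    then obtain p q where pq: "p \<in> M" "0 < l p" "q \<in> M" "l q < 0" by (auto simp: not_le)
    show ?thesis
    proof (cases "h = {x. l x \<le> 0}")
      case True
      then show ?thesis using that[OF side(2)] neg[OF pq(3,4)] by blast
    next
      case False
      then have "h \<subseteq> {x. 0 \<le> l x}" using h by (auto simp: sides_def)
      then show ?thesis using that[OF side(1)] pos[OF pq(1,2)] by blast
    qed
  qed
qed

lemma cut_fan_pure:
  assumes F: "rational_fan L F" and d: "pure_dimensional d F" and l: "l \<in> dual_lattice L"
  shows "pure_dimensional d (cut_fan l F)"
  unfolding pure_dimensional_def
proof
  fix C assume C: "C \<in> maximal_cones (cut_fan l F)"
  then obtain \<sigma> h where \<sigma>h: "C = \<sigma> \<inter> h" "\<sigma> \<in> F" "h \<in> sides l"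
    unfolding cut_fan_def maximal_cones_def by blast
  obtain M where M: "M \<in> maximal_cones F" "\<sigma> \<subseteq> M"
    using maximal_cone_exists[OF rational_fanD(1)[OF F] \<sigma>h(2)] by blast
  then have MF: "M \<in> F" by (simp add: maximal_cones_def)
  obtain C' where C': "C' \<in> cut_fan l F" "M \<inter> h \<subseteq> C'" "C' \<subseteq> M" "dim C' = dim M"
    using cut_fan_cover[OF F l MF \<sigma>h(3)] by blast
  have "C \<subseteq> C'" using \<sigma>h(1) M(2) C'(2) by blast
  then have "C' = C" using C C'(1) by (simp add: maximal_cones_def)
  then show "dim C = d" using C'(4) M(1) d by (simp add: pure_dimensional_def)
qed

end

section \<open>Normal vectors of a cone relative to a facet\<close>

definition normal_vectors :: "'a::euclidean_space set \<Rightarrow> 'a set \<Rightarrow> 'a set \<Rightarrow> 'a set" where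
  "normal_vectors L \<sigma> \<tau> = {u \<in> L \<inter> span \<sigma>.
     (\<forall>w \<in> L \<inter> span \<sigma>. \<exists>n::int. w - of_int n *\<^sub>R u \<in> span \<tau>) \<and> (\<exists>x\<in>\<sigma>. u - x \<in> span \<tau>)}"

text \<open>Balancing depends only on classes modulo \<open>span \<tau>\<close>; the set of all
  candidates makes the chosen representative irrelevant.\<close>

lemma normal_vector_some: "normal_vector L \<sigma> \<tau> = (SOME u. u \<in> normal_vectors L \<sigma> \<tau>)"
  unfolding normal_vector_def normal_vectors_def by simp

lemma normal_vectors_mono:
  assumes "u \<in> normal_vectors L C \<tau>'" "C \<subseteq> \<sigma>" "span C = span \<sigma>" "span \<tau>' = span \<tau>"
  shows "u \<in> normal_vectors L \<sigma> \<tau>"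
  using assms unfolding normal_vectors_def by auto

context euclidean_lattice
begin

text \<open>The form l identifies the quotient of the lattice in \<open>span \<sigma>\<close> by its
  part in \<open>span \<tau>\<close> with the integers, and v represents a generator. The point g of
  \<sigma> fixes the sign.\<close>

lemma facet_form:
  assumes \<sigma>: "rational_cone L \<sigma>" and \<tau>: "rational_cone L \<tau>" "\<tau> \<subseteq> \<sigma>" "dim \<sigma> = Suc (dim \<tau>)"
  obtains l v g where "l \<in> dual_lattice (L \<inter> span \<sigma>)" "\<And>x. x \<in> span \<tau> \<Longrightarrow> l x = 0"
    "v \<in> L \<inter> span \<sigma>" "l v = 1" "g \<in> \<sigma>" "l g > 0" "\<And>x. x \<in> span \<sigma> \<Longrightarrow> x - l x *\<^sub>R v \<in> span \<tau>"
proof -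
  obtain G where G: "finite G" "G \<subseteq> L" "\<sigma> = convex_cone hull G"
    using \<sigma> by (auto simp: rational_cone_def)
  have spG: "span \<sigma> = span G" unfolding G(3) by (rule span_convex_cone_hull)
  have "\<not> G \<subseteq> span \<tau>"
  proof
    assume "G \<subseteq> span \<tau>"
    then have "span \<sigma> \<subseteq> span \<tau>" unfolding spG by (intro span_minimal) auto
    then have "dim \<sigma> \<le> dim \<tau>" by (metis dim_span dim_subset)
    then show False using \<tau>(3) by simp
  qed
  then obtain g where g: "g \<in> G" "g \<notin> span \<tau>" by blast
  have g\<sigma>: "g \<in> \<sigma>" unfolding G(3) using g(1) by (rule hull_inc)
  have sp: "span (insert g (span \<tau>)) = span \<sigma>"
  proof (intro subspace_dim_equal subspace_span)
    show "span (insert g (span \<tau>)) \<subseteq> span \<sigma>"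
      using span_mono[OF \<tau>(2)] g\<sigma> by (intro span_minimal) (auto intro: span_base)
    show "dim (span \<sigma>) \<le> dim (span (insert g (span \<tau>)))"
      using g(2) \<tau>(3) by (simp add: dim_insert span_span)
  qed
  obtain l v where "l \<in> dual_lattice (L \<inter> span \<sigma>)" "\<And>x. x \<in> span \<tau> \<Longrightarrow> l x = 0"
    "v \<in> L \<inter> span \<sigma>" "l v = 1" "l g > 0" "\<And>x. x \<in> span \<sigma> \<Longrightarrow> x - l x *\<^sub>R v \<in> span \<tau>"
    using primitive_form[OF rational_coneD(6)[OF \<tau>(1)], of g thesis] g G(2) unfolding sp by blast
  then show ?thesis using that g\<sigma> by blast
qed

lemma normal_vector_normal:
  assumes "rational_cone L \<sigma>" "rational_cone L \<tau>" "\<tau> \<subseteq> \<sigma>" "dim \<sigma> = Suc (dim \<tau>)"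
  shows "normal_vector L \<sigma> \<tau> \<in> normal_vectors L \<sigma> \<tau>"
proof -
  obtain l v g where l: "l \<in> dual_lattice (L \<inter> span \<sigma>)" "\<And>x. x \<in> span \<tau> \<Longrightarrow> l x = 0"
    "v \<in> L \<inter> span \<sigma>" "l v = 1" "g \<in> \<sigma>" "l g > 0" "\<And>x. x \<in> span \<sigma> \<Longrightarrow> x - l x *\<^sub>R v \<in> span \<tau>"
    using facet_form[OF assms, of thesis] by blast
  have "v \<in> normal_vectors L \<sigma> \<tau>"
    unfolding normal_vectors_def
  proof (intro CollectI conjI ballI)
    show "v \<in> L \<inter> span \<sigma>" by (rule l(3))
    show "\<exists>n::int. w - of_int n *\<^sub>R v \<in> span \<tau>" if w: "w \<in> L \<inter> span \<sigma>" for w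
    proof -
      obtain n where "l w = of_int n" using dual_latticeD(2)[OF l(1) w] by (auto elim: Ints_cases)
      then show ?thesis using l(7)[of w] w by auto
    qed
    have "(1 / l g) *\<^sub>R g \<in> \<sigma>" using l(5,6) rational_coneD(1)[OF assms(1)] by (intro convex_cone_scaleR) auto
    moreover have "v - (1 / l g) *\<^sub>R g \<in> span \<tau>"
    proof -
      have "(- 1 / l g) *\<^sub>R (g - l g *\<^sub>R v) \<in> span \<tau>" using l(5,7) by (intro span_scale) (simp add: span_base)
      then show ?thesis using l(6) by (simp add: scaleR_diff_right)
    qed
    ultimately show "\<exists>x\<in>\<sigma>. v - x \<in> span \<tau>" by blast
  qed
  then show ?thesis unfolding normal_vector_some by (rule someI)
qed

text \<open>A generator of the quotient lattice has the value 1 or -1 under the primitive form of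
  the facet. It is congruent to a point of \<sigma>, and \<sigma> lies on one side of its facet, so
  the value is 1.\<close>

lemma normal_vectors_unique:
  assumes "rational_cone L \<sigma>" "rational_cone L \<tau>" "\<tau> face_of \<sigma>" "dim \<sigma> = Suc (dim \<tau>)"
    and u: "u \<in> normal_vectors L \<sigma> \<tau>" and u': "u' \<in> normal_vectors L \<sigma> \<tau>"
  shows "u - u' \<in> span \<tau>"
proof -
  have sub: "\<tau> \<subseteq> \<sigma>" using assms(3) by (rule face_of_imp_subset)
  obtain l v g where l: "l \<in> dual_lattice (L \<inter> span \<sigma>)" "\<And>x. x \<in> span \<tau> \<Longrightarrow> l x = 0"
    "v \<in> L \<inter> span \<sigma>" "l v = 1" "g \<in> \<sigma>" "l g > 0" "\<And>x. x \<in> span \<sigma> \<Longrightarrow> x - l x *\<^sub>R v \<in> span \<tau>"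
    using facet_form[OF assms(1,2) sub assms(4), of thesis] by blast
  have linl: "linear l" using l(1) by (rule dual_latticeD)
  have ker: "x \<in> span \<tau>" if "x \<in> span \<sigma>" "l x = 0" for x
    using l(7)[OF that(1)] that(2) by simp
  have one: "l w = 1" if w: "w \<in> normal_vectors L \<sigma> \<tau>" for w
  proof -
    obtain n :: int where n: "v - of_int n *\<^sub>R w \<in> span \<tau>" using w l(3) unfolding normal_vectors_def by blast
    then have "1 = of_int n * l w" using l(2)[OF n] l(4) by (simp add: linear_eqE[OF linl])
    moreover have "w \<in> L \<inter> span \<sigma>" using w by (simp add: normal_vectors_def)
    then obtain m where m: "l w = of_int m" using dual_latticeD(2)[OF l(1)] by (auto elim: Ints_cases)
    ultimately have "1 = n * m" by (metis of_int_1 of_int_eq_iff of_int_mult)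
    then have "m = 1 \<or> m = -1" by (metis zmult_eq_1_iff)
    moreover obtain x where x: "x \<in> \<sigma>" "w - x \<in> span \<tau>" using w unfolding normal_vectors_def by blast
    then have "l w = l x" using l(2)[OF x(2)] by (simp add: linear_eqE[OF linl])
    moreover have "0 \<le> l x"
      using face_one_side[OF rational_coneD(1)[OF assms(1)] assms(3) rational_coneD(5)[OF assms(2)] linl ker _ l(5,6) x(1)]
        l(2) span_base by blast
    ultimately show ?thesis using m by auto
  qed
  have "u - u' \<in> span \<sigma>" using u u' unfolding normal_vectors_def by (auto intro: span_diff)
  moreover have "l (u - u') = 0" using one[OF u] one[OF u'] by (simp add: linear_eqE[OF linl])
  ultimately show ?thesis by (rule ker)
qed

end

lemma maximal_essential:
  "maximal_cones (essential_fan (F, \<omega>)) = {\<sigma> \<in> maximal_cones F. \<omega> \<sigma> \<noteq> 0}"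
proof (intro set_eqI iffI)
  fix \<sigma> assume \<sigma>: "\<sigma> \<in> maximal_cones (essential_fan (F, \<omega>))"
  then obtain M where M: "M \<in> maximal_cones F" "\<omega> M \<noteq> 0" "\<sigma> \<subseteq> M"
    unfolding essential_fan_def maximal_cones_def by auto
  then have "M \<in> essential_fan (F, \<omega>)" unfolding essential_fan_def maximal_cones_def by auto
  then have "M = \<sigma>" using \<sigma> M(3) unfolding maximal_cones_def by blast
  then show "\<sigma> \<in> {\<sigma> \<in> maximal_cones F. \<omega> \<sigma> \<noteq> 0}" using M by simp
next
  fix \<sigma> assume "\<sigma> \<in> {\<sigma> \<in> maximal_cones F. \<omega> \<sigma> \<noteq> 0}"
  then show "\<sigma> \<in> maximal_cones (essential_fan (F, \<omega>))"
    unfolding essential_fan_def maximal_cones_def by auto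
qed

section \<open>Weights and balancing on the cut fan\<close>

definition parent_cone :: "'a set set \<Rightarrow> 'a set \<Rightarrow> 'a set" where
  "parent_cone F C = (THE \<sigma>. \<sigma> \<in> maximal_cones F \<and> C \<subseteq> \<sigma>)"

locale hyperplane_cut = euclidean_lattice L for L :: "'a::euclidean_space set" +
  fixes d :: nat and F :: "'a set set" and \<omega> :: "'a set \<Rightarrow> int" and l :: "'a \<Rightarrow> real"
  assumes tropical: "(F, \<omega>) \<in> tropical_fans L d" and form: "l \<in> dual_lattice L"
begin

lemma fan: "rational_fan L F" and pure: "pure_dimensional d F" and balance: "balanced L d (F, \<omega>)"
  using tropical by (auto simp: tropical_fans_def)

lemma linear_form: "linear l"
  using form by (rule dual_latticeD)

abbreviation "F' \<equiv> cut_fan l F"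

lemma cut: "rational_fan L F'" "pure_dimensional d F'"
  using cut_fan_rational[OF fan form] cut_fan_pure[OF fan pure form] .

lemma maximal: "maximal_cones F = {\<sigma> \<in> F. dim \<sigma> = d}" "maximal_cones F' = {\<sigma> \<in> F'. dim \<sigma> = d}"
  using maximal_cones_eq[OF fan pure] maximal_cones_eq[OF cut] .

lemma parent_eq:
  assumes "dim C = d" "\<sigma> \<in> maximal_cones F" "C \<subseteq> \<sigma>"
  shows "parent_cone F C = \<sigma>"
  unfolding parent_cone_def
proof (rule the_equality)
  show "\<sigma> \<in> maximal_cones F \<and> C \<subseteq> \<sigma>" using assms by simp
  fix \<sigma>' assume "\<sigma>' \<in> maximal_cones F \<and> C \<subseteq> \<sigma>'"
  then show "\<sigma>' = \<sigma>"
    using assms fan_subset_of_dim[OF fan, of \<sigma> \<sigma>' C] fan_subset_of_dim[OF fan, of \<sigma>' \<sigma> C]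
    by (auto simp: maximal)
qed

lemma parent:
  assumes "C \<in> maximal_cones F'"
  shows "parent_cone F C \<in> maximal_cones F" "C \<subseteq> parent_cone F C"
    "\<exists>h\<in>sides l. C = parent_cone F C \<inter> h" "span C = span (parent_cone F C)"
proof -
  have C: "C \<in> F'" "dim C = d" using assms by (auto simp: maximal)
  obtain \<sigma> h where \<sigma>h: "C = \<sigma> \<inter> h" "\<sigma> \<in> F" "h \<in> sides l"
    using C(1) unfolding cut_fan_def by blast
  have "dim C \<le> dim \<sigma>" using \<sigma>h(1) by (intro dim_subset) auto
  then have "dim \<sigma> = d" using fan_dim_le[OF fan pure \<sigma>h(2)] C(2) by simp
  then have \<sigma>: "\<sigma> \<in> maximal_cones F" using \<sigma>h(2) by (simp add: maximal)
  have eq: "parent_cone F C = \<sigma>" using parent_eq[OF C(2) \<sigma>] \<sigma>h(1) by blast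
  show "parent_cone F C \<in> maximal_cones F" "C \<subseteq> parent_cone F C"
    "\<exists>h\<in>sides l. C = parent_cone F C \<inter> h"
    using \<sigma> \<sigma>h eq by auto
  show "span C = span (parent_cone F C)"
    unfolding eq using \<sigma>h(1) C(2) \<open>dim \<sigma> = d\<close> by (intro span_eq_of_subset_dim) auto
qed

lemma cover:
  assumes "\<sigma> \<in> maximal_cones F" "h \<in> sides l"
  obtains C where "C \<in> maximal_cones F'" "\<sigma> \<inter> h \<subseteq> C" "parent_cone F C = \<sigma>"
proof -
  have "\<sigma> \<in> F" "dim \<sigma> = d" using assms(1) by (auto simp: maximal)
  then obtain C where C: "C \<in> F'" "\<sigma> \<inter> h \<subseteq> C" "C \<subseteq> \<sigma>" "dim C = d"
    using cut_fan_cover[OF fan form _ assms(2)] by metis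
  then have "C \<in> maximal_cones F'" by (simp add: maximal)
  then show ?thesis using that C parent_eq[OF C(4) assms(1) C(3)] by blast
qed

abbreviation "\<omega>' \<equiv> (\<lambda>C. \<omega> (parent_cone F C))"

text \<open>Two different pieces of a cone \<sigma> meet only in the wall. If both contain a
  full-dimensional part of \<tau>, then \<tau> is a facet of \<sigma> that lies in the wall and
  spans its slice of \<open>span \<sigma>\<close>; so \<sigma> is on one side of the wall and is not
  cut into two pieces.\<close>

lemma parent_inj:
  assumes \<tau>: "\<tau> \<in> F" "Suc (dim \<tau>) = d" "\<tau>' \<subseteq> \<tau>" "dim \<tau> \<le> dim \<tau>'"
    and C: "C1 \<in> maximal_cones F'" "C2 \<in> maximal_cones F'" "\<tau>' \<subseteq> C1" "\<tau>' \<subseteq> C2"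
    and eq: "parent_cone F C1 = parent_cone F C2"
  shows "C1 = C2"
proof (rule ccontr)
  assume ne: "C1 \<noteq> C2"
  define \<sigma> where "\<sigma> = parent_cone F C1"
  have \<sigma>: "\<sigma> \<in> F" "dim \<sigma> = d" using parent(1)[OF C(1)] by (auto simp: \<sigma>_def maximal)
  have "\<exists>h\<in>sides l. C1 = \<sigma> \<inter> h" "\<exists>h\<in>sides l. C2 = \<sigma> \<inter> h"
    using parent(3)[OF C(1)] parent(3)[OF C(2)] unfolding \<sigma>_def eq .
  then obtain h1 h2 where h: "h1 \<in> sides l" "C1 = \<sigma> \<inter> h1" "h2 \<in> sides l" "C2 = \<sigma> \<inter> h2"
    by blast
  have nsub: "\<not> C1 \<subseteq> C2" "\<not> C2 \<subseteq> C1" using C(1,2) ne unfolding maximal_cones_def by blast+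
  have h12: "h1 \<noteq> {x. l x = 0}" "h2 \<noteq> {x. l x = 0}" "h1 \<noteq> h2"
  proof -
    have "{x. l x = 0} \<subseteq> h" if "h \<in> sides l" for h using that by (auto simp: sides_def)
    then have "{x. l x = 0} \<subseteq> h1" "{x. l x = 0} \<subseteq> h2" using h(1,3) by blast+
    then show "h1 \<noteq> {x. l x = 0}" "h2 \<noteq> {x. l x = 0}" "h1 \<noteq> h2" using nsub h(2,4) by blast+
  qed
  have "\<tau>' \<subseteq> {x. l x = 0}"
    using sides_facts(5)[OF linear_form h(1,3) h12(3)] C(3,4) h by blast
  have sp: "span \<tau>' = span \<tau>" using span_eq_of_subset_dim \<tau>(3,4) by blast
  have \<tau>0: "l x = 0" if "x \<in> \<tau>" for x
    using linear_eq_0_on_span[OF linear_form, of \<tau>' x] \<open>\<tau>' \<subseteq> {x. l x = 0}\<close> that sp span_base by blast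
  have \<tau>\<sigma>: "\<tau> \<subseteq> \<sigma>"
    using fan_subset_of_dim[OF fan \<tau>(1) \<sigma>(1) \<tau>(3) _ \<tau>(4)] C(3) h(2) by blast
  have face: "\<tau> face_of \<sigma>" using rational_fanD(5)[OF fan \<sigma>(1) \<tau>(1)] rational_fanD(4)[OF fan \<sigma>(1) \<tau>(1)] \<tau>\<sigma>
    by (simp add: Int_absorb1)
  have sides: "h1 = {x. 0 \<le> l x} \<and> h2 = {x. l x \<le> 0} \<or> h1 = {x. l x \<le> 0} \<and> h2 = {x. 0 \<le> l x}"
    using h(1,3) h12 unfolding sides_def by blast
  have "\<exists>p\<in>\<sigma>. 0 < l p"
  proof (rule ccontr)
    assume "\<not> ?thesis"
    then have "\<sigma> \<inter> {x. 0 \<le> l x} \<subseteq> \<sigma> \<inter> {x. l x \<le> 0}" by (auto simp: not_less)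
    then show False using sides nsub h(2,4) by auto
  qed
  moreover have "\<exists>q\<in>\<sigma>. l q < 0"
  proof (rule ccontr)
    assume "\<not> ?thesis"
    then have "\<sigma> \<inter> {x. l x \<le> 0} \<subseteq> \<sigma> \<inter> {x. 0 \<le> l x}" by (auto simp: not_less)
    then show False using sides nsub h(2,4) by auto
  qed
  ultimately obtain p q where pq: "p \<in> \<sigma>" "0 < l p" "q \<in> \<sigma>" "l q < 0" by blast
  let ?K = "{x \<in> span \<sigma>. l x = 0}"
  have "dim \<sigma> = Suc (dim ?K)" using dim_kernel[OF linear_form, of p \<sigma>] pq(1,2) by (simp add: span_base)
  then have "dim ?K \<le> dim \<tau>" using \<tau>(2) \<sigma>(2) by simp
  moreover have "\<tau> \<subseteq> ?K" using \<tau>0 \<tau>\<sigma> by (auto intro: span_base)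
  ultimately have "span \<tau> = span ?K" by (intro span_eq_of_subset_dim)
  then have "x \<in> span \<tau>" if "x \<in> span \<sigma>" "l x = 0" for x using that by (simp add: span_base)
  then have "0 \<le> l q"
    using face_one_side[OF rational_coneD(1)[OF rational_fanD(2)[OF fan \<sigma>(1)]] face
      rational_coneD(5)[OF rational_fanD(2)[OF fan \<tau>(1)]] linear_form _ \<tau>0 pq(1-3)] by blast
  then show False using pq(4) by simp
qed

text \<open>Here \<tau>' is part of an old cone \<tau> with the same span. Passing to parent cones
  is a bijection from the maximal cones around \<tau>' to those around \<tau>; it preserves weights
  and, modulo \<open>span \<tau>\<close>, normal vectors, so the old balancing condition carries
  over.\<close>

lemma balanced_in_facet:
  assumes \<tau>': "\<tau>' \<in> F'" and \<tau>: "\<tau> \<in> F" "Suc (dim \<tau>) = d" "\<tau>' \<subseteq> \<tau>" "dim \<tau>' = dim \<tau>"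
  shows "(\<Sum>C \<in> {C \<in> maximal_cones F'. \<tau>' \<subseteq> C}. of_int (\<omega>' C) *\<^sub>R normal_vector L C \<tau>') \<in> span \<tau>'"
proof -
  have sp: "span \<tau>' = span \<tau>" using span_eq_of_subset_dim \<tau>(3,4) by (metis order_refl)
  let ?A = "{C \<in> maximal_cones F'. \<tau>' \<subseteq> C}" and ?B = "{\<sigma> \<in> maximal_cones F. \<tau> \<subseteq> \<sigma>}"
  have rc: "rational_cone L \<tau>" "rational_cone L \<tau>'" using rational_fanD(2) fan cut(1) \<tau>(1) \<tau>' by blast+
  have bij: "bij_betw (parent_cone F) ?A ?B"
    unfolding bij_betw_def
  proof (intro conjI subset_antisym subsetI)
    show "inj_on (parent_cone F) ?A"
      using parent_inj[OF \<tau>(1,2,3)] \<tau>(4) by (auto intro!: inj_onI)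
    fix \<sigma> assume "\<sigma> \<in> parent_cone F ` ?A"
    then obtain C where C: "C \<in> maximal_cones F'" "\<tau>' \<subseteq> C" "\<sigma> = parent_cone F C" by blast
    have "\<sigma> \<in> maximal_cones F" "\<tau>' \<subseteq> \<sigma>" using parent[OF C(1)] C by auto
    then show "\<sigma> \<in> ?B" using fan_subset_of_dim[OF fan \<tau>(1) _ \<tau>(3), of \<sigma>] \<tau>(4) by (auto simp: maximal)
  next
    fix \<sigma> assume \<sigma>: "\<sigma> \<in> ?B"
    \<comment> \<open>The side h is taken from \<tau>' itself, so that the piece of \<sigma> on this
      side contains \<tau>'.\<close>
    obtain \<rho> h where h: "\<tau>' = \<rho> \<inter> h" "h \<in> sides l" using \<tau>' unfolding cut_fan_def by blast
    obtain C where C: "C \<in> maximal_cones F'" "\<sigma> \<inter> h \<subseteq> C" "parent_cone F C = \<sigma>"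
      using cover[of \<sigma> h] \<sigma> h(2) by blast
    moreover have "\<tau>' \<subseteq> C" using C(2) \<sigma> \<tau>(3) h(1) by blast
    ultimately show "\<sigma> \<in> parent_cone F ` ?A" by blast
  qed
  have "(\<Sum>\<sigma>\<in>?B. of_int (\<omega> \<sigma>) *\<^sub>R normal_vector L \<sigma> \<tau>) \<in> span \<tau>"
    using balance \<tau>(1,2) unfolding balanced_def by blast
  then have 1: "(\<Sum>C\<in>?A. of_int (\<omega>' C) *\<^sub>R normal_vector L (parent_cone F C) \<tau>) \<in> span \<tau>"
    using sum.reindex_bij_betw[OF bij, of "\<lambda>\<sigma>. of_int (\<omega> \<sigma>) *\<^sub>R normal_vector L \<sigma> \<tau>"] by simp
  have "normal_vector L C \<tau>' - normal_vector L (parent_cone F C) \<tau> \<in> span \<tau>" if C: "C \<in> ?A" for C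
  proof -
    let ?\<sigma> = "parent_cone F C"
    have \<sigma>: "?\<sigma> \<in> ?B" using bij C unfolding bij_betw_def by blast
    then have \<sigma>F: "?\<sigma> \<in> F" "dim ?\<sigma> = Suc (dim \<tau>)" "\<tau> \<subseteq> ?\<sigma>" using \<tau>(2) by (auto simp: maximal)
    have CF: "C \<in> F'" "dim C = Suc (dim \<tau>')" "\<tau>' \<subseteq> C" using C \<tau>(2,4) by (auto simp: maximal)
    have rcs: "rational_cone L ?\<sigma>" "rational_cone L C" using rational_fanD(2) fan cut(1) \<sigma>F(1) CF(1) by blast+
    have face: "\<tau> face_of ?\<sigma>"
      using rational_fanD(4)[OF fan \<sigma>F(1) \<tau>(1)] \<sigma>F(3) by (simp add: Int_absorb1)
    have "normal_vector L C \<tau>' \<in> normal_vectors L C \<tau>'"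
      using normal_vector_normal[OF rcs(2) rc(2)] CF by simp
    moreover have CM: "C \<in> maximal_cones F'" using C by simp
    ultimately have "normal_vector L C \<tau>' \<in> normal_vectors L ?\<sigma> \<tau>"
      using normal_vectors_mono[OF _ parent(2)[OF CM] parent(4)[OF CM] sp] by blast
    moreover have "normal_vector L ?\<sigma> \<tau> \<in> normal_vectors L ?\<sigma> \<tau>"
      using normal_vector_normal[OF rcs(1) rc(1)] \<sigma>F by simp
    ultimately show ?thesis
      using normal_vectors_unique[OF rcs(1) rc(1) face \<sigma>F(2)] by blast
  qed
  then have "(\<Sum>C\<in>?A. of_int (\<omega>' C) *\<^sub>R (normal_vector L C \<tau>' - normal_vector L (parent_cone F C) \<tau>)) \<in> span \<tau>"
    by (intro span_sum span_scale)
  from span_add[OF this 1] show ?thesis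
    unfolding sp by (simp add: scaleR_diff_right sum_subtractf)
qed

text \<open>A cone of codimension 1 that is not part of an old one is a new wall inside a maximal
  cone \<rho>. Only the two halves of \<rho> contain it; they carry the same weight and have
  opposite normal vectors.\<close>

lemma cut_balanced: "balanced L d (F', \<omega>')"
  unfolding balanced_def prod.case
proof (intro ballI impI)
  fix \<tau>' assume \<tau>': "\<tau>' \<in> F'" and dim: "Suc (dim \<tau>') = d"
  let ?A = "{C \<in> maximal_cones F'. \<tau>' \<subseteq> C}"
  show "(\<Sum>C\<in>?A. of_int (\<omega>' C) *\<^sub>R normal_vector L C \<tau>') \<in> span \<tau>'"
  proof (cases "\<exists>\<tau>\<in>F. \<tau>' \<subseteq> \<tau> \<and> dim \<tau> = dim \<tau>'")
    case True
    then show ?thesis using balanced_in_facet[OF \<tau>'] dim by metis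
  next
    case False
    obtain \<rho> h where \<rho>h: "\<tau>' = \<rho> \<inter> h" "\<rho> \<in> F" "h \<in> sides l" using \<tau>' unfolding cut_fan_def by blast
    let ?pos = "\<rho> \<inter> {x. 0 \<le> l x}" and ?neg = "\<rho> \<inter> {x. l x \<le> 0}" and ?zer = "\<rho> \<inter> {x. l x = 0}"
    have "dim \<tau>' \<le> dim \<rho>" using \<rho>h(1) by (intro dim_subset) auto
    then have dim\<rho>: "dim \<rho> = d"
      using False \<rho>h(1,2) fan_dim_le[OF fan pure \<rho>h(2)] dim by (metis Int_lower1 Suc_leI le_antisym le_neq_implies_less)
    have rc\<rho>: "rational_cone L \<rho>" using rational_fanD(2)[OF fan \<rho>h(2)] .
    have cc: "convex_cone \<rho>" using rational_coneD(1)[OF rc\<rho>] .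
    have not\<rho>: "\<tau>' \<noteq> \<rho>" using dim dim\<rho> by auto
    have zer_not_in: "\<tau>' \<notin> F" using False by blast
    have side: "?pos \<in> F'" "?neg \<in> F'" "?zer \<in> F'"
      using \<rho>h(2) unfolding cut_fan_def sides_def by blast+
    have z: "0 \<in> \<rho>" using rational_coneD(5)[OF rc\<rho>] .
    \<comment> \<open>If l had one sign on \<rho>, the slice by the wall would be a face of \<rho>
      and therefore an old cone, and \<tau>' could only be this face or \<rho>.\<close>
    have "(\<exists>p\<in>\<rho>. 0 < l p) \<and> (\<exists>q\<in>\<rho>. l q < 0)"
    proof (rule ccontr)
      assume "\<not> ?thesis"
      then have cases: "(\<forall>p\<in>\<rho>. l p \<le> 0) \<or> (\<forall>p\<in>\<rho>. 0 \<le> l p)" by (meson linorder_not_less)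
      have "?zer face_of \<rho>"
        using cases
      proof
        assume "\<forall>p\<in>\<rho>. l p \<le> 0"
        then have "{x. l x \<le> 0} \<inter> \<rho> = \<rho>" by blast
        moreover have "{x. l x \<le> 0} \<inter> {x. l x = 0} face_of {x. l x \<le> 0}"
          by (intro sides_facts(4)[OF linear_form]) (auto simp: sides_def)
        moreover have "{x. l x \<le> 0} \<inter> {x. l x = 0} \<inter> \<rho> = ?zer" by auto
        ultimately show ?thesis
          using face_of_slice[of "{x. l x \<le> 0} \<inter> {x. l x = 0}" "{x. l x \<le> 0}" \<rho>]
            rational_coneD(2)[OF rc\<rho>] by simp
      next
        assume "\<forall>p\<in>\<rho>. 0 \<le> l p"
        then have "{x. 0 \<le> l x} \<inter> \<rho> = \<rho>" by blast
        moreover have "{x. 0 \<le> l x} \<inter> {x. l x = 0} face_of {x. 0 \<le> l x}"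
          by (intro sides_facts(4)[OF linear_form]) (auto simp: sides_def)
        moreover have "{x. 0 \<le> l x} \<inter> {x. l x = 0} \<inter> \<rho> = ?zer" by auto
        ultimately show ?thesis
          using face_of_slice[of "{x. 0 \<le> l x} \<inter> {x. l x = 0}" "{x. 0 \<le> l x}" \<rho>]
            rational_coneD(2)[OF rc\<rho>] by simp
      qed
      then have "?zer \<in> F" using rational_fanD(3)[OF fan \<rho>h(2)] z linear_0[OF linear_form] by blast
      moreover have "\<tau>' = ?zer \<or> \<tau>' = \<rho>" using \<rho>h(1,3) cases unfolding sides_def by auto
      ultimately show False using zer_not_in not\<rho> by auto
    qed
    then obtain p q where pq: "p \<in> \<rho>" "0 < l p" "q \<in> \<rho>" "l q < 0" by blast
    have sp_pos: "span ?pos = span \<rho>"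
      using span_cone_cut[OF cc linear_form pq(1,2)] unfolding Collect_conj_eq Collect_mem_eq .
    have sp_neg: "span ?neg = span \<rho>"
      using span_cone_cut[OF cc linear_compose_neg[OF linear_form] pq(3)] pq(4)
      unfolding Collect_conj_eq Collect_mem_eq neg_0_le_iff_le neg_0_less_iff_less by blast
    have dims: "dim ?pos = d" "dim ?neg = d" using sp_pos sp_neg dim\<rho> by (metis dim_span)+
    then have \<tau>'eq: "\<tau>' = ?zer" using \<rho>h(1,3) dim unfolding sides_def by auto
    let ?K = "{x \<in> span \<rho>. l x = 0}"
    have "dim \<rho> = Suc (dim ?K)" using dim_kernel[OF linear_form, of p \<rho>] pq(1,2) by (simp add: span_base)
    then have "dim ?K \<le> dim \<tau>'" using dim dim\<rho> by simp
    moreover have "\<tau>' \<subseteq> ?K" using \<tau>'eq by (auto intro: span_base)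
    ultimately have "span \<tau>' = span ?K" by (intro span_eq_of_subset_dim)
    then have ker: "x \<in> span \<tau>'" if "x \<in> span \<rho>" "l x = 0" for x using that by (simp add: span_base)
    have "?A = {?pos, ?neg}"
    proof (intro subset_antisym subsetI)
      fix C assume "C \<in> ?A"
      then have C: "C \<in> maximal_cones F'" "\<tau>' \<subseteq> C" by auto
      let ?\<sigma> = "parent_cone F C"
      have \<sigma>: "?\<sigma> \<in> F" "dim ?\<sigma> = d" "\<tau>' \<subseteq> ?\<sigma>" using parent[OF C(1)] C(2) by (auto simp: maximal)
      have int: "?\<sigma> \<inter> \<rho> \<in> F" using rational_fan_Int[OF fan \<sigma>(1) \<rho>h(2)] .
      have "\<tau>' \<subseteq> ?\<sigma> \<inter> \<rho>" using \<sigma>(3) \<rho>h(1) by blast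
      moreover from this have "dim \<tau>' \<le> dim (?\<sigma> \<inter> \<rho>)" by (rule dim_subset)
      \<comment> \<open>An intersection of dimension d - 1 would be an old cone containing \<tau>',
        which this case excludes.\<close>
      ultimately have "d \<le> dim (?\<sigma> \<inter> \<rho>)" using False int dim by (metis Suc_leI le_neq_implies_less)
      then have "?\<sigma> \<subseteq> \<rho>" "\<rho> \<subseteq> ?\<sigma>"
        using fan_subset_of_dim[OF fan \<sigma>(1) \<rho>h(2), of "?\<sigma> \<inter> \<rho>"]
          fan_subset_of_dim[OF fan \<rho>h(2) \<sigma>(1), of "?\<sigma> \<inter> \<rho>"] \<sigma>(2) dim\<rho> by auto
      then have eq: "?\<sigma> = \<rho>" by blast
      obtain h' where h': "h' \<in> sides l" "C = \<rho> \<inter> h'" using parent(3)[OF C(1)] eq by auto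
      have "C \<noteq> ?zer" using \<tau>'eq C(1) dim by (auto simp: maximal)
      then show "C \<in> {?pos, ?neg}" using h' by (auto simp: sides_def)
    next
      fix C assume "C \<in> {?pos, ?neg}"
      then show "C \<in> ?A" using side dims \<tau>'eq by (auto simp: maximal)
    qed
    moreover have "?pos \<noteq> ?neg"
    proof -
      have "p \<in> ?pos" "p \<notin> ?neg" using pq by auto
      then show ?thesis by blast
    qed
    moreover have "parent_cone F ?pos = \<rho>" "parent_cone F ?neg = \<rho>"
      using parent_eq[OF dims(1), of \<rho>] parent_eq[OF dims(2), of \<rho>] \<rho>h(2) dim\<rho> by (auto simp: maximal)
    ultimately have sum: "(\<Sum>C\<in>?A. of_int (\<omega>' C) *\<^sub>R normal_vector L C \<tau>')
        = of_int (\<omega> \<rho>) *\<^sub>R (normal_vector L ?pos \<tau>' + normal_vector L ?neg \<tau>')"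
      by (simp add: scaleR_add_right)
    have rc: "rational_cone L ?pos" "rational_cone L ?neg" "rational_cone L \<tau>'"
      using rational_fanD(2)[OF cut(1)] side \<tau>' by blast+
    have pos: "normal_vector L ?pos \<tau>' \<in> normal_vectors L ?pos \<tau>'"
      using rc dims dim \<tau>'eq by (intro normal_vector_normal) auto
    have neg: "normal_vector L ?neg \<tau>' \<in> normal_vectors L ?neg \<tau>'" (is "?u \<in> _")
      using rc dims dim \<tau>'eq by (intro normal_vector_normal) auto
    have neg': "- ?u \<in> normal_vectors L ?pos \<tau>'"
      unfolding normal_vectors_def
    proof (intro CollectI conjI ballI)
      have "?u \<in> L \<inter> span \<rho>" using neg unfolding normal_vectors_def sp_neg by blast
      then show "- ?u \<in> L \<inter> span ?pos"
        unfolding sp_pos using lattice_diff[OF lattice_zero, of ?u] by (auto intro: span_neg)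
      fix w assume "w \<in> L \<inter> span ?pos"
      then obtain n :: int where "w - of_int n *\<^sub>R ?u \<in> span \<tau>'"
        using neg unfolding normal_vectors_def sp_pos sp_neg by blast
      then show "\<exists>n::int. w - of_int n *\<^sub>R (- ?u) \<in> span \<tau>'" by (intro exI[of _ "- n"]) simp
    next
      obtain y where y: "y \<in> ?neg" "?u - y \<in> span \<tau>'" using neg unfolding normal_vectors_def by blast
      \<comment> \<open>Chosen such that \<open>y + c *\<^sub>R p\<close> lies in the wall; c is
        nonnegative because y is on the negative side.\<close>
      define c where "c = - l y / l p"
      have c: "0 \<le> c" unfolding c_def using y(1) pq(2) by (simp add: divide_nonpos_pos)
      have "c *\<^sub>R p \<in> ?pos"
        using c pq(1,2) cc by (auto simp: linear_eqE[OF linear_form] intro: convex_cone_scaleR)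
      moreover have "- ?u - c *\<^sub>R p \<in> span \<tau>'"
      proof -
        have "y + c *\<^sub>R p \<in> span \<rho>" using y(1) pq(1) by (auto intro: span_add span_scale span_base)
        moreover have "l (y + c *\<^sub>R p) = 0" using pq(2) by (simp add: linear_eqE[OF linear_form] c_def)
        ultimately have "y + c *\<^sub>R p \<in> span \<tau>'" by (rule ker)
        from span_diff[OF span_neg[OF y(2)] this]
        have "- (?u - y) - (y + c *\<^sub>R p) \<in> span \<tau>'" .
        then show ?thesis by simp
      qed
      ultimately show "\<exists>x\<in>?pos. - ?u - x \<in> span \<tau>'" by blast
    qed
    have face: "\<tau>' face_of ?pos"
      using rational_fanD(4)[OF cut(1) side(1) \<tau>'] \<tau>'eq
      by (simp add: Int_absorb1 le_infI2 Int_mono subset_iff)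
    have "normal_vector L ?pos \<tau>' - (- ?u) \<in> span \<tau>'"
      using dims dim by (intro normal_vectors_unique[OF rc(1,3) face _ pos neg']) simp
    then show ?thesis unfolding sum by (intro span_scale) simp
  qed
qed

lemma cut_tropical: "(F', \<omega>') \<in> tropical_fans L d"
  using cut cut_balanced by (simp add: tropical_fans_def)

lemma cut_refinement: "refinement (F', \<omega>') (F, \<omega>)"
  unfolding refinement_def
proof (intro conjI ballI impI)
  let ?E' = "essential_fan (F', \<omega>')" and ?E = "essential_fan (F, \<omega>)"
  have sub: "\<exists>\<sigma>\<in>?E. C \<subseteq> \<sigma>" if C: "C \<in> ?E'" for C
  proof -
    obtain M where M: "M \<in> maximal_cones F'" "\<omega>' M \<noteq> 0" "C \<subseteq> M"
      using C by (auto simp: essential_fan_def)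
    have "parent_cone F M \<in> ?E" using parent(1)[OF M(1)] M(2) by (auto simp: essential_fan_def maximal_cones_def)
    then show ?thesis using parent(2)[OF M(1)] M(3) by blast
  qed
  then show "\<exists>\<sigma>\<in>?E. C \<subseteq> \<sigma>" if "C \<in> ?E'" for C using that by blast
  show "\<Union>?E' = \<Union>?E"
  proof (intro subset_antisym subsetI)
    fix x assume "x \<in> \<Union>?E'"
    then show "x \<in> \<Union>?E" using sub by blast
  next
    fix x assume "x \<in> \<Union>?E"
    then obtain \<sigma> where \<sigma>: "x \<in> \<sigma>" "\<sigma> \<in> maximal_cones F" "\<omega> \<sigma> \<noteq> 0"
      unfolding essential_fan_def by blast
    obtain h where h: "h \<in> sides l" "x \<in> h"
      using linorder_linear[of 0 "l x"] unfolding sides_def by blast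
    obtain C where C: "C \<in> maximal_cones F'" "\<sigma> \<inter> h \<subseteq> C" "parent_cone F C = \<sigma>"
      using cover[OF \<sigma>(2) h(1)] by blast
    have "C \<in> ?E'" using C \<sigma>(3) by (auto simp: essential_fan_def maximal_cones_def)
    then show "x \<in> \<Union>?E'" using C(2) \<sigma>(1) h(2) by blast
  qed
  fix C \<sigma> assume C: "C \<in> maximal_cones ?E'" and \<sigma>: "\<sigma> \<in> maximal_cones ?E" and "C \<subseteq> \<sigma>"
  have "C \<in> maximal_cones F'" using C by (simp add: maximal_essential)
  moreover have "\<sigma> \<in> maximal_cones F" using \<sigma> by (simp add: maximal_essential)
  ultimately have "parent_cone F C = \<sigma>" using \<open>C \<subseteq> \<sigma>\<close> by (intro parent_eq) (auto simp: maximal)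
  then show "snd (F', \<omega>') C = snd (F, \<omega>) \<sigma>" by simp
qed

end

section \<open>Fan cycles\<close>

lemma refinementD:
  assumes "refinement Y X"
  shows "\<Union>(essential_fan Y) = \<Union>(essential_fan X)"
    "\<sigma> \<in> essential_fan Y \<Longrightarrow> \<exists>\<sigma>'\<in>essential_fan X. \<sigma> \<subseteq> \<sigma>'"
    "\<sigma> \<in> maximal_cones (essential_fan Y) \<Longrightarrow> \<sigma>' \<in> maximal_cones (essential_fan X) \<Longrightarrow> \<sigma> \<subseteq> \<sigma>' \<Longrightarrow>
      snd Y \<sigma> = snd X \<sigma>'"
  using assms unfolding refinement_def by simp_all

lemma refinement_refl: "refinement X X"
  unfolding refinement_def
proof (intro conjI ballI impI)
  fix \<sigma> \<sigma>' assume "\<sigma> \<in> maximal_cones (essential_fan X)" "\<sigma>' \<in> maximal_cones (essential_fan X)" "\<sigma> \<subseteq> \<sigma>'"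
  then show "snd X \<sigma> = snd X \<sigma>'" unfolding maximal_cones_def by auto
qed auto

text \<open>The comparison of weights passes through a maximal cone of Y that contains \<sigma>. It
  lies in some maximal cone of X, which must be \<sigma>'' because both contain \<sigma> and have
  its dimension d.\<close>

lemma refinement_trans:
  assumes X: "X \<in> tropical_fans L d" and Y: "Y \<in> tropical_fans L d" and Z: "Z \<in> tropical_fans L d"
    and ZY: "refinement Z Y" and YX: "refinement Y X"
  shows "refinement Z X"
proof -
  obtain F \<omega> F1 \<omega>1 F2 \<omega>2 where eqs: "X = (F, \<omega>)" "Y = (F1, \<omega>1)" "Z = (F2, \<omega>2)" by (metis surj_pair)
  have fans: "rational_fan L F" "pure_dimensional d F" "rational_fan L F1" "pure_dimensional d F1"
    "rational_fan L F2" "pure_dimensional d F2"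
    using X Y Z unfolding eqs tropical_fans_def by auto
  note max = maximal_cones_eq[OF fans(1,2)] maximal_cones_eq[OF fans(3,4)] maximal_cones_eq[OF fans(5,6)]
  show ?thesis
    unfolding refinement_def
  proof (intro conjI ballI impI)
    show "\<Union>(essential_fan Z) = \<Union>(essential_fan X)" using refinementD(1)[OF ZY] refinementD(1)[OF YX] by simp
    show "\<exists>\<sigma>'\<in>essential_fan X. \<sigma> \<subseteq> \<sigma>'" if "\<sigma> \<in> essential_fan Z" for \<sigma>
      using refinementD(2)[OF ZY that] refinementD(2)[OF YX] by (meson subset_trans)
    fix \<sigma> \<sigma>'' assume \<sigma>: "\<sigma> \<in> maximal_cones (essential_fan Z)" and \<sigma>'': "\<sigma>'' \<in> maximal_cones (essential_fan X)"
      and sub: "\<sigma> \<subseteq> \<sigma>''"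
    have dim\<sigma>: "dim \<sigma> = d" using \<sigma> by (auto simp: eqs maximal_essential max)
    have "\<sigma> \<in> essential_fan Z" using \<sigma> by (simp add: maximal_cones_def)
    then obtain \<sigma>1 where \<sigma>1: "\<sigma>1 \<in> essential_fan Y" "\<sigma> \<subseteq> \<sigma>1" using refinementD(2)[OF ZY] by blast
    have finE: "finite (essential_fan Y)" "finite (essential_fan X)"
      using rational_fanD(1)[OF fans(1)] rational_fanD(1)[OF fans(3)] unfolding eqs essential_fan_def by auto
    obtain \<sigma>' where "\<sigma>' \<in> maximal_cones (essential_fan Y)" "\<sigma>1 \<subseteq> \<sigma>'"
      using maximal_cone_exists[OF finE(1) \<sigma>1(1)] by blast
    with \<sigma>1(2) have \<sigma>': "\<sigma>' \<in> maximal_cones (essential_fan Y)" "\<sigma> \<subseteq> \<sigma>'" by auto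
    then have "\<sigma>' \<in> essential_fan Y" by (simp add: maximal_cones_def)
    then obtain \<sigma>2 where \<sigma>2: "\<sigma>2 \<in> essential_fan X" "\<sigma>' \<subseteq> \<sigma>2" using refinementD(2)[OF YX] by blast
    obtain \<sigma>3 where "\<sigma>3 \<in> maximal_cones (essential_fan X)" "\<sigma>2 \<subseteq> \<sigma>3"
      using maximal_cone_exists[OF finE(2) \<sigma>2(1)] by blast
    with \<sigma>2(2) have \<sigma>3: "\<sigma>3 \<in> maximal_cones (essential_fan X)" "\<sigma>' \<subseteq> \<sigma>3" by auto
    have "\<sigma>3 \<subseteq> \<sigma>''"
      using fan_subset_of_dim[OF fans(1), of \<sigma>3 \<sigma>'' \<sigma>] \<sigma>3 \<sigma>'' \<sigma>'(2) sub dim\<sigma>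
      by (auto simp: eqs maximal_essential max)
    then have "\<sigma>3 = \<sigma>''" using \<sigma>3 \<sigma>'' unfolding maximal_cones_def by auto
    then show "snd Z \<sigma> = snd X \<sigma>''"
      using refinementD(3)[OF ZY \<sigma> \<sigma>'] refinementD(3)[OF YX \<sigma>'(1) \<sigma>3] by simp
  qed
qed

lemma rational_essential_fan:
  assumes "rational_fan L F"
  shows "rational_fan L (essential_fan (F, \<omega>))"
proof -
  have sub: "essential_fan (F, \<omega>) \<subseteq> F" by (auto simp: essential_fan_def)
  have faces: "\<tau> \<in> essential_fan (F, \<omega>)" if "\<sigma> \<in> essential_fan (F, \<omega>)" "\<tau> face_of \<sigma>" "\<tau> \<noteq> {}" for \<sigma> \<tau>
  proof -
    have "\<tau> \<subseteq> \<sigma>" using that(2) by (rule face_of_imp_subset)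
    moreover have "\<tau> \<in> F" using rational_fanD(3)[OF assms _ that(2,3)] that(1) sub by blast
    ultimately show ?thesis using that(1) unfolding essential_fan_def by auto
  qed
  show ?thesis
    unfolding rational_fan_def
  proof (intro conjI ballI allI impI)
    show "finite (essential_fan (F, \<omega>))" using sub rational_fanD(1)[OF assms] finite_subset by blast
    show "rational_cone L \<sigma>" if "\<sigma> \<in> essential_fan (F, \<omega>)" for \<sigma>
      using rational_fanD(2)[OF assms] sub that by blast
    show "\<tau> \<in> essential_fan (F, \<omega>)" if "\<sigma> \<in> essential_fan (F, \<omega>)" "\<tau> face_of \<sigma> \<and> \<tau> \<noteq> {}" for \<sigma> \<tau>
      using faces[of \<sigma> \<tau>] that by blast
    fix \<sigma> \<tau> assume "\<sigma> \<in> essential_fan (F, \<omega>)" "\<tau> \<in> essential_fan (F, \<omega>)"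
    then have "\<sigma> \<in> F" "\<tau> \<in> F" using sub by blast+
    then show "\<sigma> \<inter> \<tau> face_of \<sigma>" "\<sigma> \<inter> \<tau> face_of \<tau>" using rational_fanD(4,5)[OF assms] by simp_all
  qed
qed

section \<open>Piecewise linear functions and piecewise polynomials on a fan cycle\<close>

context euclidean_lattice
begin

text \<open>One cut for each form; later cuts pass to subcones and keep the signs already
  fixed.\<close>

lemma refine_sign_constant:
  assumes "finite S" "S \<subseteq> dual_lattice L" "X \<in> tropical_fans L d"
  shows "\<exists>Z\<in>tropical_fans L d. refinement Z X \<and> (\<forall>C\<in>fst Z. sign_constant S C)"
  using assms(1,2)
proof (induction S rule: finite_induct)
  case empty
  show ?case using assms(3) refinement_refl[of X] by (intro bexI[of _ X]) (auto simp: sign_constant_def)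
next
  case (insert l S)
  then obtain Y where Y: "Y \<in> tropical_fans L d" "refinement Y X" "\<forall>C\<in>fst Y. sign_constant S C" by auto
  obtain F \<omega> where F: "Y = (F, \<omega>)" by fastforce
  interpret hyperplane_cut L d F \<omega> l
    using Y(1) insert.prems F by unfold_locales auto
  let ?Z = "(F', \<omega>')"
  have "refinement ?Z X"
    using refinement_trans[OF assms(3) Y(1) cut_tropical _ Y(2)] cut_refinement F by simp
  moreover have "sign_constant (insert l S) C" if "C \<in> F'" for C
  proof -
    obtain \<sigma> h where \<sigma>: "\<sigma> \<in> F" "h \<in> sides l" "C = \<sigma> \<inter> h" using \<open>C \<in> F'\<close> unfolding cut_fan_def by blast
    have "sign_constant S C" using Y(3) \<sigma> F by (auto intro: sign_constant_mono)
    then show ?thesis using \<sigma>(2,3) by (auto simp: sign_constant_def sides_def)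
  qed
  ultimately show ?case using cut_tropical by (intro bexI[of _ ?Z]) auto
qed

lemma pl_continuous: "f \<in> pl_functions M \<Longrightarrow> continuous_on A f"
proof (induction rule: pl_functions.induct)
  case (form l)
  then have "bounded_linear l" using dual_latticeD(1) linear_conv_bounded_linear by blast
  then show ?case by (rule linear_continuous_on)
qed (auto intro: continuous_intros)

lemma pl_in_PP:
  assumes f: "f \<in> pl_functions L" and X: "X \<in> tropical_fans L d"
  obtains Z where "Z \<in> tropical_fans L d" "refinement Z X" "f \<in> PP L 1 (essential_fan Z)"
proof -
  obtain S T where st: "pl_walls L f S T" using pl_walls_exist[OF f] by blast
  note st = pl_wallsD[OF st]
  obtain Z where Z: "Z \<in> tropical_fans L d" "refinement Z X" "\<forall>C\<in>fst Z. sign_constant S C"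
    using refine_sign_constant[OF st(1,2) X] by blast
  have "\<exists>p\<in>sym_power 1 (L \<inter> span \<sigma>). \<forall>x\<in>\<sigma>. f x = p x" if \<sigma>: "\<sigma> \<in> essential_fan Z" for \<sigma>
  proof -
    have "\<sigma> \<in> fst Z" using \<sigma> by (auto simp: essential_fan_def split: prod.splits)
    then obtain m where m: "m \<in> T" "\<forall>x\<in>\<sigma>. f x = m x" using st(5) Z(3) by blast
    have "m \<in> sym_power (Suc 0) L" using m(1) st(4) by (intro sym_power_form) auto
    then have "m \<in> sym_power 1 (L \<inter> span \<sigma>)" using sym_power_mono[of m 1 L] by auto
    then show ?thesis using m(2) by blast
  qed
  then have "f \<in> PP L 1 (essential_fan Z)" using pl_continuous[OF f] by (auto simp: PP_def)
  then show ?thesis using that Z by blast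
qed

text \<open>Every factor \<open>g i j\<close> receives its own fan structure, as
  \<open>PP_cycle\<close> permits. Each of these refines a common refinement Z of X and Y, hence X,
  and thereby witnesses its own membership in the class C.\<close>

theorem PP_cycle_sum_of_products:
  assumes C: "C \<in> fan_cycles L d" and f: "f \<in> PP_cycle L k C"
  shows "\<exists>(n::nat) (c :: nat \<Rightarrow> int) (g :: nat \<Rightarrow> nat \<Rightarrow> 'a \<Rightarrow> real).
     (\<forall>i<n. \<forall>j<k. g i j \<in> PP_cycle L 1 C) \<and>
     (\<forall>x\<in>cycle_support C. f x = (\<Sum>i<n. of_int (c i) * (\<Prod>j<k. g i j x)))"
proof -
  obtain X where X: "X \<in> tropical_fans L d" "C = fan_equiv L d `` {X}"
    using C unfolding fan_cycles_def by (rule quotientE)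
  obtain Y where Y: "Y \<in> C" "f \<in> PP L k (essential_fan Y)" using f unfolding PP_cycle_def by blast
  have "(X, Y) \<in> fan_equiv L d" using X(2) Y(1) by blast
  then obtain Z where Z: "Y \<in> tropical_fans L d" "Z \<in> tropical_fans L d" "refinement Z X" "refinement Z Y"
    unfolding fan_equiv_def by blast
  \<comment> \<open>The representation is obtained on the support of Y, whereas
    \<open>cycle_support\<close> is a union over all fan structures.\<close>
  have support: "\<Union>(essential_fan X') = \<Union>(essential_fan X)" if "X' \<in> C" for X'
  proof -
    have "(X, X') \<in> fan_equiv L d" using X(2) that by blast
    then obtain W where "refinement W X" "refinement W X'" unfolding fan_equiv_def by blast
    then show ?thesis using refinementD(1) by metis
  qed
  obtain F \<omega> where F: "Y = (F, \<omega>)" by fastforce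
  have "rational_fan L (essential_fan Y)"
    using Z(1) rational_essential_fan unfolding F tropical_fans_def by blast
  then obtain p where p: "p \<in> pl_power k L" "\<forall>x\<in>\<Union>(essential_fan Y). f x = p x"
    using PP_pl_power Y(2) by blast
  obtain n :: nat and c :: "nat \<Rightarrow> int" and g where "(\<forall>i<n. \<forall>j<k. g i j \<in> pl_functions L) \<and>
    (\<forall>x. p x = (\<Sum>i<n. of_int (c i) * (\<Prod>j<k. g i j x)))"
    using pl_power_sum_of_products[OF p(1)] by (elim exE) (rule that)
  then have g: "\<And>i j. i < n \<Longrightarrow> j < k \<Longrightarrow> g i j \<in> pl_functions L"
    "\<And>x. p x = (\<Sum>i<n. of_int (c i) * (\<Prod>j<k. g i j x))" by blast+
  have "g i j \<in> PP_cycle L 1 C" if "i < n" "j < k" for i j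
  proof -
    obtain Z' where Z': "Z' \<in> tropical_fans L d" "refinement Z' Z" "g i j \<in> PP L 1 (essential_fan Z')"
      using pl_in_PP[OF g(1)[OF \<open>i < n\<close> \<open>j < k\<close>] Z(2)] by blast
    have "refinement Z' X" using refinement_trans[OF X(1) Z(2) Z'(1,2) Z(3)] .
    then have "Z' \<in> C" using X Z'(1) refinement_refl[of Z'] unfolding fan_equiv_def by blast
    then show ?thesis using Z'(3) unfolding PP_cycle_def by blast
  qed
  moreover have "f x = (\<Sum>i<n. of_int (c i) * (\<Prod>j<k. g i j x))" if "x \<in> cycle_support C" for x
  proof -
    have "x \<in> \<Union>(essential_fan Y)" using \<open>x \<in> cycle_support C\<close> support Y(1) unfolding cycle_support_def by blast
    then have "f x = p x" using p(2) by blast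
    then show ?thesis using g(2) by simp
  qed
  ultimately show ?thesis by (intro exI[of _ n] exI[of _ c] exI[of _ g]) blast
qed

end

theorem proposition3p12:
  fixes L :: "'a::euclidean_space set"
  assumes "is_lattice L"
  shows "(\<forall>F k f. unimodular_fan L F \<and> f \<in> PP L k F \<longrightarrow>
            (\<exists>a. (\<forall>\<sigma>\<in>F. dim \<sigma> \<le> k \<longrightarrow> a \<sigma> \<in> sym_power (k - dim \<sigma>) L) \<and>
                 (\<forall>x\<in>\<Union>F. f x = (\<Sum>\<sigma> \<in> {\<sigma>\<in>F. dim \<sigma> \<le> k}. a \<sigma> x * Psi_cone L F \<sigma> x))))
       \<and> (\<forall>d C k f. C \<in> fan_cycles L d \<and> f \<in> PP_cycle L k C \<longrightarrow>
            (\<exists>(n::nat) (c :: nat \<Rightarrow> int) (g :: nat \<Rightarrow> nat \<Rightarrow> 'a \<Rightarrow> real).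
                 (\<forall>i<n. \<forall>j<k. g i j \<in> PP_cycle L 1 C) \<and>
                 (\<forall>x\<in>cycle_support C. f x = (\<Sum>i<n. of_int (c i) * (\<Prod>j<k. g i j x)))))"
proof -
  interpret euclidean_lattice L by unfold_locales (rule assms)
  show ?thesis
    by (intro conjI allI impI; elim conjE)
      (rule unimodular.PP_representation[OF unimodular.intro[OF euclidean_lattice_axioms
          unimodular_axioms.intro]] PP_cycle_sum_of_products; assumption)+
qed

end
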